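(* Let $H=(V,E)$ be a finite connected graph (multiple edges and loops allowed) which is not a cycle and has minimal degree at least $2$, with $V=[r]=\{1,\dots,r\}$ and $d$ unoriented edges. Let $F_d$ be the free group with free generators $g_1,\dots,g_d$, where each $g_i$ is associated with a directed edge $(u_i,v_i)$ of $H$ (one orientation chosen for each unoriented edge). Let $a=(a_1,\dots,a_d)\in\mathbb C^d$ with $a_i\neq0$ for all $i$, and $$p=\sum_{i=1}^d\bigl(a_iE_{v_iu_i}g_i+\bar a_iE_{v_iu_i}^*g_i^{-1}\bigr)\in M_r(\mathbb C)[F_d].$$ Then there exists a finite set $D\subset\mathbb R$ such that the following holds. The spectrum $\sigma(\lambda(p))$ is a finite union of closed intervals and possibly a finite set of atoms $D_0$ with $D_0\subset D$. Moreover, any closed interval $I_0$ contained in the interior of $\sigma(\lambda(p))\setminus D$ satisfies conditions (ACmat) and (R4mat).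
   Context: $E_{vu}\in M_r(\mathbb R)$ is the matrix whose only non-zero entry is the entry $(v,u)$, equal to $1$. $M_r(\mathbb C)[F_d]$ is the set of finite sums $q=\sum_gq_gg$ with $q_g\in M_r(\mathbb C)$. $\lambda$ is the left regular representation of $F_d$ on $\ell^2(F_d)$, $\lambda(g)\delta_v=\delta_{gv}$, and $\lambda(p)=\sum_gp_g\otimes\lambda(g)$ acts on $\mathbb C^r\otimes\ell^2(F_d)$ (it is self-adjoint). $R^z=(\lambda(p)-z\,\mathrm{Id})^{-1}$, $\Im R^z=(R^z-(R^z)^* )/(2i)$, and for an operator $Q$ on $\mathbb C^r\otimes\ell^2(F_d)$, $Q(g,h)\in M_r(\mathbb C)$ denotes its $(g,h)$ block. $e$ is the unit, $|g|$ the word length for a fixed finite generating set, and $\|A\|_2=\sqrt{\mathrm{Tr}(AA^* )}$ on $M_r(\mathbb C)$. (ACmat) on $I_0$: there is $C_0\ge1$ with $C_0^{-1}\le\mathrm{Tr}\{(\Im R^z)(e,e)\}\le C_0$ for all $z=E+i\eta$, $E\in I_0$, $0<\eta\le1$. (R4mat) on $I_0$: for some $C_1'>2C_1+1$, $\displaystyle\lim_{\eta\to0}\sup_{\lambda_0\in I_0}\sum_{g\in F_d}\eta^2\|(\Im R^{\lambda_0+i\eta})(e,g)\|_2^4|g|^{C_1'}=0$, where $C_1$ is a rapid decay exponent of $F_d$: a constant $C_1>0$ for which there are $C>0$ and a finite generating set $S'$ such that $\|\sum_gq_g\lambda(g)\|_{\rm op}\le C(\mathrm{diam}_{S'}(q))^{C_1}(\sum_g|q_g|^2)^{1/2}$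 for all $q\in\mathbb C[F_d]$, $\mathrm{diam}_{S'}(q)$ being the maximum of $1$ and the diameter of the support of $q$ in $\mathrm{Cay}(F_d,S')$ (edges from $g$ to $sg$, $s\in S'$); such a constant exists (known fact). *)

theory Defs
  imports
    "Graph_Theory.Digraph_Component"
    "HOL-Library.Poly_Mapping"
    "HOL-Analysis.Analysis"
begin

section \<open>Graphs\<close>

text \<open>
  A finite multigraph with loops is given by one chosen orientation of each of its edges, as a
  \<^typ>\<open>('r, 'd) pre_digraph\<close>. Its connectedness is \<^const>\<open>Digraph_Component.connected\<close>, which is that
  of the underlying symmetric graph.
\<close>

text \<open>The degree in the unoriented multigraph; a loop contributes 2.\<close>

definition vertex_degree :: "('r, 'd) pre_digraph \<Rightarrow> 'r \<Rightarrow> nat" where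
  "vertex_degree H x = in_degree H x + out_degree H x"

text \<open>
  The cycles with \<open>n \<ge> 1\<close> vertices: \<open>n = 1\<close> is one vertex with one loop, \<open>n = 2\<close> is two vertices
  joined by a double edge. The orientation of the edges plays no role.
\<close>

definition is_cycle :: "('r, 'd) pre_digraph \<Rightarrow> bool" where
  "is_cycle H \<longleftrightarrow> (\<exists>n>0. \<exists>w e.
     bij_betw w {..<n} (verts H) \<and> bij_betw e {..<n} (arcs H) \<and>
     (\<forall>k<n. {tail H (e k), head H (e k)} = {w k, w (Suc k mod n)}))"


section \<open>Free groups\<close>

text \<open>
  The free group on \<open>'d\<close>: words in the letters \<open>(i, True)\<close>, standing for \<open>g\<^sub>i\<close>, and \<open>(i, False)\<close>,
  standing for its inverse, modulo the equivalence generated by cancelling adjacent inverse letters.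
\<close>

inductive cancel_step :: "('d \<times> bool) list \<Rightarrow> ('d \<times> bool) list \<Rightarrow> bool" where
  "cancel_step (xs @ (i, b) # (i, \<not> b) # ys) (xs @ ys)"

abbreviation word_eq :: "('d \<times> bool) list \<Rightarrow> ('d \<times> bool) list \<Rightarrow> bool" where
  "word_eq \<equiv> equivclp cancel_step"

quotient_type 'd free_group = "('d \<times> bool) list" / word_eq
  by (rule equivp_evquivclp)

definition word_inv :: "('d \<times> bool) list \<Rightarrow> ('d \<times> bool) list" where
  "word_inv xs = rev (map (\<lambda>(i, b). (i, \<not> b)) xs)"

lemma cancel_step_append_right: "cancel_step xs ys \<Longrightarrow> cancel_step (xs @ zs) (ys @ zs)"
  by (auto elim!: cancel_step.cases intro: cancel_step.intros)

lemma cancel_step_append_left: "cancel_step xs ys \<Longrightarrow> cancel_step (zs @ xs) (zs @ ys)"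
  by (auto elim!: cancel_step.cases simp flip: append_assoc intro: cancel_step.intros)

lemma cancel_step_word_inv:
  assumes "cancel_step xs ys" shows "cancel_step (word_inv xs) (word_inv ys)"
  using assms
proof cases
  case (1 us i b vs)
  show ?thesis
    using cancel_step.intros[of "word_inv vs" i b "word_inv us"]
    by (simp add: 1 word_inv_def)
qed

lemma word_eq_map:
  assumes "\<And>xs ys. cancel_step xs ys \<Longrightarrow> cancel_step (f xs) (f ys)" and "word_eq xs ys"
  shows "word_eq (f xs) (f ys)"
  using assms(2)
  by (induction rule: equivclp_induct) (auto intro: equivclp_into_equivclp assms(1))

lemma word_eq_word_inv_append: "word_eq (word_inv xs @ xs) []"
proof (induction xs)
  case (Cons x xs)
  obtain i b where x: "x = (i, b)" by (cases x)
  have "cancel_step (word_inv xs @ (i, \<not> b) # (i, \<not> \<not> b) # xs) (word_inv xs @ xs)"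
    by (rule cancel_step.intros)
  then have "word_eq (word_inv (x # xs) @ x # xs) (word_inv xs @ xs)"
    by (auto simp: x word_inv_def intro: r_into_equivclp)
  with Cons.IH show ?case by (blast intro: equivclp_trans)
qed (simp add: word_inv_def)

instantiation free_group :: (type) "{monoid_mult, inverse}"
begin

lift_definition one_free_group :: "'a free_group" is "[]" .

lift_definition times_free_group :: "'a free_group \<Rightarrow> 'a free_group \<Rightarrow> 'a free_group" is "(@)"
proof -
  fix xs xs' ys ys' :: "('a \<times> bool) list"
  assume "word_eq xs xs'" and "word_eq ys ys'"
  then have "word_eq (xs @ ys) (xs' @ ys)" and "word_eq (xs' @ ys) (xs' @ ys')"
    using word_eq_map[of "\<lambda>xs. xs @ ys", OF cancel_step_append_right]
      word_eq_map[of "(@) xs'", OF cancel_step_append_left] by blast+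
  then show "word_eq (xs @ ys) (xs' @ ys')" by (rule equivclp_trans)
qed

lift_definition inverse_free_group :: "'a free_group \<Rightarrow> 'a free_group" is word_inv
  by (rule word_eq_map[OF cancel_step_word_inv])

definition divide_free_group :: "'a free_group \<Rightarrow> 'a free_group \<Rightarrow> 'a free_group" where
  "divide_free_group g h = g * inverse h"

instance
  by standard (transfer, simp)+

end

lemma free_group_left_inverse: "inverse g * g = (1 :: 'd free_group)"
  by transfer (rule word_eq_word_inv_append)

lift_definition free_gen :: "'d \<Rightarrow> 'd free_group" is "\<lambda>i. [(i, True)]" .

lifting_forget free_group.lifting

definition words_over :: "'d free_group set \<Rightarrow> 'd free_group list set" where
  "words_over S = lists (S \<union> inverse ` S)"

definition generates :: "'d free_group set \<Rightarrow> bool" where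
  "generates S \<longleftrightarrow> prod_list ` words_over S = UNIV"

definition word_length :: "'d free_group set \<Rightarrow> 'd free_group \<Rightarrow> nat" where
  "word_length S g = (LEAST n. \<exists>ws \<in> words_over S. length ws = n \<and> prod_list ws = g)"

text \<open>The Cayley graph has an edge from \<open>g\<close> to \<open>s g\<close>; distances ignore the orientation.\<close>

definition cayley_adj :: "'d free_group set \<Rightarrow> 'd free_group \<Rightarrow> 'd free_group \<Rightarrow> bool" where
  "cayley_adj S g h \<longleftrightarrow> (\<exists>s\<in>S. h = s * g \<or> g = s * h)"

definition cayley_dist :: "'d free_group set \<Rightarrow> 'd free_group \<Rightarrow> 'd free_group \<Rightarrow> nat" where
  "cayley_dist S g h = (LEAST n. (cayley_adj S ^^ n) g h)"


section \<open>The Hilbert space of square-summable functions\<close>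

typedef 'x ell2 = "{f :: 'x \<Rightarrow> complex. (\<lambda>x. (cmod (f x))\<^sup>2) summable_on UNIV}"
  morphisms ell2_apply Abs_ell2
  by (rule exI[of _ "\<lambda>_. 0"]) simp

setup_lifting type_definition_ell2

lemma square_summable_lincomb:
  fixes f g :: "'x \<Rightarrow> complex"
  assumes "(\<lambda>x. (cmod (f x))\<^sup>2) summable_on UNIV" and "(\<lambda>x. (cmod (g x))\<^sup>2) summable_on UNIV"
  shows "(\<lambda>x. (cmod (a * f x + b * g x))\<^sup>2) summable_on UNIV"
proof (rule summable_on_comparison_test)
  show "(\<lambda>x. 2 * (cmod a)\<^sup>2 * (cmod (f x))\<^sup>2 + 2 * (cmod b)\<^sup>2 * (cmod (g x))\<^sup>2) summable_on UNIV"
    by (intro summable_on_add summable_on_cmult_right assms)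
  fix x
  have "(cmod (a * f x + b * g x))\<^sup>2 \<le> (cmod (a * f x) + cmod (b * g x))\<^sup>2"
    by (intro power_mono norm_triangle_ineq) simp
  also have "\<dots> \<le> 2 * (cmod (a * f x))\<^sup>2 + 2 * (cmod (b * g x))\<^sup>2"
    using sum_squares_bound[of "cmod (a * f x)" "cmod (b * g x)"]
    by (simp add: power2_sum)
  finally show "(cmod (a * f x + b * g x))\<^sup>2
      \<le> 2 * (cmod a)\<^sup>2 * (cmod (f x))\<^sup>2 + 2 * (cmod b)\<^sup>2 * (cmod (g x))\<^sup>2"
    by (simp add: norm_mult power_mult_distrib)
qed simp

lemma ell2_square_summable: "(\<lambda>x. (cmod (ell2_apply f x))\<^sup>2) summable_on UNIV"
  using ell2_apply[of f] by simp

lift_definition scaleC_ell2 :: "complex \<Rightarrow> 'x ell2 \<Rightarrow> 'x ell2" (infixr "*\<^sub>C" 75)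
  is "\<lambda>c f x. c * f x"
  subgoal for c f using square_summable_lincomb[of f f c 0] by simp
  done

lemma ell2_inner_summable: "(\<lambda>x. ell2_apply f x \<bullet> ell2_apply g x) summable_on UNIV"
proof (rule abs_summable_summable, rule summable_on_comparison_test)
  show "(\<lambda>x. (cmod (ell2_apply f x))\<^sup>2 + (cmod (ell2_apply g x))\<^sup>2) summable_on UNIV"
    by (intro summable_on_add ell2_square_summable)
  fix x
  have "\<bar>ell2_apply f x \<bullet> ell2_apply g x\<bar> \<le> cmod (ell2_apply f x) * cmod (ell2_apply g x)"
    by (rule Cauchy_Schwarz_ineq2)
  also have "\<dots> \<le> (cmod (ell2_apply f x))\<^sup>2 + (cmod (ell2_apply g x))\<^sup>2"
    using sum_squares_bound[of "cmod (ell2_apply f x)" "cmod (ell2_apply g x)"]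
      mult_nonneg_nonneg[OF norm_ge_zero[of "ell2_apply f x"] norm_ge_zero[of "ell2_apply g x"]]
    by linarith
  finally show "norm (ell2_apply f x \<bullet> ell2_apply g x)
      \<le> (cmod (ell2_apply f x))\<^sup>2 + (cmod (ell2_apply g x))\<^sup>2"
    by simp
qed simp

definition ell2_norm :: "'x ell2 \<Rightarrow> real" where
  "ell2_norm f = sqrt (\<Sum>\<^sub>\<infinity>x. (cmod (ell2_apply f x))\<^sup>2)"

text \<open>
  The library's inner product class is real: \<open>f \<bullet> g\<close> is the real part of the complex inner product
  \<open>cinner\<close> below, so that it induces the usual norm.
\<close>

instantiation ell2 :: (type) real_inner
begin

lift_definition zero_ell2 :: "'a ell2" is "\<lambda>_. 0" by simp

lift_definition plus_ell2 :: "'a ell2 \<Rightarrow> 'a ell2 \<Rightarrow> 'a ell2" is "\<lambda>f g x. f x + g x"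
  subgoal for f g using square_summable_lincomb[of f g 1 1] by simp
  done

lift_definition minus_ell2 :: "'a ell2 \<Rightarrow> 'a ell2 \<Rightarrow> 'a ell2" is "\<lambda>f g x. f x - g x"
  subgoal for f g using square_summable_lincomb[of f g 1 "-1"] by simp
  done

lift_definition uminus_ell2 :: "'a ell2 \<Rightarrow> 'a ell2" is "\<lambda>f x. - f x" by simp

definition scaleR_ell2 :: "real \<Rightarrow> 'a ell2 \<Rightarrow> 'a ell2" where
  "c *\<^sub>R f = complex_of_real c *\<^sub>C f"

definition inner_ell2 :: "'a ell2 \<Rightarrow> 'a ell2 \<Rightarrow> real" where
  "f \<bullet> g = (\<Sum>\<^sub>\<infinity>x. ell2_apply f x \<bullet> ell2_apply g x)"

definition norm_ell2 :: "'a ell2 \<Rightarrow> real" where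
  "norm_ell2 f = ell2_norm f"

definition sgn_ell2 :: "'a ell2 \<Rightarrow> 'a ell2" where
  "sgn_ell2 f = inverse (ell2_norm f) *\<^sub>R f"

definition dist_ell2 :: "'a ell2 \<Rightarrow> 'a ell2 \<Rightarrow> real" where
  "dist_ell2 f g = ell2_norm (f - g)"

definition uniformity_ell2 :: "('a ell2 \<times> 'a ell2) filter" where
  "uniformity_ell2 = (INF e\<in>{0<..}. principal {(f, g). ell2_norm (f - g) < e})"

definition open_ell2 :: "'a ell2 set \<Rightarrow> bool" where
  "open_ell2 U = (\<forall>f\<in>U. eventually (\<lambda>(f', g). f' = f \<longrightarrow> g \<in> U)
    (INF e\<in>{0<..}. principal {(f, g). ell2_norm (f - g) < e}))"

instance
proof
  fix f g h :: "'a ell2" and r s :: real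
  show "f + g + h = f + (g + h)" by transfer (simp add: add.assoc)
  show "f + g = g + f" by transfer (simp add: add.commute)
  show "0 + f = f" by transfer simp
  show "- f + f = 0" by transfer simp
  show "f - g = f + - g" by transfer simp
  show "r *\<^sub>R (f + g) = r *\<^sub>R f + r *\<^sub>R g"
    unfolding scaleR_ell2_def by transfer (simp add: distrib_left)
  show "(r + s) *\<^sub>R f = r *\<^sub>R f + s *\<^sub>R f"
    unfolding scaleR_ell2_def by transfer (simp add: distrib_right)
  show "r *\<^sub>R s *\<^sub>R f = (r * s) *\<^sub>R f"
    unfolding scaleR_ell2_def by transfer (simp add: mult.assoc)
  show "1 *\<^sub>R f = f"
    unfolding scaleR_ell2_def by transfer simp
  show "f \<bullet> g = g \<bullet> f" by (simp add: inner_ell2_def inner_commute)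
  show "(f + g) \<bullet> h = f \<bullet> h + g \<bullet> h"
    by (simp add: inner_ell2_def plus_ell2.rep_eq inner_add_left infsum_add ell2_inner_summable)
  have "ell2_apply (r *\<^sub>R f) = (\<lambda>x. r *\<^sub>R ell2_apply f x)"
    by (simp add: scaleR_ell2_def scaleC_ell2.rep_eq scaleR_conv_of_real)
  then show "(r *\<^sub>R f) \<bullet> g = r * (f \<bullet> g)"
    by (simp add: inner_ell2_def infsum_cmult_right')
  show "0 \<le> f \<bullet> f" by (simp add: inner_ell2_def infsum_nonneg)
  show "f \<bullet> f = 0 \<longleftrightarrow> f = 0"
  proof
    assume "f \<bullet> f = 0"
    then have "ell2_apply f x \<bullet> ell2_apply f x = 0" for x
      using nonneg_infsum_le_0D[OF _ ell2_inner_summable[of f f], of x] by (simp add: inner_ell2_def)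
    then show "f = 0" by (simp add: zero_ell2.rep_eq fun_eq_iff flip: ell2_apply_inject)
  qed (simp add: inner_ell2_def zero_ell2.rep_eq)
  show "norm f = sqrt (f \<bullet> f)"
    by (simp add: norm_ell2_def ell2_norm_def inner_ell2_def power2_norm_eq_inner)
qed (simp_all add: norm_ell2_def sgn_ell2_def dist_ell2_def uniformity_ell2_def open_ell2_def)

end

definition cinner :: "'x ell2 \<Rightarrow> 'x ell2 \<Rightarrow> complex" where
  "cinner f g = (\<Sum>\<^sub>\<infinity>x. cnj (ell2_apply f x) * ell2_apply g x)"

lift_definition ell2_delta :: "'x \<Rightarrow> 'x ell2" is "\<lambda>x y. if y = x then 1 else 0"
  subgoal for x
    using summable_on_cong_neutral[of "{x}" UNIV
        "\<lambda>y. (cmod (if y = x then 1 else 0))\<^sup>2" "\<lambda>y. (cmod (if y = x then 1 else 0))\<^sup>2"]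
    by simp
  done


section \<open>Operators\<close>

definition op_adjoint :: "('x ell2 \<Rightarrow> 'x ell2) \<Rightarrow> 'x ell2 \<Rightarrow> 'x ell2" where
  "op_adjoint Q = (THE Q'. \<forall>f g. cinner (Q' f) g = cinner f (Q g))"

definition op_Im :: "('x ell2 \<Rightarrow> 'x ell2) \<Rightarrow> 'x ell2 \<Rightarrow> 'x ell2" where
  "op_Im Q f = (1 / (2 * \<i>)) *\<^sub>C (Q f - op_adjoint Q f)"

definition op_shift :: "('x ell2 \<Rightarrow> 'x ell2) \<Rightarrow> complex \<Rightarrow> 'x ell2 \<Rightarrow> 'x ell2" where
  "op_shift T z f = T f - z *\<^sub>C f"

definition resolvent :: "('x ell2 \<Rightarrow> 'x ell2) \<Rightarrow> complex \<Rightarrow> 'x ell2 \<Rightarrow> 'x ell2" where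
  "resolvent T z = inv (op_shift T z)"

definition spectrum :: "('x ell2 \<Rightarrow> 'x ell2) \<Rightarrow> complex set" where
  "spectrum T = {z. \<not> (bij (op_shift T z) \<and> bounded_linear (resolvent T z))}"

definition eigenvalue :: "('x ell2 \<Rightarrow> 'x ell2) \<Rightarrow> complex \<Rightarrow> bool" where
  "eigenvalue T z \<longleftrightarrow> (\<exists>f. f \<noteq> 0 \<and> T f = z *\<^sub>C f)"


section \<open>The left regular representation\<close>

lemma free_group_left_mult_bij: "bij (\<lambda>h. g * h :: 'd free_group)"
proof -
  have right: "g * inverse g = 1" for g :: "'d free_group"
    by (metis free_group_left_inverse mult.assoc mult_1_left mult_1_right)
  show ?thesis
    by (rule bij_betw_byWitness[where f' = "\<lambda>h. inverse g * h"])
      (auto simp: free_group_left_inverse right simp flip: mult.assoc)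
qed

text \<open>\<open>(\<lambda>(g) f)(h) = f(g\<inverse> h)\<close>, that is, \<open>\<lambda>(g) \<delta>\<^sub>v = \<delta>\<^bsub>g v\<^esub>\<close>.\<close>

lift_definition left_regular :: "'d free_group \<Rightarrow> 'd free_group ell2 \<Rightarrow> 'd free_group ell2"
  is "\<lambda>g f h. f (inverse g * h)"
  subgoal for g f
    using summable_on_reindex_bij_betw[OF free_group_left_mult_bij[of "inverse g"],
        of "\<lambda>h. (cmod (f h))\<^sup>2"]
    by simp
  done

lemma left_regular_delta: "left_regular g (ell2_delta v) = ell2_delta (g * v)"
proof -
  have "inverse g * h = v \<longleftrightarrow> h = g * v" for h
    by (metis free_group_left_inverse mult.assoc mult_1_left mult_1_right)
  then show ?thesis by transfer auto
qed

text \<open>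
  The Hilbert space \<open>\<complex>\<^sup>r \<otimes> \<ell>\<^sup>2(X)\<close> is \<open>\<ell>\<^sup>2([r] \<times> X)\<close>, with \<open>e\<^sub>i \<otimes> \<delta>\<^sub>x = \<delta>\<^bsub>(i, x)\<^esub>\<close>; an element is
  the family of its \<open>r\<close> components in \<open>\<ell>\<^sup>2(X)\<close>.
\<close>

lift_definition component :: "'r \<Rightarrow> ('r \<times> 'x) ell2 \<Rightarrow> 'x ell2" is "\<lambda>i f x. f (i, x)"
  subgoal for i f
    using summable_on_reindex[of "Pair i" UNIV "\<lambda>y. (cmod (f y))\<^sup>2"]
      summable_on_subset_banach[of "\<lambda>y. (cmod (f y))\<^sup>2" UNIV "range (Pair i)"]
    by (simp add: inj_def o_def)
  done

lemma square_summable_of_components: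
  fixes F :: "'r::finite \<Rightarrow> 'x \<Rightarrow> complex"
  assumes "\<And>i. (\<lambda>x. (cmod (F i x))\<^sup>2) summable_on UNIV"
  shows "(\<lambda>(i, x). (cmod (F i x))\<^sup>2) summable_on UNIV"
proof -
  have "(\<lambda>(i, x). (cmod (F i x))\<^sup>2) summable_on (\<Union>i. range (Pair i))"
  proof (rule summable_on_finite_union_disjoint)
    show "(\<lambda>(i, x). (cmod (F i x))\<^sup>2) summable_on range (Pair i)" for i
      using assms[of i] by (subst summable_on_reindex) (auto simp: inj_def o_def)
  qed auto
  moreover have "(\<Union>i. range (Pair i)) = (UNIV :: ('r \<times> 'x) set)" by auto
  ultimately show ?thesis by simp
qed

lift_definition of_components :: "('r::finite \<Rightarrow> 'x ell2) \<Rightarrow> ('r \<times> 'x) ell2"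
  is "\<lambda>F (i, x). F i x"
  subgoal for F
    using square_summable_of_components[of F] by (auto simp: case_prod_unfold)
  done

definition op_tensor ::
    "complex^'r^'r \<Rightarrow> ('x ell2 \<Rightarrow> 'x ell2) \<Rightarrow> ('r::finite \<times> 'x) ell2 \<Rightarrow> ('r \<times> 'x) ell2" where
  "op_tensor A T f = of_components (\<lambda>i. \<Sum>j\<in>UNIV. A $ i $ j *\<^sub>C T (component j f))"

text \<open>
  Group-ring elements with coefficients in \<open>'c\<close> are the finitely supported functions
  \<^typ>\<open>'d free_group \<Rightarrow>\<^sub>0 'c\<close>, and \<open>Poly_Mapping.single g c\<close> is the element \<open>c g\<close>.
\<close>

definition lambda_scalar ::
    "('d free_group \<Rightarrow>\<^sub>0 complex) \<Rightarrow> 'd free_group ell2 \<Rightarrow> 'd free_group ell2" where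
  "lambda_scalar q f = (\<Sum>g\<in>Poly_Mapping.keys q. Poly_Mapping.lookup q g *\<^sub>C left_regular g f)"

definition lambda_matrix ::
    "('d free_group \<Rightarrow>\<^sub>0 complex^'r^'r) \<Rightarrow>
      ('r::finite \<times> 'd free_group) ell2 \<Rightarrow> ('r \<times> 'd free_group) ell2" where
  "lambda_matrix p f = (\<Sum>g\<in>Poly_Mapping.keys p.
     op_tensor (Poly_Mapping.lookup p g) (left_regular g) f)"

definition block ::
    "(('r::finite \<times> 'x) ell2 \<Rightarrow> ('r \<times> 'x) ell2) \<Rightarrow> 'x \<Rightarrow> 'x \<Rightarrow> complex^'r^'r" where
  "block Q g h = (\<chi> i j. cinner (ell2_delta (i, g)) (Q (ell2_delta (j, h))))"


section \<open>Rapid decay\<close>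

definition support_diam :: "'d free_group set \<Rightarrow> ('d free_group \<Rightarrow>\<^sub>0 complex) \<Rightarrow> nat" where
  "support_diam S q = Max (insert 1 {cayley_dist S g h | g h.
     g \<in> Poly_Mapping.keys q \<and> h \<in> Poly_Mapping.keys q})"

definition rapid_decay_exponent :: "'d itself \<Rightarrow> real \<Rightarrow> bool" where
  "rapid_decay_exponent _ C1 \<longleftrightarrow> C1 > 0 \<and>
    (\<exists>C>0. \<exists>S :: 'd free_group set. finite S \<and> generates S \<and>
      (\<forall>q. onorm (lambda_scalar q)
          \<le> C * real (support_diam S q) powr C1 *
            sqrt (\<Sum>g\<in>Poly_Mapping.keys q. (cmod (Poly_Mapping.lookup q g))\<^sup>2)))"


section \<open>The conditions on the resolvent\<close>

definition conj_transpose :: "complex^'n^'m \<Rightarrow> complex^'m^'n" where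
  "conj_transpose A = (\<chi> i j. cnj (A $ j $ i))"

definition hs_norm :: "complex^'r^'r \<Rightarrow> real" where
  "hs_norm A = sqrt (Re (trace (A ** conj_transpose A)))"

abbreviation Im_resolvent ::
    "('d free_group \<Rightarrow>\<^sub>0 complex^'r^'r) \<Rightarrow> complex \<Rightarrow>
      ('r::finite \<times> 'd free_group) ell2 \<Rightarrow> ('r \<times> 'd free_group) ell2" where
  "Im_resolvent p z \<equiv> op_Im (resolvent (lambda_matrix p) z)"

text \<open>The trace below is real, as the imaginary part of an operator is self-adjoint.\<close>

definition ACmat :: "('d free_group \<Rightarrow>\<^sub>0 complex^'r::finite^'r) \<Rightarrow> real set \<Rightarrow> bool" where
  "ACmat p I0 \<longleftrightarrow> (\<exists>C0\<ge>1. \<forall>E\<in>I0. \<forall>\<eta>. 0 < \<eta> \<and> \<eta> \<le> 1 \<longrightarrow>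
     inverse C0 \<le> Re (trace (block (Im_resolvent p (Complex E \<eta>)) 1 1)) \<and>
     Re (trace (block (Im_resolvent p (Complex E \<eta>)) 1 1)) \<le> C0)"

text \<open>
  The sum and the supremum are taken in \<open>[0, \<infinity>]\<close>, so that the condition includes their finiteness
  for small \<open>\<eta>\<close>.
\<close>

definition R4mat ::
    "('d free_group \<Rightarrow>\<^sub>0 complex^'r::finite^'r) \<Rightarrow> 'd free_group set \<Rightarrow> real \<Rightarrow> real set \<Rightarrow> bool" where
  "R4mat p S C1 I0 \<longleftrightarrow> (\<exists>C1' > 2 * C1 + 1.
     ((\<lambda>\<eta>. SUP E\<in>I0. \<Sum>\<^sub>\<infinity>g. ennreal (\<eta>\<^sup>2 *
          hs_norm (block (Im_resolvent p (Complex E \<eta>)) 1 g) ^ 4 *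
          real (word_length S g) powr C1'))
      \<longlongrightarrow> 0) (at_right 0))"


section \<open>The operator associated with a weighted graph\<close>

text \<open>The matrix \<open>c E\<^bsub>v u\<^esub>\<close>.\<close>

definition matrix_unit :: "complex \<Rightarrow> 'r \<Rightarrow> 'r \<Rightarrow> complex^'r^'r" where
  "matrix_unit c v u = (\<chi> x y. if x = v \<and> y = u then c else 0)"

text \<open>The edge \<open>i\<close> of \<open>H\<close> is directed from \<open>u\<^sub>i = tail H i\<close> to \<open>v\<^sub>i = head H i\<close>.\<close>

definition graph_poly ::
    "('r::finite, 'd) pre_digraph \<Rightarrow> ('d \<Rightarrow> complex) \<Rightarrow> 'd free_group \<Rightarrow>\<^sub>0 complex^'r^'r" where
  "graph_poly H a = (\<Sum>i\<in>arcs H.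
     Poly_Mapping.single (free_gen i) (matrix_unit (a i) (head H i) (tail H i)) +
     Poly_Mapping.single (inverse (free_gen i))
       (conj_transpose (matrix_unit (a i) (head H i) (tail H i))))"

end

theory Submission imports Defs "HOL-Complex_Analysis.Complex_Analysis" begin

text \<open>
  The Cayley graph of the free group is a tree, so the resolvent entries of \<open>\<lambda>(p)\<close> are products along
  non-backtracking walks of \<open>H\<close> of finitely many functions \<open>\<zeta>\<^sub>k\<close>, indexed by the darts and the vertices
  of \<open>H\<close>, which solve a Riccati system \<open>\<zeta>\<^sub>k (z + \<Sum>\<^sub>l w\<^sub>k\<^sub>l \<zeta>\<^sub>l) = -1\<close>. The \<open>\<zeta>\<^sub>k\<close> are algebraic over
  \<open>\<complex>(z)\<close>: otherwise a nonzero derivation of a field of Laurent series would vanish on \<open>\<complex>(z)\<close> but not on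
  some \<open>\<zeta>\<^sub>k\<close>, contradicting the linearised system, which is a contraction for large \<open>Im z\<close>. Hence they are
  bounded and Lipschitz up to the real axis outside a finite set \<open>D\<close>.

  Non-backtracking walks on \<open>H\<close> are irreducible because \<open>H\<close> is not a cycle; so at a real \<open>E\<close> outside \<open>D\<close>
  either all boundary values have positive imaginary part, or all are real near \<open>E\<close>, and then the
  resolvent extends holomorphically through \<open>E\<close> by reflection. The first case describes the bands
  and gives (ACmat); an isolated point of the spectrum is an eigenvalue by its residues. On the
  bands, the energy \<open>|\<psi>(w)|\<^sup>2 Im \<zeta>\<^sub>k / |\<zeta>\<^sub>k|\<^sup>2\<close> of a walk \<open>w\<close> ending in the state \<open>k\<close> does not increase
  in total from one length to the next, while every walk loses a fixed fraction of it at each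
  branching. So the energies decay exponentially and fourth powers are summable against any power
  of the length, uniformly in \<open>z\<close>: this is (R4mat), with any exponent.
\<close>

section \<open>Extending derivations\<close>

text \<open>Algebraicity goes through derivations because elimination in a polynomial system with
  several unknowns may degenerate, whereas a derivation acts on the given solution and meets only
  the linearised system at one point. Its values are uncontrolled; Laurent series suit it because
  any values have a lowest order, and the coefficients of that order satisfy a complex linear
  system. Lipschitz bounds, and not mere continuity, matter on the real axis: if all boundary values
  at E are real, the quotients Im \<zeta>_k(E + i \<eta>) / \<eta> stay bounded, and this bounded
  vector certifies that the boundary values are real in a whole neighbourhood of E. Continuity alone
  would not exclude a single real point between nonreal ones. The choice of the solution is
  immaterial: the columns built from any solution solve the resolvent equation, and T - z is
  injective for nonreal z. Fourth powers split into two pairs: one is bounded by the largest energy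
  of a level, which decays, the other by the total energy of the level, which stays bounded.\<close>

definition is_subfield :: "'a::field set \<Rightarrow> bool" where
  "is_subfield F \<longleftrightarrow> 0 \<in> F \<and> 1 \<in> F \<and>
     (\<forall>x\<in>F. \<forall>y\<in>F. x + y \<in> F \<and> x * y \<in> F) \<and> (\<forall>x\<in>F. - x \<in> F \<and> inverse x \<in> F)"

text \<open>The values of \<open>D\<close> may lie outside \<open>F\<close>: a derivation takes
  values in the ambient field, so an extension never has to enlarge a codomain.\<close>

definition derivation_on :: "'a::field set \<Rightarrow> ('a \<Rightarrow> 'a) \<Rightarrow> bool" where
  "derivation_on F D \<longleftrightarrow>
     (\<forall>x\<in>F. \<forall>y\<in>F. D (x + y) = D x + D y \<and> D (x * y) = x * D y + D x * y)"

definition polys_over :: "'a::field set \<Rightarrow> 'a poly set" where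
  "polys_over F = {P. \<forall>i. coeff P i \<in> F}"

definition transcendental_over :: "'a::field set \<Rightarrow> 'a \<Rightarrow> bool" where
  "transcendental_over F x \<longleftrightarrow> (\<forall>P\<in>polys_over F. poly P x = 0 \<longrightarrow> P = 0)"

lemma is_subfield_sum: "is_subfield F \<Longrightarrow> (\<And>i. i \<in> A \<Longrightarrow> f i \<in> F) \<Longrightarrow> sum f A \<in> F"
  by (induction A rule: infinite_finite_induct) (auto simp: is_subfield_def)

lemma polys_over_add: "is_subfield F \<Longrightarrow> P \<in> polys_over F \<Longrightarrow> Q \<in> polys_over F \<Longrightarrow> P + Q \<in> polys_over F"
  by (auto simp: polys_over_def is_subfield_def)

lemma polys_over_mult: "is_subfield F \<Longrightarrow> P \<in> polys_over F \<Longrightarrow> Q \<in> polys_over F \<Longrightarrow> P * Q \<in> polys_over F"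
  unfolding polys_over_def coeff_mult mem_Collect_eq
  by (intro allI is_subfield_sum) (auto simp: is_subfield_def)

lemma polys_over_uminus: "is_subfield F \<Longrightarrow> P \<in> polys_over F \<Longrightarrow> - P \<in> polys_over F"
  by (auto simp: polys_over_def is_subfield_def)

lemma polys_over_diff: "is_subfield F \<Longrightarrow> P \<in> polys_over F \<Longrightarrow> Q \<in> polys_over F \<Longrightarrow> P - Q \<in> polys_over F"
  using polys_over_add[of F P "- Q"] polys_over_uminus[of F Q] by simp

lemma polys_over_monom: "is_subfield F \<Longrightarrow> c \<in> F \<Longrightarrow> monom c n \<in> polys_over F"
  by (auto simp: polys_over_def is_subfield_def)

lemma polys_over_const: "is_subfield F \<Longrightarrow> c \<in> F \<Longrightarrow> [:c:] \<in> polys_over F"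
  using polys_over_monom[of F c 0] by (simp add: monom_0)

lemma derivation_on_0: "derivation_on F D \<Longrightarrow> is_subfield F \<Longrightarrow> D 0 = 0"
  by (metis add_cancel_right_left derivation_on_def is_subfield_def)

lemma derivation_on_sum:
  assumes "derivation_on F D" "is_subfield F" "\<And>i. i \<in> A \<Longrightarrow> f i \<in> F"
  shows "D (sum f A) = (\<Sum>i\<in>A. D (f i))"
  using assms(3)
proof (induction A rule: infinite_finite_induct)
  case (insert x A)
  have "sum f A \<in> F" using insert.prems by (intro is_subfield_sum assms(2)) auto
  then show ?case using insert assms(1) by (simp add: derivation_on_def)
qed (simp_all add: derivation_on_0[OF assms(1,2)])

lemma derivation_on_1: "derivation_on F D \<Longrightarrow> is_subfield F \<Longrightarrow> D 1 = 0"
  unfolding derivation_on_def is_subfield_def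
  by (metis add_cancel_right_right mult.right_neutral mult_1)

text \<open>The value at P(x) that is forced on every derivation extending \<open>D\<close> and
  sending x to u: apply \<open>D\<close> to the coefficients, then add P'(x) u.\<close>

definition formal_derivative :: "('a::field \<Rightarrow> 'a) \<Rightarrow> 'a \<Rightarrow> 'a \<Rightarrow> 'a poly \<Rightarrow> 'a" where
  "formal_derivative D x u P = poly (map_poly D P) x + poly (pderiv P) x * u"

lemma quotient_rule_add:
  fixes q q' :: "'a::field"
  assumes "q \<noteq> 0" "q' \<noteq> 0"
  shows "((p * dq' + dp * q' + (p' * dq + dp' * q)) * (q * q') - (p * q' + p' * q) * (q * dq' + dq * q')) / (q * q')\<^sup>2
    = (dp * q - p * dq) / q\<^sup>2 + (dp' * q' - p' * dq') / q'\<^sup>2"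
proof -
  have "(dp * q - p * dq) / q\<^sup>2 + (dp' * q' - p' * dq') / q'\<^sup>2 = ((dp * q - p * dq) * q'\<^sup>2 + (dp' * q' - p' * dq') * q\<^sup>2) / (q\<^sup>2 * q'\<^sup>2)"
    using assms by (intro add_frac_eq) auto
  then show ?thesis by (simp add: power2_eq_square algebra_simps)
qed

lemma quotient_rule_mult:
  fixes q q' :: "'a::field"
  assumes "q \<noteq> 0" "q' \<noteq> 0"
  shows "((p * dp' + dp * p') * (q * q') - p * p' * (q * dq' + dq * q')) / (q * q')\<^sup>2
    = p / q * ((dp' * q' - p' * dq') / q'\<^sup>2) + (dp * q - p * dq) / q\<^sup>2 * (p' / q')"
proof -
  have "p / q * ((dp' * q' - p' * dq') / q'\<^sup>2) + (dp * q - p * dq) / q\<^sup>2 * (p' / q')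
    = (p * q * (dp' * q' - p' * dq') + (dp * q - p * dq) * p' * q') / (q * q')\<^sup>2"
    using assms by (simp add: add_divide_distrib power2_eq_square mult_ac)
  then show ?thesis by (simp add: power2_eq_square algebra_simps)
qed
text \<open>Independence of the fraction chosen: the last hypothesis is the derived form of the
  equation p q1 = p1 q.\<close>

lemma quotient_rule_unique:
  fixes q q1 :: "'a::field"
  assumes "q \<noteq> 0" "q1 \<noteq> 0" and "p * q1 = p1 * q" "p * dq1 + dp * q1 = p1 * dq + dp1 * q"
  shows "(dp * q - p * dq) / q\<^sup>2 = (dp1 * q1 - p1 * dq1) / q1\<^sup>2"
proof -
  have "(dp * q - p * dq) * q1\<^sup>2 = (dp1 * q1 - p1 * dq1) * q\<^sup>2"
    using assms(3,4) by algebra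
  then show ?thesis using assms(1,2) by (simp add: frac_eq_eq)
qed

section \<open>Extension of a derivation from F to F(x)\<close>

context
  fixes F :: "'a::field_char_0 set" and D
  assumes F: "is_subfield F" and D: "derivation_on F D"
begin

lemma formal_derivative_add:
  assumes "P \<in> polys_over F" "Q \<in> polys_over F"
  shows "formal_derivative D x u (P + Q) = formal_derivative D x u P + formal_derivative D x u Q"
proof -
  have "map_poly D (P + Q) = map_poly D P + map_poly D Q"
    using assms D derivation_on_0[OF D F]
    by (intro poly_eqI) (auto simp: coeff_map_poly derivation_on_def polys_over_def)
  then show ?thesis by (simp add: formal_derivative_def pderiv_add algebra_simps)
qed

lemma formal_derivative_mult:
  assumes "P \<in> polys_over F" "Q \<in> polys_over F"
  shows "formal_derivative D x u (P * Q) =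
    poly P x * formal_derivative D x u Q + formal_derivative D x u P * poly Q x"
proof -
  have "D (coeff (P * Q) n) = (\<Sum>i\<le>n. D (coeff P i * coeff Q (n - i)))" for n
    unfolding coeff_mult using assms F
    by (intro derivation_on_sum[OF D F]) (auto simp: polys_over_def is_subfield_def)
  also have "\<dots> n = (\<Sum>i\<le>n. coeff P i * D (coeff Q (n - i)) + D (coeff P i) * coeff Q (n - i))" for n
    using assms D by (intro sum.cong) (auto simp: derivation_on_def polys_over_def)
  finally have "map_poly D (P * Q) = P * map_poly D Q + map_poly D P * Q"
    using derivation_on_0[OF D F]
    by (intro poly_eqI) (simp add: coeff_map_poly coeff_mult sum.distrib)
  then show ?thesis by (simp add: formal_derivative_def pderiv_mult algebra_simps)
qed

lemma formal_derivative_const: "formal_derivative D x u [:c:] = D c"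
  using derivation_on_0[OF D F] by (simp add: formal_derivative_def map_poly_pCons pderiv_pCons)

lemma formal_derivative_uminus:
  assumes "P \<in> polys_over F"
  shows "formal_derivative D x u (- P) = - formal_derivative D x u P"
proof -
  have "formal_derivative D x u (P + - P) = formal_derivative D x u P + formal_derivative D x u (- P)"
    by (rule formal_derivative_add[OF assms polys_over_uminus[OF F assms]])
  then show ?thesis using formal_derivative_const[of x u 0] derivation_on_0[OF D F]
    by (simp add: eq_neg_iff_add_eq_0 add.commute)
qed

lemma formal_derivative_diff:
  assumes "P \<in> polys_over F" "Q \<in> polys_over F"
  shows "formal_derivative D x u (P - Q) = formal_derivative D x u P - formal_derivative D x u Q"
  using formal_derivative_add[OF assms(1) polys_over_uminus[OF F assms(2)]]
  by (simp add: formal_derivative_uminus[OF assms(2)])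

text \<open>The field F(x) is taken as the set of fractions P(x)/Q(x), and the extension is given by
  the quotient rule. The hypothesis on u says exactly that relations P(x) = 0 are respected, which
  makes the rule independent of the fraction.\<close>

lemma derivation_adjoin:
  assumes u: "\<And>P. P \<in> polys_over F \<Longrightarrow> poly P x = 0 \<Longrightarrow> formal_derivative D x u P = 0"
  shows "\<exists>F' D'. is_subfield F' \<and> derivation_on F' D' \<and> F \<subseteq> F' \<and> x \<in> F' \<and> D' x = u \<and> (\<forall>y\<in>F. D' y = D y)"
proof -
  let ?d = "formal_derivative D x u"
  define R where "R y P Q \<longleftrightarrow> P \<in> polys_over F \<and> Q \<in> polys_over F \<and> poly Q x \<noteq> 0 \<and> y = poly P x / poly Q x" for y P Q
  define F' where "F' = {y. \<exists>P Q. R y P Q}"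
  define val where "val P Q = (?d P * poly Q x - poly P x * ?d Q) / (poly Q x)\<^sup>2" for P Q
  define D' where "D' y = (SOME v. \<exists>P Q. R y P Q \<and> v = val P Q)" for y
  have uniq: "val P Q = val P1 Q1" if "R y P Q" "R y P1 Q1" for y P Q P1 Q1
  proof -
    have mem: "P \<in> polys_over F" "Q \<in> polys_over F" "P1 \<in> polys_over F" "Q1 \<in> polys_over F"
      and nz: "poly Q x \<noteq> 0" "poly Q1 x \<noteq> 0" using that by (auto simp: R_def)
    have "poly P x = y * poly Q x" "poly P1 x = y * poly Q1 x" using that(1)[unfolded R_def] that(2)[unfolded R_def] by (metis nonzero_eq_divide_eq)+
    then have eq: "poly P x * poly Q1 x = poly P1 x * poly Q x" by simp
    \<comment> \<open>The polynomial P Q1 - P1 Q vanishes at x because both fractions equal y, so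
      the hypothesis on u applies to it.\<close>
    have "?d (P * Q1 - P1 * Q) = 0"
      using mem eq F by (intro u polys_over_diff polys_over_mult) auto
    then have e2: "poly P x * ?d Q1 + ?d P * poly Q1 x = poly P1 x * ?d Q + ?d P1 * poly Q x"
      using mem F by (simp add: formal_derivative_diff formal_derivative_mult polys_over_mult)
    show ?thesis unfolding val_def using nz eq e2 by (rule quotient_rule_unique)
  qed
  have D': "D' y = val P Q" if "R y P Q" for y P Q
    unfolding D'_def
  proof (rule some_equality)
    show "\<exists>P' Q'. R y P' Q' \<and> val P Q = val P' Q'" using that by blast
    show "v = val P Q" if "\<exists>P Q. R y P Q \<and> v = val P Q" for v
      using that uniq[OF \<open>R y P Q\<close>] by auto
  qed
  have R_add: "R (y + y') (P * Q' + P' * Q) (Q * Q')" if "R y P Q" "R y' P' Q'" for y y' P Q P' Q'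
    using that F unfolding R_def
    by (auto simp: add_frac_eq intro!: polys_over_add polys_over_mult)
  have R_mult: "R (y * y') (P * P') (Q * Q')" if "R y P Q" "R y' P' Q'" for y y' P Q P' Q'
    using that F unfolding R_def by (auto intro!: polys_over_mult)
  have R_F: "R y [:y:] 1" if "y \<in> F" for y
    using that F polys_over_const[OF F, of y] polys_over_const[OF F, of 1]
    by (auto simp: R_def is_subfield_def one_pCons)
  have 0: "0 \<in> F" and 1: "1 \<in> F" using F by (auto simp: is_subfield_def)
  have X: "[:0, 1:] \<in> polys_over F"
    using polys_over_monom[OF F 1, of 1] by (simp add: monom_altdef)
  have R_x: "R x [:0, 1:] 1" using X R_F[OF 1] by (auto simp: R_def)
  have sub: "is_subfield F'"
    unfolding is_subfield_def
  proof (intro conjI ballI)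
    show "0 \<in> F'" "1 \<in> F'" using R_F 0 1 by (auto simp: F'_def)
    fix y assume "y \<in> F'"
    then obtain P Q where R: "R y P Q" by (auto simp: F'_def)
    have "R (- y) (- P) Q" using R F by (auto simp: R_def intro: polys_over_uminus)
    then show "- y \<in> F'" by (auto simp: F'_def)
    show "inverse y \<in> F'"
    proof (cases "y = 0")
      case False
      then have "R (inverse y) Q P" using R by (auto simp: R_def)
      then show ?thesis by (auto simp: F'_def)
    qed (use R_F 0 in \<open>auto simp: F'_def\<close>)
    fix y' assume "y' \<in> F'"
    then obtain P' Q' where R': "R y' P' Q'" by (auto simp: F'_def)
    show "y + y' \<in> F'" using R_add[OF R R'] unfolding F'_def by blast
    show "y * y' \<in> F'" using R_mult[OF R R'] unfolding F'_def by blast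
  qed
  have der: "derivation_on F' D'"
    unfolding derivation_on_def
  proof (intro conjI ballI)
    fix y y' assume "y \<in> F'" "y' \<in> F'"
    then obtain P Q P' Q' where R: "R y P Q" and R': "R y' P' Q'" by (auto simp: F'_def)
    have mem: "P \<in> polys_over F" "Q \<in> polys_over F" "P' \<in> polys_over F" "Q' \<in> polys_over F"
      and nz: "poly Q x \<noteq> 0" "poly Q' x \<noteq> 0" using R R' by (auto simp: R_def)
    have y: "y = poly P x / poly Q x" "y' = poly P' x / poly Q' x" using R R' by (auto simp: R_def)
    show "D' (y + y') = D' y + D' y'"
      unfolding D'[OF R] D'[OF R'] D'[OF R_add[OF R R']] val_def using mem nz F
      by (simp add: formal_derivative_add formal_derivative_mult polys_over_mult quotient_rule_add)
    show "D' (y * y') = y * D' y' + D' y * y'"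
      unfolding D'[OF R] D'[OF R'] D'[OF R_mult[OF R R']] val_def unfolding y using mem nz F
      by (simp add: formal_derivative_mult polys_over_mult quotient_rule_mult)
  qed
  have d1: "?d 1 = 0" using formal_derivative_const[of x u 1] derivation_on_1[OF D F] by (simp add: one_pCons)
  have "D' x = u" unfolding D'[OF R_x] val_def
    using derivation_on_0[OF D F] derivation_on_1[OF D F] d1
    by (simp add: formal_derivative_def map_poly_pCons pderiv_pCons)
  moreover have "D' y = D y" if "y \<in> F" for y
    unfolding D'[OF R_F[OF that]] val_def using d1 by (simp add: formal_derivative_const)
  moreover have "F \<subseteq> F'" "x \<in> F'" using R_F R_x by (auto simp: F'_def)
  ultimately show ?thesis using sub der by (intro exI[of _ F'] exI[of _ D']) simp
qed

text \<open>For transcendental x there is no relation to respect. For algebraic x with minimal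
  polynomial m, the relation m(x) = 0 dictates u, and it can be solved for u since m'(x) is nonzero
  in characteristic 0.\<close>

lemma compatible_derivative_exists:
  "\<exists>u. \<forall>P\<in>polys_over F. poly P x = 0 \<longrightarrow> formal_derivative D x u P = 0"
proof (cases "transcendental_over F x")
  case True
  then show ?thesis using formal_derivative_const[of x _ 0] derivation_on_0[OF D F]
    by (auto simp: transcendental_over_def)
next
  case False
  let ?A = "\<lambda>P. P \<in> polys_over F \<and> poly P x = 0 \<and> P \<noteq> 0"
  define m where "m = arg_min degree ?A"
  obtain P0 where "?A P0" using False unfolding transcendental_over_def by blast
  then have m: "?A m" unfolding m_def by (rule arg_min_natI)
  have min: "degree m \<le> degree P" if "?A P" for P
    unfolding m_def using arg_min_nat_le[of ?A P degree] that by blast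
  have deg: "degree m > 0"
  proof (rule gr_zeroI)
    assume "degree m = 0"
    then obtain c where "m = [:c:]" by (rule degree_eq_zeroE)
    then show False using m by simp
  qed
  have pd: "poly (pderiv m) x \<noteq> 0"
  proof
    assume "poly (pderiv m) x = 0"
    moreover have "pderiv m \<noteq> 0" using deg by (simp add: pderiv_eq_0_iff)
    moreover have "of_nat n * c \<in> F" if "c \<in> F" for n c
      using that F by (induction n) (auto simp: is_subfield_def algebra_simps)
    then have "pderiv m \<in> polys_over F" using m by (simp add: polys_over_def coeff_pderiv del: of_nat_Suc)
    ultimately have "degree m \<le> degree (pderiv m)" by (intro min) auto
    then show False using deg by (simp add: degree_pderiv)
  qed
  \<comment> \<open>The solution of \<open>formal_derivative D x u m = 0\<close>. All other
    relations are then reached by division by m.\<close>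
  define u where "u = - poly (map_poly D m) x / poly (pderiv m) x"
  let ?d = "formal_derivative D x u"
  have dm: "?d m = 0" using pd by (simp add: formal_derivative_def u_def)
  have "?d P = 0" if "P \<in> polys_over F" "poly P x = 0" for P
    using that
  proof (induction "degree P" arbitrary: P rule: less_induct)
    case less
    show ?case
    proof (cases "P = 0")
      case True
      then show ?thesis using formal_derivative_const[of x u 0] derivation_on_0[OF D F] by simp
    next
      case False
      then have le: "degree m \<le> degree P" using less min by auto
      \<comment> \<open>As m need not be monic, P is multiplied by the leading coefficient of m
        before its top term is cancelled by a multiple of m.\<close>
      define A where "A = [:lead_coeff m:]"
      define B where "B = monom (lead_coeff P) (degree P - degree m)"
      have mem: "A \<in> polys_over F" "B \<in> polys_over F" "m \<in> polys_over F"
        using m less.prems F unfolding A_def B_def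
        by (auto intro!: polys_over_const polys_over_monom) (auto simp: polys_over_def)
      define P1 where "P1 = A * P - B * m"
      have P1: "P1 \<in> polys_over F" "poly P1 x = 0"
        using mem less.prems F m unfolding P1_def by (auto intro!: polys_over_diff polys_over_mult)
      have dP1: "?d P1 = lead_coeff m * ?d P"
      proof -
        have "?d P1 = poly A x * ?d P + ?d A * poly P x - (poly B x * ?d m + ?d B * poly m x)"
          unfolding P1_def using mem less.prems(1) F
          by (simp only: formal_derivative_diff formal_derivative_mult polys_over_mult)
        then show ?thesis using less.prems(2) m dm by (simp add: A_def)
      qed
      have lm: "lead_coeff m \<noteq> 0" using m by simp
      have "?d P1 = 0"
      proof (cases "P1 = 0")
        case True
        then show ?thesis using formal_derivative_const[of x u 0] derivation_on_0[OF D F] by simp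
      next
        case nz: False
        have dA: "degree (A * P) \<le> degree P" unfolding A_def by simp
        have dB: "degree (B * m) \<le> degree P"
          using degree_mult_le[of B m] le degree_monom_le[of "lead_coeff P" "degree P - degree m"]
          by (simp add: B_def)
        have "degree P1 \<le> degree P" unfolding P1_def by (intro degree_diff_le dA dB)
        moreover have "coeff (B * m) (degree P) = lead_coeff P * lead_coeff m"
          unfolding B_def using le by (simp add: coeff_monom_mult)
        then have "coeff P1 (degree P) = 0" unfolding P1_def A_def by simp
        ultimately have "degree P1 < degree P"
          using nz by (metis leading_coeff_0_iff le_neq_implies_less)
        then show ?thesis using less.hyps P1 by blast
      qed
      then show ?thesis using dP1 lm by simp
    qed
  qed
  then show ?thesis by blast
qed

end

lemma derivation_adjoin_finite:
  fixes F :: "'a::field_char_0 set"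
  assumes F: "is_subfield F" and D: "derivation_on F D" and "finite Y"
  shows "\<exists>F' D'. is_subfield F' \<and> derivation_on F' D' \<and> F \<subseteq> F' \<and> Y \<subseteq> F' \<and> (\<forall>y\<in>F. D' y = D y)"
  using assms(3)
proof induction
  case empty
  then show ?case using F D by blast
next
  case (insert x Y)
  then obtain F' D' where *: "is_subfield F'" "derivation_on F' D'" "F \<subseteq> F'" "Y \<subseteq> F'" "\<forall>y\<in>F. D' y = D y"
    by blast
  obtain u where u: "\<forall>P\<in>polys_over F'. poly P x = 0 \<longrightarrow> formal_derivative D' x u P = 0"
    using compatible_derivative_exists[OF *(1,2)] by (rule exE)
  have "\<exists>F'' D''. is_subfield F'' \<and> derivation_on F'' D'' \<and> F' \<subseteq> F'' \<and> x \<in> F'' \<and> D'' x = u \<and> (\<forall>y\<in>F'. D'' y = D' y)"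
    using u by (intro derivation_adjoin[OF *(1,2)]) simp
  then obtain F'' D'' where
    1: "is_subfield F''" "derivation_on F'' D''" "F' \<subseteq> F''" "x \<in> F''" "\<forall>y\<in>F'. D'' y = D' y" by blast
  have "\<forall>y\<in>F. D'' y = D y" using *(3,5) 1(5) by (metis subsetD)
  moreover have "F \<subseteq> F''" "insert x Y \<subseteq> F''" using * 1 by blast+
  ultimately show ?case using 1(1,2) by (intro exI[of _ F''] exI[of _ D'']) simp
qed

text \<open>The zero derivation on F is extended by x to 1, which is free as x is transcendental,
  and then to each element of Y in turn. On Y the values are not controlled.\<close>

lemma transcendental_derivation:
  fixes F :: "'a::field_char_0 set"
  assumes F: "is_subfield F" and x: "transcendental_over F x" and Y: "finite Y"
  shows "\<exists>F' D. is_subfield F' \<and> derivation_on F' D \<and> F \<subseteq> F' \<and> x \<in> F' \<and> Y \<subseteq> F' \<and>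
    D x = 1 \<and> (\<forall>y\<in>F. D y = 0)"
proof -
  have D0: "derivation_on F (\<lambda>_. 0)" by (simp add: derivation_on_def)
  have "formal_derivative (\<lambda>_. 0) x 1 P = 0" if "P \<in> polys_over F" "poly P x = 0" for P
    using that x by (auto simp: transcendental_over_def formal_derivative_def)
  from derivation_adjoin[OF F D0 this] obtain F1 D1 where
    1: "is_subfield F1" "derivation_on F1 D1" "F \<subseteq> F1" "x \<in> F1" "D1 x = 1" "\<forall>y\<in>F. D1 y = 0"
    by auto
  from derivation_adjoin_finite[OF 1(1,2) Y] obtain F2 D2 where
    2: "is_subfield F2" "derivation_on F2 D2" "F1 \<subseteq> F2" "Y \<subseteq> F2" "\<forall>y\<in>F1. D2 y = D1 y" by blast
  have "\<forall>y\<in>F. D2 y = 0" "D2 x = 1" using 1 2(5) by (metis subsetD)+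
  moreover have "F \<subseteq> F2" "x \<in> F2" using 1 2 by blast+
  ultimately show ?thesis using 2(1,2,4) by (intro exI[of _ F2] exI[of _ D2]) simp
qed

section \<open>A system of Riccati equations\<close>

text \<open>The product form, unlike x_k = -1/(...), forces both factors to be nonzero and passes to
  limits and to derivations without a side condition.\<close>

definition green_eq :: "('k::finite \<Rightarrow> 'k \<Rightarrow> real) \<Rightarrow> complex \<Rightarrow> ('k \<Rightarrow> complex) \<Rightarrow> bool" where
  "green_eq w z x \<longleftrightarrow> (\<forall>k. x k * (z + (\<Sum>l\<in>UNIV. complex_of_real (w k l) * x l)) = - 1)"

abbreviation upper :: "complex set" where "upper \<equiv> {z. 0 < Im z}"

lemma open_upper: "open upper"
  by (simp add: open_halfspace_Im_gt)

lemma convex_upper: "convex upper"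
  by (simp add: convex_halfspace_Im_gt)

lemma connected_upper: "topological_space_class.connected upper"
  by (rule convex_connected[OF convex_upper])

definition green_solution :: "('k::finite \<Rightarrow> 'k \<Rightarrow> real) \<Rightarrow> ('k \<Rightarrow> complex \<Rightarrow> complex) \<Rightarrow> bool" where
  "green_solution w \<zeta> \<longleftrightarrow> (\<forall>k. \<zeta> k holomorphic_on upper \<and>
     (\<forall>z\<in>upper. 0 < Im (\<zeta> k z))) \<and> (\<forall>z\<in>upper. green_eq w z (\<lambda>k. \<zeta> k z))"

lemma finite_type_max: "\<exists>l. \<forall>m. f m \<le> f l" for f :: "'k::finite \<Rightarrow> real"
proof -
  have "Max (range f) \<in> range f" by (intro Max_in) auto
  then obtain l where "Max (range f) = f l" by (rule imageE)
  then show ?thesis using Max_ge[of "range f"] by (intro exI[of _ l]) auto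
qed

lemma eq_neg_inverse:
  fixes x u :: complex
  assumes "x * u = - 1" shows "x = - 1 / u"
proof -
  have "u \<noteq> 0" using assms by auto
  then show ?thesis using assms by (rule iffD2[OF nonzero_eq_divide_eq])
qed

lemma Im_neg_inverse: "Im (- 1 / u) = Im u / (cmod u)\<^sup>2"
  by (simp add: Im_divide cmod_def power2_eq_square)

text \<open>The map u to -1/u preserves the upper half-plane; with c = Im z this gives the a priori
  bound 1 / Im z for iterates and for solutions.\<close>

lemma Im_neg_inverse_bounds:
  assumes "0 < c" "c \<le> Im u"
  shows "0 < Im (- 1 / u)" "cmod (- 1 / u) \<le> 1 / c"
proof -
  have u: "u \<noteq> 0" using assms by auto
  then show "0 < Im (- 1 / u)" unfolding Im_neg_inverse using assms by simp
  have "c \<le> cmod u" using assms abs_Im_le_cmod[of u] by linarith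
  then show "cmod (- 1 / u) \<le> 1 / c" using assms(1) by (simp add: norm_divide frac_le)
qed

lemma nonzero_if_Im_pos: "0 < Im u \<Longrightarrow> u \<noteq> 0"
  by auto


section \<open>Existence of a solution by fixed-point iteration\<close>

fun green_iterate :: "('k::finite \<Rightarrow> 'k \<Rightarrow> real) \<Rightarrow> nat \<Rightarrow> 'k \<Rightarrow> complex \<Rightarrow> complex" where
  "green_iterate w 0 k z = - 1 / z"
| "green_iterate w (Suc n) k z =
     - 1 / (z + (\<Sum>l\<in>UNIV. complex_of_real (w k l) * green_iterate w n l z))"

declare green_iterate.simps [simp del]

lemma Im_le_Im_add_weighted_sum:
  fixes w :: "'k::finite \<Rightarrow> 'k \<Rightarrow> real"
  assumes "\<And>l. 0 \<le> w k l" "\<And>l. 0 \<le> Im (x l)"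
  shows "Im z \<le> Im (z + (\<Sum>l\<in>UNIV. complex_of_real (w k l) * x l))"
  using assms by (simp add: sum_nonneg)

text \<open>Montel's theorem for finitely many families at once: a further subsequence is extracted
  for each index, and the limits already obtained survive.\<close>

lemma convergent_subsequence_family:
  fixes f :: "nat \<Rightarrow> 'k \<Rightarrow> complex \<Rightarrow> complex"
  assumes "finite A" and S: "open S" and hol: "\<And>n k. f n k holomorphic_on S"
    and bdd: "\<And>K. compact K \<Longrightarrow> K \<subseteq> S \<Longrightarrow> \<exists>B. \<forall>n k. \<forall>z\<in>K. cmod (f n k z) \<le> B"
  shows "\<exists>r g. strict_mono (r :: nat \<Rightarrow> nat) \<and>
    (\<forall>k\<in>A. g k holomorphic_on S \<and> (\<forall>z\<in>S. (\<lambda>n. f (r n) k z) \<longlonglongrightarrow> g k z))"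
  using assms(1)
proof induction
  case empty
  show ?case by (intro exI[of _ "\<lambda>n. n"]) (simp add: strict_mono_def)
next
  case (insert k A)
  then obtain r g where r: "strict_mono r"
    and g: "\<And>k. k \<in> A \<Longrightarrow> g k holomorphic_on S"
      "\<And>k z. k \<in> A \<Longrightarrow> z \<in> S \<Longrightarrow> (\<lambda>n. f (r n) k z) \<longlonglongrightarrow> g k z" by blast
  obtain h r' where h: "h holomorphic_on S" "strict_mono r'"
    "\<And>z. z \<in> S \<Longrightarrow> (\<lambda>n. f (r (r' n)) k z) \<longlonglongrightarrow> h z"
  proof (rule Montel[of S "range (\<lambda>n. f n k)" "\<lambda>n. f (r n) k"])
    show "\<exists>B. \<forall>h\<in>range (\<lambda>n. f n k). \<forall>z\<in>K. cmod (h z) \<le> B" if "compact K" "K \<subseteq> S" for K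
      using bdd[OF that] by auto
  qed (use S hol in auto)
  have "(\<lambda>n. f (r (r' n)) k' z) \<longlonglongrightarrow> g k' z" if "k' \<in> A" "z \<in> S" for k' z
    using LIMSEQ_subseq_LIMSEQ[OF g(2)[OF that] h(2)] by (simp add: o_def)
  then show ?case using r h g(1) insert.hyps
    by (intro exI[of _ "r \<circ> r'"] exI[of _ "g(k := h)"]) (auto simp: strict_mono_def)
qed

context
  fixes w :: "'k::finite \<Rightarrow> 'k \<Rightarrow> real"
  assumes w_nonneg: "\<And>k l. 0 \<le> w k l"
begin

lemma green_iterate_bounds:
  assumes "0 < Im z"
  shows "0 < Im (green_iterate w n k z)" "cmod (green_iterate w n k z) \<le> 1 / Im z"
proof -
  have "0 < Im (green_iterate w n k z) \<and> cmod (green_iterate w n k z) \<le> 1 / Im z"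
  proof (induction n arbitrary: k)
    case 0
    show ?case unfolding green_iterate.simps using Im_neg_inverse_bounds[of "Im z" z] assms by simp
  next
    case (Suc n)
    show ?case unfolding green_iterate.simps
      using assms Im_neg_inverse_bounds[OF assms Im_le_Im_add_weighted_sum[of w k]] w_nonneg Suc
      by (simp add: less_imp_le)
  qed
  then show "0 < Im (green_iterate w n k z)" "cmod (green_iterate w n k z) \<le> 1 / Im z" by auto
qed

lemma green_iterate_denominator:
  assumes "0 < Im z"
  shows "z + (\<Sum>l\<in>UNIV. complex_of_real (w k l) * green_iterate w n l z) \<noteq> 0"
proof -
  have "0 < Im (z + (\<Sum>l\<in>UNIV. complex_of_real (w k l) * green_iterate w n l z))"
    using Im_le_Im_add_weighted_sum[of w k "\<lambda>l. green_iterate w n l z" z] assms w_nonneg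
      green_iterate_bounds(1)[OF assms, of n] by (simp add: less_imp_le)
  then show ?thesis by (rule nonzero_if_Im_pos)
qed

lemma green_iterate_Suc:
  assumes "0 < Im z"
  shows "green_iterate w (Suc n) k z * (z + (\<Sum>l\<in>UNIV. complex_of_real (w k l) * green_iterate w n l z)) = - 1"
  using green_iterate_denominator[OF assms] by (simp add: green_iterate.simps)

lemma green_iterate_holomorphic: "green_iterate w n k holomorphic_on upper"
proof (induction n arbitrary: k)
  case 0
  have "(\<lambda>z. - 1 / z) holomorphic_on upper" by (intro holomorphic_intros) auto
  then show ?case by (simp add: green_iterate.simps)
next
  case (Suc n)
  have "(\<lambda>z. - 1 / (z + (\<Sum>l\<in>UNIV. complex_of_real (w k l) * green_iterate w n l z))) holomorphic_on upper"
    using green_iterate_denominator by (intro holomorphic_intros Suc) auto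
  then show ?case by (simp add: green_iterate.simps)
qed

text \<open>Two successive iterates differ by a product of two factors of size at most 1 / Im z and
  the weighted differences of the preceding ones, so the factor per step is W / (Im z)^2, at most
  1/2.\<close>

lemma green_iterate_contraction:
  assumes W: "\<And>k. (\<Sum>l\<in>UNIV. w k l) \<le> W" and z: "0 < Im z" "2 * W \<le> (Im z)\<^sup>2"
  shows "cmod (green_iterate w (Suc n) k z - green_iterate w n k z) \<le> 2 / Im z * (1 / 2) ^ n"
proof (induction n arbitrary: k)
  case 0
  show ?case using add_mono[OF green_iterate_bounds(2)[OF z(1), of "Suc 0" k] green_iterate_bounds(2)[OF z(1), of 0 k]]
    by (intro norm_triangle_le_diff) simp
next
  case (Suc n)
  define a b where "a = green_iterate w (Suc (Suc n)) k z" and "b = green_iterate w (Suc n) k z"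
  define A B where "A = (\<Sum>l\<in>UNIV. complex_of_real (w k l) * green_iterate w (Suc n) l z)"
    and "B = (\<Sum>l\<in>UNIV. complex_of_real (w k l) * green_iterate w n l z)"
  have "a * (z + A) = - 1" "b * (z + B) = - 1"
    using green_iterate_Suc[OF z(1)] by (simp_all only: a_def b_def A_def B_def)
  \<comment> \<open>The resolvent identity in scalar form: subtract the two equations after
    multiplying each by the other unknown.\<close>
  then have e: "a - b = a * b * (A - B)" by algebra
  have "cmod (A - B) = cmod (\<Sum>l\<in>UNIV. complex_of_real (w k l) * (green_iterate w (Suc n) l z - green_iterate w n l z))"
    unfolding A_def B_def by (simp only: sum_subtractf right_diff_distrib)
  also have "\<dots> \<le> (\<Sum>l\<in>UNIV. w k l * (2 / Im z * (1 / 2) ^ n))"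
    using mult_left_mono[OF Suc w_nonneg] w_nonneg
    by (intro sum_norm_le) (simp only: norm_mult norm_of_real abs_of_nonneg)
  also have "\<dots> = (\<Sum>l\<in>UNIV. w k l) * (2 / Im z * (1 / 2) ^ n)" by (simp only: sum_distrib_right)
  also have "\<dots> \<le> W * (2 / Im z * (1 / 2) ^ n)" using z(1) by (intro mult_right_mono W) auto
  finally have AB: "cmod (A - B) \<le> W * (2 / Im z * (1 / 2) ^ n)" .
  have "cmod (a - b) = cmod a * cmod b * cmod (A - B)" unfolding e by (simp add: norm_mult)
  also have "\<dots> \<le> (1 / Im z) * (1 / Im z) * (W * (2 / Im z * (1 / 2) ^ n))"
    unfolding a_def b_def using green_iterate_bounds(2)[OF z(1)] z(1) AB by (intro mult_mono) auto
  also have "\<dots> = W / (Im z)\<^sup>2 * (2 / Im z * (1 / 2) ^ n)" by (simp add: power2_eq_square)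
  also have "\<dots> \<le> 1 / 2 * (2 / Im z * (1 / 2) ^ n)"
    using z by (intro mult_right_mono) (auto simp: field_simps)
  finally show ?case unfolding a_def b_def by simp
qed

text \<open>The contraction estimate is available only for large Im z. Elsewhere compactness
  provides a holomorphic limit of a subsequence, and the identity theorem carries the equation from
  the region of contraction to the half-plane.\<close>

theorem green_solution_exists: "\<exists>\<zeta>. green_solution w \<zeta>"
proof -
  have bdd: "\<exists>B. \<forall>n k. \<forall>z\<in>K. cmod (green_iterate w n k z) \<le> B" if K: "compact K" "K \<subseteq> upper" for K
  proof -
    have "continuous_on K (\<lambda>z. 1 / Im z)" using K by (intro continuous_intros) auto
    then have "bounded ((\<lambda>z. 1 / Im z) ` K)" using K(1) compact_continuous_image compact_imp_bounded by blast
    then obtain B where "\<And>z. z \<in> K \<Longrightarrow> norm (1 / Im z) \<le> B" unfolding bounded_iff by auto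
    note B = this
    have "cmod (green_iterate w n k z) \<le> B" if "z \<in> K" for n k z
    proof -
      have "0 < Im z" using K(2) that by blast
      then have "cmod (green_iterate w n k z) \<le> 1 / Im z" by (rule green_iterate_bounds(2))
      also have "\<dots> \<le> B" using B[OF that] \<open>0 < Im z\<close> by simp
      finally show ?thesis .
    qed
    then show ?thesis by blast
  qed
  obtain r g where r: "strict_mono (r :: nat \<Rightarrow> nat)" and hol: "\<And>k. g k holomorphic_on upper"
    and lim: "\<And>k z. z \<in> upper \<Longrightarrow> (\<lambda>n. green_iterate w (r n) k z) \<longlonglongrightarrow> g k z"
    using convergent_subsequence_family[of UNIV upper "green_iterate w", OF finite open_upper green_iterate_holomorphic bdd]
    by auto
  define W where "W = (\<Sum>k\<in>UNIV. \<Sum>l\<in>UNIV. w k l)"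
  have W: "(\<Sum>l\<in>UNIV. w k l) \<le> W" for k
    unfolding W_def by (intro member_le_sum sum_nonneg w_nonneg) auto
  have W0: "0 \<le> W" unfolding W_def by (intro sum_nonneg w_nonneg)
  \<comment> \<open>Above this height Im z is at least 1, so (Im z)^2 is at least Im z and hence at
    least 2 W.\<close>
  define U where "U = {z. 2 * W + 1 < Im z}"
  have eq_U: "g k z * (z + (\<Sum>l\<in>UNIV. complex_of_real (w k l) * g l z)) = - 1" if "z \<in> U" for k z
  proof -
    have "2 * W + 1 < Im z" using that by (simp add: U_def)
    moreover from this have "1 * Im z \<le> Im z * Im z" using W0 by (intro mult_right_mono) auto
    ultimately have z: "0 < Im z" "2 * W \<le> (Im z)\<^sup>2" 
      using W0 unfolding power2_eq_square by linarith+
    have lim0: "(\<lambda>n. 2 / Im z * (1 / 2) ^ n) \<longlonglongrightarrow> 0"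
      using tendsto_mult[OF tendsto_const[of "2 / Im z"] LIMSEQ_power_zero[of "1 / 2 :: real"]] by simp
    have "(\<lambda>n. green_iterate w (Suc n) k z - green_iterate w n k z) \<longlonglongrightarrow> 0"
      by (rule Lim_null_comparison[OF always_eventually lim0]) (intro allI green_iterate_contraction[OF W z])
    from LIMSEQ_subseq_LIMSEQ[OF this r]
    have "(\<lambda>n. (green_iterate w (Suc (r n)) k z - green_iterate w (r n) k z) + green_iterate w (r n) k z) \<longlonglongrightarrow> 0 + g k z"
      using lim z(1) by (intro tendsto_add) (auto simp: o_def)
    then have "(\<lambda>n. green_iterate w (Suc (r n)) k z) \<longlonglongrightarrow> g k z" by simp
    then have "(\<lambda>n. green_iterate w (Suc (r n)) k z * (z + (\<Sum>l\<in>UNIV. complex_of_real (w k l) * green_iterate w (r n) l z)))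
      \<longlonglongrightarrow> g k z * (z + (\<Sum>l\<in>UNIV. complex_of_real (w k l) * g l z))"
      using lim z(1) by (intro tendsto_intros) auto
    then have "(\<lambda>n. - 1 :: complex) \<longlonglongrightarrow> g k z * (z + (\<Sum>l\<in>UNIV. complex_of_real (w k l) * g l z))"
      by (simp only: green_iterate_Suc[OF z(1)])
    from LIMSEQ_unique[OF this tendsto_const] show ?thesis .
  qed
  have eq: "g k z * (z + (\<Sum>l\<in>UNIV. complex_of_real (w k l) * g l z)) = - 1" if "z \<in> upper" for k z
  proof (rule analytic_continuation_open[where s = U and s' = upper and g = "\<lambda>_. - 1"
        and f = "\<lambda>z. g k z * (z + (\<Sum>l\<in>UNIV. complex_of_real (w k l) * g l z))"])
    show "open U" unfolding U_def by (simp add: open_halfspace_Im_gt)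
    show "U \<noteq> {}" unfolding U_def by (auto intro: exI[of _ "Complex 0 (2 * W + 2)"])
    show "U \<subseteq> upper" unfolding U_def using W0 by auto
    show "(\<lambda>z. g k z * (z + (\<Sum>l\<in>UNIV. complex_of_real (w k l) * g l z))) holomorphic_on upper"
      by (intro holomorphic_intros hol)
  qed (fact open_upper connected_upper holomorphic_on_const eq_U that)+
  \<comment> \<open>Limits only keep Im nonnegative; strict positivity is recovered from the
    equation, whose denominator has imaginary part at least Im z.\<close>
  have pos: "0 < Im (g k z)" if "z \<in> upper" for k z
  proof -
    have nn: "0 \<le> Im (g l z)" for l
    proof (rule LIMSEQ_le_const)
      show "(\<lambda>n. Im (green_iterate w (r n) l z)) \<longlonglongrightarrow> Im (g l z)" by (intro tendsto_Im lim that)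
      show "\<exists>N. \<forall>n\<ge>N. 0 \<le> Im (green_iterate w (r n) l z)"
        using less_imp_le[OF green_iterate_bounds(1)] that by simp
    qed
    define u where "u = z + (\<Sum>l\<in>UNIV. complex_of_real (w k l) * g l z)"
    have "g k z * u = - 1" using eq[OF that] by (simp add: u_def)
    then have "g k z = - 1 / u" by (rule eq_neg_inverse)
    moreover have "Im z \<le> Im u" unfolding u_def by (intro Im_le_Im_add_weighted_sum w_nonneg nn)
    ultimately show ?thesis using Im_neg_inverse_bounds(1)[of "Im z" u] that by (simp only: mem_Collect_eq)
  qed
  show ?thesis unfolding green_solution_def green_eq_def
    by (intro exI[of _ g] conjI allI ballI hol pos eq)
qed

end

section \<open>Algebraicity of the solution\<close>

text \<open>The outer variable of P is x, the value of the function; the coefficients are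
  polynomials in z. Degree and \<open>pderiv\<close> of P therefore refer to x.\<close>

definition eval2 :: "complex poly poly \<Rightarrow> complex \<Rightarrow> complex \<Rightarrow> complex" where
  "eval2 P z x = poly (poly P [:x:]) z"

lemma eval2_altdef: "eval2 P z x = (\<Sum>i\<le>degree P. poly (coeff P i) z * x ^ i)"
  by (simp add: eval2_def poly_altdef[of P] poly_sum poly_power)

lemma eval2_add: "eval2 (P + Q) z x = eval2 P z x + eval2 Q z x"
  and eval2_diff: "eval2 (P - Q) z x = eval2 P z x - eval2 Q z x"
  and eval2_mult: "eval2 (P * Q) z x = eval2 P z x * eval2 Q z x"
  and eval2_smult: "eval2 (smult c P) z x = poly c z * eval2 P z x"
  and eval2_0: "eval2 0 z x = 0"
  by (simp_all add: eval2_def)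

lemma holomorphic_eval2:
  assumes "f holomorphic_on A"
  shows "(\<lambda>z. eval2 P z (f z)) holomorphic_on A"
  unfolding eval2_altdef by (intro holomorphic_intros assms)

text \<open>A power series has no negative powers, so only its constant term can reach the lowest
  order of Y. This turns a relation between Laurent series into one between lowest
  coefficients.\<close>

lemma fls_nth_fps_times_lowest:
  fixes G :: "'a::comm_ring_1 fps"
  assumes "\<And>n. n < N \<Longrightarrow> fls_nth Y n = 0"
  shows "fls_nth (fps_to_fls G * Y) N = fps_nth G 0 * fls_nth Y N"
proof (cases "Y = 0")
  case False
  define df where "df = fls_subdegree (fps_to_fls G)"
  define dg where "dg = fls_subdegree Y"
  have df: "0 \<le> df" unfolding df_def by (rule fls_subdegree_fls_to_fps_gt0)
  have dg: "N \<le> dg" unfolding dg_def using False assms by (intro fls_subdegree_geI)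
  have eq: "fls_nth (fps_to_fls G * Y) N = (\<Sum>i=df..N - dg. fls_nth (fps_to_fls G) i * fls_nth Y (N - i))"
    unfolding df_def dg_def by (rule fls_times_nth(2))
  show ?thesis
  proof (cases "df = 0 \<and> dg = N")
    case True
    then show ?thesis using eq by simp
  next
    case no: False
    then have "df > 0 \<or> N < dg" using df dg by auto
    then have "fps_nth G 0 * fls_nth Y N = 0"
    proof
      assume "df > 0"
      then have "0 < subdegree G" unfolding df_def by (simp add: fls_subdegree_fls_to_fps)
      then have "fps_nth G 0 = 0" by (rule nth_less_subdegree_zero)
      then show ?thesis by simp
    next
      assume "N < dg"
      then show ?thesis unfolding dg_def by simp
    qed
    moreover have "{df..N - dg} = {}" using no df dg by auto
    ultimately show ?thesis using eq by simp
  qed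
qed simp

lemma fps_to_fls_sum: "fps_to_fls (sum f A) = (\<Sum>i\<in>A. fps_to_fls (f i))"
  by (induction A rule: infinite_finite_induct) auto

definition fls_of_poly :: "complex poly \<Rightarrow> complex fls" where
  "fls_of_poly p = fps_to_fls (fps_of_poly p)"

text \<open>The field of rational functions, expanded at a base point z0; the formal variable stands
  for z - z0.\<close>

definition rational_fls :: "complex fls set" where
  "rational_fls = {fls_of_poly p / fls_of_poly q | p q. q \<noteq> 0}"

lemma fls_of_poly_simps:
  "fls_of_poly 0 = 0" "fls_of_poly 1 = 1"
  "fls_of_poly (p + q) = fls_of_poly p + fls_of_poly q"
  "fls_of_poly (p * q) = fls_of_poly p * fls_of_poly q"
  "fls_of_poly (- p) = - fls_of_poly p"
  by (simp_all add: fls_of_poly_def fps_of_poly_add fps_of_poly_mult fps_of_poly_uminus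
      fls_times_fps_to_fls)

lemma fls_of_poly_eq_0_iff: "fls_of_poly p = 0 \<longleftrightarrow> p = 0"
  using fps_of_poly_eq_iff[of p 0] by (simp add: fls_of_poly_def)

lemma rational_flsI: "q \<noteq> 0 \<Longrightarrow> fls_of_poly p / fls_of_poly q \<in> rational_fls"
  by (auto simp: rational_fls_def)

lemma fls_of_poly_rational: "fls_of_poly p \<in> rational_fls"
  using rational_flsI[of 1 p] by (simp add: fls_of_poly_simps)

lemma is_subfield_rational_fls: "is_subfield rational_fls"
  unfolding is_subfield_def
proof (intro conjI ballI)
  show "0 \<in> rational_fls" "1 \<in> rational_fls"
    using fls_of_poly_rational[of 0] fls_of_poly_rational[of 1] by (simp_all add: fls_of_poly_simps)
  fix x assume "x \<in> rational_fls"
  then obtain p q where x: "x = fls_of_poly p / fls_of_poly q" and q: "q \<noteq> 0"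
    by (auto simp: rational_fls_def)
  show "- x \<in> rational_fls" using rational_flsI[OF q, of "- p"] by (simp add: x fls_of_poly_simps)
  show "inverse x \<in> rational_fls"
  proof (cases "p = 0")
    case True
    then show ?thesis using \<open>0 \<in> rational_fls\<close> by (simp add: x fls_of_poly_simps)
  next
    case False
    then show ?thesis using rational_flsI[OF False, of q] by (simp add: x)
  qed
  fix y assume "y \<in> rational_fls"
  then obtain p' q' where y: "y = fls_of_poly p' / fls_of_poly q'" and q': "q' \<noteq> 0"
    by (auto simp: rational_fls_def)
  have qq: "q * q' \<noteq> 0" using q q' by simp
  have nz: "fls_of_poly q \<noteq> 0" "fls_of_poly q' \<noteq> 0" using q q' by (simp_all add: fls_of_poly_eq_0_iff)
  have "x + y = fls_of_poly (p * q' + p' * q) / fls_of_poly (q * q')"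
    unfolding x y fls_of_poly_simps by (rule add_frac_eq[OF nz])
  then show "x + y \<in> rational_fls" using rational_flsI[OF qq] by metis
  have "x * y = fls_of_poly (p * p') / fls_of_poly (q * q')"
    unfolding x y fls_of_poly_simps by (rule times_divide_times_eq)
  then show "x * y \<in> rational_fls" using rational_flsI[OF qq] by metis
qed

lemma rational_fls_common_denominator:
  assumes "finite A" "\<And>i. i \<in> A \<Longrightarrow> c i \<in> rational_fls"
  shows "\<exists>q p. q \<noteq> 0 \<and> (\<forall>i\<in>A. fls_of_poly q * c i = fls_of_poly (p i))"
  using assms
proof (induction A rule: finite_induct)
  case empty
  show ?case by (intro exI[of _ 1]) simp
next
  case (insert i A)
  then obtain q p where q: "q \<noteq> 0" and p: "\<And>j. j \<in> A \<Longrightarrow> fls_of_poly q * c j = fls_of_poly (p j)" by auto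
  obtain p' q' where c: "c i = fls_of_poly p' / fls_of_poly q'" and q': "q' \<noteq> 0"
    using insert.prems[of i] by (auto simp: rational_fls_def)
  have nz: "fls_of_poly q' \<noteq> 0" using q' by (simp add: fls_of_poly_eq_0_iff)
  define P where "P = (\<lambda>j. if j = i then q * p' else q' * p j)"
  have "fls_of_poly (q * q') * c i = fls_of_poly (P i)"
    using nz unfolding c P_def by (simp add: fls_of_poly_simps)
  moreover have "fls_of_poly (q * q') * c j = fls_of_poly (P j)" if "j \<in> A" for j
  proof -
    have "fls_of_poly (q * q') * c j = fls_of_poly q' * (fls_of_poly q * c j)"
      by (simp only: fls_of_poly_simps ac_simps)
    then show ?thesis using p[OF that] that insert.hyps unfolding P_def by (auto simp: fls_of_poly_simps)
  qed
  moreover have "q * q' \<noteq> 0" using q q' by simp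
  ultimately show ?case by (intro exI[of _ "q * q'"] exI[of _ P]) simp
qed

lemma has_fps_expansion_fps_of_poly: "(\<lambda>u. poly p u) has_fps_expansion fps_of_poly p" for p :: "complex poly"
proof (induction p)
  case (pCons a p)
  have "(\<lambda>u. a + u * poly p u) has_fps_expansion (fps_const a + fps_X * fps_of_poly p)"
    by (intro fps_expansion_intros pCons)
  then show ?case by (simp add: fps_of_poly_pCons mult.commute)
qed simp

text \<open>Clearing denominators turns the relation over the rational functions into one with
  polynomial coefficients. It holds as a power series at z0, hence near z0, hence on the half-plane
  by analytic continuation.\<close>

lemma algebraic_relation:
  assumes f: "f holomorphic_on upper" and z0: "z0 \<in> upper"
    and F: "(\<lambda>u. f (z0 + u)) has_fps_expansion F"
    and alg: "\<not> transcendental_over rational_fls (fps_to_fls F)"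
  shows "\<exists>P. P \<noteq> 0 \<and> (\<forall>z\<in>upper. eval2 P z (f z) = 0)"
proof -
  obtain P where P: "P \<in> polys_over rational_fls" "poly P (fps_to_fls F) = 0" "P \<noteq> 0"
    using alg by (auto simp: transcendental_over_def)
  obtain q p where q: "q \<noteq> 0" and p: "\<And>i. i \<le> degree P \<Longrightarrow> fls_of_poly q * coeff P i = fls_of_poly (p i)"
    using rational_fls_common_denominator[of "{..degree P}" "coeff P"] P(1)
    unfolding polys_over_def by auto
  have "fps_to_fls (\<Sum>i\<le>degree P. fps_of_poly (p i) * F ^ i) = (\<Sum>i\<le>degree P. fls_of_poly (p i) * fps_to_fls F ^ i)"
    by (simp add: fps_to_fls_sum fls_times_fps_to_fls fps_to_fls_power fls_of_poly_def)
  also have "\<dots> = (\<Sum>i\<le>degree P. fls_of_poly q * (coeff P i * fps_to_fls F ^ i))"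
    using p by (intro sum.cong) (auto simp flip: mult.assoc)
  also have "\<dots> = fls_of_poly q * poly P (fps_to_fls F)"
    by (simp only: poly_altdef sum_distrib_left)
  finally have zero: "(\<Sum>i\<le>degree P. fps_of_poly (p i) * F ^ i) = 0" using P(2) by simp
  define g where "g u = (\<Sum>i\<le>degree P. poly (p i) u * f (z0 + u) ^ i)" for u
  have "g has_fps_expansion (\<Sum>i\<le>degree P. fps_of_poly (p i) * F ^ i)"
    unfolding g_def by (intro fps_expansion_intros has_fps_expansion_fps_of_poly F)
  then have g0: "g has_fps_expansion 0" by (simp only: zero)
  define A where "A = (\<lambda>z. z - z0) ` upper"
  have A: "A = {u. - Im z0 < Im u}"
  proof safe
    show "- Im z0 < Im u" if "u \<in> A" for u using that by (auto simp: A_def)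
    show "u \<in> A" if "- Im z0 < Im u" for u
      unfolding A_def using that by (intro image_eqI[of _ _ "u + z0"]) auto
  qed
  have hol: "g holomorphic_on A"
  proof -
    have "(f \<circ> (\<lambda>u. z0 + u)) holomorphic_on A"
      by (rule holomorphic_on_compose_gen[OF _ f]) (auto simp: A intro!: holomorphic_intros)
    then have "(\<lambda>u. f (z0 + u)) holomorphic_on A" by (simp add: o_def)
    then show ?thesis unfolding g_def by (intro holomorphic_intros)
  qed
  have "g u = 0" if "u \<in> A" for u
  proof (rule has_fps_expansion_0_analytic_continuation[OF g0 hol _ _ _ that])
    show "open A" unfolding A by (simp add: open_halfspace_Im_gt)
    show "topological_space_class.connected A" unfolding A by (intro convex_connected convex_halfspace_Im_gt)
    show "0 \<in> A" using z0 by (simp add: A)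
  qed
  then have gz: "g (z - z0) = 0" if "z \<in> upper" for z using that by (auto simp: A_def)
  \<comment> \<open>The coefficients found so far are polynomials in u = z - z0; composition with z
    - z0 rewrites them in z.\<close>
  define c where "c i = pcompose (p i) [:- z0, 1:]" for i
  define R where "R = (\<Sum>i\<le>degree P. monom (c i) i)"
  have coeff_R: "coeff R i = c i" if "i \<le> degree P" for i
    unfolding R_def using that by (simp add: coeff_sum sum.delta)
  have "eval2 R z (f z) = g (z - z0)" for z
    unfolding R_def g_def c_def eval2_def
    by (simp add: poly_sum poly_monom poly_power poly_pcompose)
  then have "\<forall>z\<in>upper. eval2 R z (f z) = 0" using gz by simp
  moreover have "R \<noteq> 0"
  proof
    assume "R = 0"
    then have "c (degree P) = 0" using coeff_R[of "degree P"] by simp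
    then have "p (degree P) = 0"
      unfolding c_def by (subst (asm) pcompose_eq_0_iff) auto
    then have "fls_of_poly q * lead_coeff P = 0" using p[of "degree P"] by (simp add: fls_of_poly_simps)
    then show False using q P(3) by (simp add: fls_of_poly_eq_0_iff)
  qed
  ultimately show ?thesis by blast
qed

lemma green_solution_bound:
  assumes w: "\<And>k l. 0 \<le> w k l" and \<zeta>: "green_solution w \<zeta>" and z: "z \<in> upper"
  shows "cmod (\<zeta> k z) \<le> 1 / Im z"
proof -
  have "\<zeta> k z = - 1 / (z + (\<Sum>l\<in>UNIV. complex_of_real (w k l) * \<zeta> l z))"
    using \<zeta> z by (intro eq_neg_inverse) (auto simp: green_solution_def green_eq_def simp del: mem_Collect_eq)
  moreover have "Im z \<le> Im (z + (\<Sum>l\<in>UNIV. complex_of_real (w k l) * \<zeta> l z))"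
    using \<zeta> z by (intro Im_le_Im_add_weighted_sum w) (auto simp: green_solution_def intro: less_imp_le)
  ultimately show ?thesis using Im_neg_inverse_bounds(2)[of "Im z"] z by (simp only: mem_Collect_eq)
qed

text \<open>If some \<zeta>_k were transcendental, a derivation killing the rational functions would
  not kill it. The derived vector would be a nonzero solution of the linearised system, and so would
  its lowest-order coefficients, where that system is a strict contraction of the maximum
  norm.\<close>

theorem green_solution_algebraic:
  fixes w :: "'k::finite \<Rightarrow> 'k \<Rightarrow> real"
  assumes w: "\<And>k l. 0 \<le> w k l" and \<zeta>: "green_solution w \<zeta>"
  shows "\<exists>P. P \<noteq> 0 \<and> (\<forall>z\<in>upper. eval2 P z (\<zeta> k z) = 0)"
proof -
  define W where "W = (\<Sum>k\<in>UNIV. \<Sum>l\<in>UNIV. w k l)"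
  have W: "(\<Sum>l\<in>UNIV. w k l) \<le> W" for k
    unfolding W_def by (intro member_le_sum sum_nonneg w) auto
  have W0: "0 \<le> W" unfolding W_def by (intro sum_nonneg w)
  \<comment> \<open>At this height each \<zeta>_l is at most 1/(W + 1) in modulus, and W/(W + 1)^2 <
    1 is the contraction factor.\<close>
  define z0 where "z0 = Complex 0 (W + 1)"
  have z0: "z0 \<in> upper" "Im z0 = W + 1" using W0 by (auto simp: z0_def)
  have hol: "\<zeta> k holomorphic_on upper" for k using \<zeta> by (simp add: green_solution_def)
  define F where "F k = fps_expansion (\<zeta> k) z0" for k
  have F: "(\<lambda>u. \<zeta> k (z0 + u)) has_fps_expansion F k" for k
    unfolding F_def using hol open_upper z0(1)
    by (intro analytic_at_imp_has_fps_expansion) (auto simp: analytic_at)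
  have F0: "fps_nth (F k) 0 = \<zeta> k z0" for k
    using has_fps_expansion_imp_0_eq_fps_nth_0[OF F] by simp
  define t where "t = fps_const z0 + (fps_X :: complex fps)"
  have F_eq: "F k * (t + (\<Sum>l\<in>UNIV. fps_const (complex_of_real (w k l)) * F l)) = - 1" for k
  proof -
    let ?G = "F k * (t + (\<Sum>l\<in>UNIV. fps_const (complex_of_real (w k l)) * F l)) - fps_const (- 1)"
    have "(\<lambda>u. \<zeta> k (z0 + u) * ((z0 + u) + (\<Sum>l\<in>UNIV. complex_of_real (w k l) * \<zeta> l (z0 + u))) - (- 1))
        has_fps_expansion ?G"
      unfolding t_def by (intro fps_expansion_intros F)
    moreover have "\<forall>\<^sub>F u in nhds 0. \<zeta> k (z0 + u) * ((z0 + u) + (\<Sum>l\<in>UNIV. complex_of_real (w k l) * \<zeta> l (z0 + u))) - (- 1) = 0"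
    proof -
      have "open {u. - Im z0 < Im u}" by (simp add: open_halfspace_Im_gt)
      then have "\<forall>\<^sub>F u in nhds 0. u \<in> {u. - Im z0 < Im u}"
        using z0(1) by (intro eventually_nhds_in_open) auto
      then show ?thesis
      proof eventually_elim
        case (elim u)
        then have "z0 + u \<in> upper" by simp
        then have "green_eq w (z0 + u) (\<lambda>k. \<zeta> k (z0 + u))" using \<zeta> by (simp add: green_solution_def)
        then show ?case by (simp add: green_eq_def)
      qed
    qed
    ultimately have "?G = 0" by (intro fps_expansion_unique_complex) (simp_all only: has_fps_expansion_0_iff)
    then show ?thesis by simp
  qed
  define X where "X k = fps_to_fls (F k)" for k
  define T where "T = fls_of_poly [:z0, 1:]"
  have T: "T = fps_to_fls t" unfolding T_def t_def fls_of_poly_def fps_of_poly_linear by (simp add: add.commute)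
  define e where "e k l = fls_of_poly [:complex_of_real (w k l):]" for k l
  have e: "e k l = fps_to_fls (fps_const (complex_of_real (w k l)))" for k l
    unfolding e_def fls_of_poly_def fps_of_poly_const by simp
  have X_eq: "X k * (T + (\<Sum>l\<in>UNIV. e k l * X l)) = - 1" for k
  proof -
    have "X k * (T + (\<Sum>l\<in>UNIV. e k l * X l)) = fps_to_fls (F k * (t + (\<Sum>l\<in>UNIV. fps_const (complex_of_real (w k l)) * F l)))"
      by (simp add: X_def T e fls_times_fps_to_fls fps_to_fls_sum)
    then show ?thesis unfolding F_eq by simp
  qed
  have "\<not> transcendental_over rational_fls (X k)"
  proof
    assume "transcendental_over rational_fls (X k)"
    from transcendental_derivation[OF is_subfield_rational_fls this, of "range X"] obtain L D where
      L: "is_subfield L" "rational_fls \<subseteq> L" "range X \<subseteq> L" and D: "derivation_on L D"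
      and DX: "D (X k) = 1" and D0: "\<And>y. y \<in> rational_fls \<Longrightarrow> D y = 0"
      by auto
    have add: "D (x + y) = D x + D y" and mult: "D (x * y) = x * D y + D x * y"
      if "x \<in> L" "y \<in> L" for x y using D that by (auto simp: derivation_on_def)
    have memX: "X l \<in> L" and mem_e: "e l m \<in> L" and mem_T: "T \<in> L" for l m
      using L fls_of_poly_rational unfolding e_def T_def by auto
    have mem_eX: "e l m * X m \<in> L" for l m using L(1) memX mem_e by (auto simp: is_subfield_def)
    have mem_sum: "(\<Sum>m\<in>UNIV. e l m * X m) \<in> L" for l by (intro is_subfield_sum L(1) mem_eX)
    have D_eX: "D (e l m * X m) = e l m * D (X m)" for l m
      using mult[OF mem_e memX] D0[OF fls_of_poly_rational] unfolding e_def by simp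
    have D_T: "D T = 0" using D0[OF fls_of_poly_rational] unfolding T_def by simp
    have Dm1: "D (- 1) = 0"
      using D0 is_subfield_rational_fls by (simp add: is_subfield_def)
    \<comment> \<open>Leibniz applied to X_l (T + sum) = -1, where \<open>D\<close> vanishes on T
      and on the weights; multiplying by X_l and using the equation again isolates D(X_l).\<close>
    have Y: "D (X l) = X l * X l * (\<Sum>m\<in>UNIV. e l m * D (X m))" for l
    proof -
      have memS: "T + (\<Sum>m\<in>UNIV. e l m * X m) \<in> L" using L(1) mem_T mem_sum by (auto simp: is_subfield_def)
      have DS: "D (T + (\<Sum>m\<in>UNIV. e l m * X m)) = (\<Sum>m\<in>UNIV. e l m * D (X m))"
        using add[OF mem_T mem_sum] derivation_on_sum[OF D L(1) mem_eX] by (simp add: D_T D_eX)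
      have "D (X l * (T + (\<Sum>m\<in>UNIV. e l m * X m))) = 0" unfolding X_eq by (rule Dm1)
      then have "X l * (\<Sum>m\<in>UNIV. e l m * D (X m)) + D (X l) * (T + (\<Sum>m\<in>UNIV. e l m * X m)) = 0"
        unfolding mult[OF memX memS] DS .
      then show ?thesis using X_eq[of l] by algebra
    qed
    define S where "S = {l. D (X l) \<noteq> 0}"
    have S: "finite S" "k \<in> S" unfolding S_def using DX by auto
    \<comment> \<open>The least order among the nonzero derived series. It is possibly negative, but
      finite as there are finitely many of them.\<close>
    define N where "N = Min ((\<lambda>l. fls_subdegree (D (X l))) ` S)"
    have low: "fls_nth (D (X l)) n = 0" if "n < N" for l n
    proof (cases "l \<in> S")
      case True
      then have "N \<le> fls_subdegree (D (X l))" unfolding N_def using S by (intro Min_le) auto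
      then show ?thesis using that by simp
    qed (simp add: S_def)
    have "N \<in> (\<lambda>l. fls_subdegree (D (X l))) ` S" unfolding N_def using S by (intro Min_in) auto
    then obtain l0 where l0: "l0 \<in> S" "N = fls_subdegree (D (X l0))" by blast
    define c where "c l = fls_nth (D (X l)) N" for l
    have c0: "c l0 \<noteq> 0" unfolding c_def l0(2) using l0(1) by (simp add: S_def)
    have c_eq: "c l = \<zeta> l z0 * \<zeta> l z0 * (\<Sum>m\<in>UNIV. complex_of_real (w l m) * c m)" for l
    proof -
      have le: "fls_nth (e l m * D (X m)) n = complex_of_real (w l m) * fls_nth (D (X m)) n" if "n \<le> N" for m n
        unfolding e using low that by (subst fls_nth_fps_times_lowest) auto
      have s: "fls_nth (\<Sum>m\<in>UNIV. e l m * D (X m)) n = (\<Sum>m\<in>UNIV. complex_of_real (w l m) * fls_nth (D (X m)) n)" if "n \<le> N" for n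
        using le[OF that] by (simp add: fls_nth_sum)
      have "c l = fls_nth (fps_to_fls (F l * F l) * (\<Sum>m\<in>UNIV. e l m * D (X m))) N"
        unfolding c_def Y[of l] by (simp add: X_def fls_times_fps_to_fls)
      also have "\<dots> = fps_nth (F l * F l) 0 * fls_nth (\<Sum>m\<in>UNIV. e l m * D (X m)) N"
        using low s by (intro fls_nth_fps_times_lowest) simp
      finally show ?thesis using s[of N] by (simp add: c_def F0)
    qed
    \<comment> \<open>A component of largest modulus cannot be reproduced by a system that shrinks
      the maximum norm.\<close>
    obtain l where l: "\<And>m. cmod (c m) \<le> cmod (c l)"
      using finite_type_max[of "\<lambda>m. cmod (c m)"] by auto
    have cl: "0 < cmod (c l)" using l[of l0] c0 by (meson less_le_trans zero_less_norm_iff)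
    have "cmod (\<Sum>m\<in>UNIV. complex_of_real (w l m) * c m) \<le> (\<Sum>m\<in>UNIV. w l m * cmod (c l))"
      using l w by (intro sum_norm_le) (auto simp: norm_mult intro!: mult_left_mono)
    also have "\<dots> \<le> W * cmod (c l)" using W[of l] by (simp add: mult_right_mono flip: sum_distrib_right)
    finally have s: "cmod (\<Sum>m\<in>UNIV. complex_of_real (w l m) * c m) \<le> W * cmod (c l)" .
    have b: "cmod (\<zeta> l z0) \<le> 1 / (W + 1)" using green_solution_bound[OF w \<zeta> z0(1), of l] z0(2) by simp
    have "cmod (c l) = cmod (\<zeta> l z0) * cmod (\<zeta> l z0) * cmod (\<Sum>m\<in>UNIV. complex_of_real (w l m) * c m)"
      by (subst c_eq) (simp only: norm_mult)
    also have "\<dots> \<le> 1 / (W + 1) * (1 / (W + 1)) * (W * cmod (c l))"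
      using b s W0 by (intro mult_mono) auto
    also have "\<dots> = W / ((W + 1) * (W + 1)) * cmod (c l)" by simp
    also have "\<dots> < 1 * cmod (c l)"
    proof (rule mult_strict_right_mono[OF _ cl])
      have "W < (W + 1) * (W + 1)" using W0 by (simp add: algebra_simps add_pos_nonneg)
      then show "W / ((W + 1) * (W + 1)) < 1" using W0 by (subst divide_less_eq_1_pos) auto
    qed
    finally show False by simp
  qed
  then show ?thesis unfolding X_def by (rule algebraic_relation[OF hol z0(1) F])
qed

section \<open>Lipschitz bounds up to the real axis\<close>

lemma eval2_pCons: "eval2 (pCons a P) z x = poly a z + x * eval2 P z x"
  by (simp add: eval2_def)

lemma eval2_const: "eval2 [:c:] z x = poly c z"
  by (simp add: eval2_def)

text \<open>The chain rule in two variables: \<open>map_poly pderiv\<close> differentiates in z,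
  \<open>pderiv\<close> in x.\<close>

lemma eval2_has_field_derivative:
  assumes f: "(f has_field_derivative f') (at z within A)"
  shows "((\<lambda>z. eval2 P z (f z)) has_field_derivative
    eval2 (map_poly pderiv P) z (f z) + eval2 (pderiv P) z (f z) * f') (at z within A)"
proof (induction P)
  case 0
  show ?case by (simp add: eval2_0)
next
  case (pCons a P)
  have "((\<lambda>z. poly a z + f z * eval2 P z (f z)) has_field_derivative
     poly (pderiv a) z + (f' * eval2 P z (f z) +
       (eval2 (map_poly pderiv P) z (f z) + eval2 (pderiv P) z (f z) * f') * f z)) (at z within A)"
    by (intro DERIV_add DERIV_mult f pCons has_field_derivative_at_within[OF poly_DERIV])
  then show ?case
    by (simp add: eval2_pCons pderiv_pCons map_poly_pCons eval2_add algebra_simps)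
qed

text \<open>Holomorphic functions on a connected open set form an integral domain: where f is
  nonzero, g vanishes on an open set.\<close>

lemma upper_zero_product:
  assumes f: "f holomorphic_on upper" and g: "g holomorphic_on upper"
    and fg: "\<And>z. z \<in> upper \<Longrightarrow> f z * g z = 0"
  shows "(\<forall>z\<in>upper. f z = 0) \<or> (\<forall>z\<in>upper. g z = 0)"
proof (rule ccontr)
  assume "\<not> ?thesis"
  then obtain z1 where z1: "z1 \<in> upper" "f z1 \<noteq> 0" and ng: "\<not> (\<forall>z\<in>upper. g z = 0)" by blast
  define U where "U = {z\<in>upper. f z \<noteq> 0}"
  have "continuous_on upper f" using f by (rule holomorphic_on_imp_continuous_on)
  then have "open (upper \<inter> f -` (- {0}))" by (intro continuous_open_preimage open_upper) auto
  moreover have "U = upper \<inter> f -` (- {0})" by (auto simp: U_def)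
  ultimately have "open U" by simp
  moreover have "g z = 0" if "z \<in> U" for z using fg[of z] that by (auto simp: U_def)
  ultimately have "g z = 0" if "z \<in> upper" for z
    using z1 analytic_continuation_open[OF \<open>open U\<close> open_upper _ connected_upper _ g holomorphic_on_const[of 0] _ that]
    by (auto simp: U_def)
  then show False using ng by blast
qed

lemma poly_zero_on_upper:
  assumes "\<And>z. z \<in> upper \<Longrightarrow> poly p z = 0" shows "p = (0 :: complex poly)"
proof (rule ccontr)
  assume "p \<noteq> 0"
  then have "finite {z. poly p z = 0}" by (rule poly_roots_finite)
  then have fin: "finite ((\<lambda>t. Complex 0 t) ` {0<..})"
    by (rule rev_finite_subset) (auto simp: assms)
  have "infinite {0 :: real <..}" by (rule infinite_Ioi)
  then show False using finite_imageD[OF fin] by (simp add: inj_on_def)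
qed

text \<open>P is an annihilator of least degree in x. A combination R of P and P' of least degree
  divides both up to polynomial factors in z, so if R had positive degree then P would split into
  annihilators of smaller degree. Hence R is a polynomial c in z alone, which plays the role of the
  discriminant.\<close>

lemma annihilator_discriminant:
  assumes f: "f holomorphic_on upper" and P0: "P0 \<noteq> 0" "\<forall>z\<in>upper. eval2 P0 z (f z) = 0"
  shows "\<exists>P c U V. (\<forall>z\<in>upper. eval2 P z (f z) = 0) \<and> P \<noteq> 0 \<and> 0 < degree P \<and>
    c \<noteq> 0 \<and> U * P + V * pderiv P = [:c:]"
proof -
  define ann where "ann P \<longleftrightarrow> P \<noteq> 0 \<and> (\<forall>z\<in>upper. eval2 P z (f z) = 0)" for P
  define P where "P = arg_min degree ann"
  have "ann P0" using P0 by (auto simp: ann_def)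
  then have P: "ann P" unfolding P_def by (rule arg_min_natI)
  have min: "degree P \<le> degree R" if "ann R" for R
    unfolding P_def using arg_min_nat_le[of ann R degree] that by auto
  have deg: "0 < degree P"
  proof (rule gr_zeroI)
    assume "degree P = 0"
    then obtain c where c: "P = [:c:]" by (rule degree_eq_zeroE)
    then have "c = 0" using P by (intro poly_zero_on_upper) (auto simp: ann_def eval2_const)
    then show False using P c by (simp add: ann_def)
  qed
  define Q where "Q = pderiv P"
  have Q: "Q \<noteq> 0" "degree Q < degree P" unfolding Q_def using deg by (auto simp: pderiv_eq_0_iff degree_pderiv)
  define I where "I R \<longleftrightarrow> R \<noteq> 0 \<and> (\<exists>U V. R = U * P + V * Q)" for R
  define R where "R = arg_min degree I"
  have "I Q" using Q by (auto simp: I_def intro: exI[of _ 0] exI[of _ 1])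
  then have R: "I R" unfolding R_def by (rule arg_min_natI)
  then obtain U V where UV: "R = U * P + V * Q" by (auto simp: I_def)
  have R0: "R \<noteq> 0" using R by (simp add: I_def)
  \<comment> \<open>Euclid's argument with pseudo-division, which stays within polynomial
    coefficients at the price of the factor a.\<close>
  have div: "\<exists>a A. a \<noteq> 0 \<and> smult a B = R * A" if B: "\<exists>U V. B = U * P + V * Q" for B
  proof -
    obtain a A where a: "a \<noteq> 0" and eq: "smult a B = R * A + pseudo_mod B R"
      using pseudo_mod(1)[OF R0, of B] by blast
    have "pseudo_mod B R = 0"
    proof (rule ccontr)
      assume nz: "pseudo_mod B R \<noteq> 0"
      obtain U' V' where B': "B = U' * P + V' * Q" using B by blast
      have "pseudo_mod B R = smult a B - R * A" using eq by (simp add: algebra_simps)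
      also have "\<dots> = (smult a U' - U * A) * P + (smult a V' - V * A) * Q"
        unfolding B' UV by (simp add: algebra_simps smult_add_right)
      finally have "I (pseudo_mod B R)" using nz by (auto simp: I_def)
      then have "degree R \<le> degree (pseudo_mod B R)"
        unfolding R_def using arg_min_nat_le[of I _ degree] by auto
      then show False using pseudo_mod(2)[OF R0, of B] nz by auto
    qed
    then show ?thesis using a eq by auto
  qed
  have "\<exists>U V. P = U * P + V * Q" by (intro exI[of _ 1] exI[of _ 0]) simp
  from div[OF this] obtain a A where a: "a \<noteq> 0" "smult a P = R * A" by blast
  have "\<exists>U V. Q = U * P + V * Q" by (intro exI[of _ 0] exI[of _ 1]) simp
  from div[OF this] obtain b B where b: "b \<noteq> 0" "smult b Q = R * B" by blast
  have B0: "B \<noteq> 0" using b Q by auto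
  have A0: "A \<noteq> 0" using a P by (auto simp: ann_def)
  have dR: "degree R \<le> degree Q"
    using arg_cong[OF b(2), of degree] b(1) R0 B0 by (simp add: degree_mult_eq)
  have dA: "degree P = degree R + degree A"
    using arg_cong[OF a(2), of degree] a(1) R0 A0 by (simp add: degree_mult_eq)
  have "degree R = 0"
  proof (rule ccontr)
    assume nz: "degree R \<noteq> 0"
    \<comment> \<open>Since a P = R A annihilates f, one of R and A does; each has degree below that
      of P.\<close>
    have "eval2 R z (f z) * eval2 A z (f z) = 0" if "z \<in> upper" for z
      using P that unfolding ann_def eval2_mult[symmetric] a(2)[symmetric] by (simp add: eval2_smult)
    from upper_zero_product[OF holomorphic_eval2[OF f] holomorphic_eval2[OF f] this]
    have "ann R \<or> ann A" using R0 A0 by (auto simp: ann_def)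
    then show False using min[of R] min[of A] dR dA Q nz by auto
  qed
  then obtain c where c: "R = [:c:]" by (rule degree_eq_zeroE)
  show ?thesis
  proof (intro exI conjI)
    show "\<forall>z\<in>upper. eval2 P z (f z) = 0" "P \<noteq> 0" using P by (simp_all add: ann_def)
    show "c \<noteq> 0" using R0 c by simp
    show "U * P + V * pderiv P = [:c:]" using UV c by (simp add: Q_def)
  qed (rule deg)
qed

lemma eval2_bounded:
  "\<exists>M>0. \<forall>z\<in>cball a r. \<forall>x\<in>cball 0 B. cmod (eval2 P z x) \<le> M"
proof -
  have "compact (cball a r \<times> cball (0::complex) B)" by (intro compact_Times compact_cball)
  moreover have "continuous_on (cball a r \<times> cball 0 B) (\<lambda>u. eval2 P (fst u) (snd u))"
    unfolding eval2_altdef by (intro continuous_intros)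
  ultimately have "bounded ((\<lambda>u. eval2 P (fst u) (snd u)) ` (cball a r \<times> cball 0 B))"
    by (intro compact_imp_bounded compact_continuous_image)
  then obtain M where "M > 0" "\<forall>y\<in>(\<lambda>u. eval2 P (fst u) (snd u)) ` (cball a r \<times> cball 0 B). cmod y \<le> M"
    unfolding bounded_pos by blast
  then show ?thesis by (intro exI[of _ M]) fastforce
qed

lemma poly_bounded_below:
  assumes "\<And>z. z \<in> cball a r \<Longrightarrow> poly p z \<noteq> 0"
  shows "\<exists>\<delta>>0. \<forall>z\<in>cball a r. \<delta> \<le> cmod (poly p (z::complex))"
proof (cases "cball a r = {}")
  case False
  have "continuous_on (cball a r) (\<lambda>z. cmod (poly p z))" by (intro continuous_intros)
  from continuous_attains_inf[OF compact_cball False this] obtain x where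
    x: "x \<in> cball a r" "\<And>y. y \<in> cball a r \<Longrightarrow> cmod (poly p x) \<le> cmod (poly p y)" by blast
  then show ?thesis using assms[of x] by (intro exI[of _ "cmod (poly p x)"]) auto
qed (auto intro: exI[of _ 1])

text \<open>For |x| > 1 the top term is at most n M |x|^(n-1); dividing by that power leaves a
  linear bound.\<close>

lemma root_bound:
  fixes x :: complex
  assumes "(\<Sum>i\<le>n. c i * x ^ i) = 0" and n: "0 < n" and \<delta>: "0 < \<delta>" "\<delta> \<le> cmod (c n)"
    and M: "\<And>i. i < n \<Longrightarrow> cmod (c i) \<le> M" "0 \<le> M"
  shows "cmod x \<le> max 1 (real n * M / \<delta>)"
proof (cases "cmod x \<le> 1")
  case False
  then have x: "1 < cmod x" by simp
  obtain m where m: "n = Suc m" using n gr0_implies_Suc by blast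
  have "c n * x ^ n = - (\<Sum>i<n. c i * x ^ i)"
    using assms(1) by (simp add: eq_neg_iff_add_eq_0 add.commute flip: lessThan_Suc_atMost)
  then have "cmod (c n * x ^ n) = cmod (\<Sum>i<n. c i * x ^ i)" by simp
  also have "\<dots> \<le> (\<Sum>i<n. M * cmod x ^ m)"
  proof (rule sum_norm_le)
    fix i assume "i \<in> {..<n}"
    then have "i \<le> m" "i < n" using m by auto
    then show "cmod (c i * x ^ i) \<le> M * cmod x ^ m"
      using x M by (auto simp: norm_mult norm_power intro!: mult_mono power_increasing)
  qed
  finally have "cmod (c n) * cmod x * cmod x ^ m \<le> real n * M * cmod x ^ m"
    by (simp add: norm_mult norm_power m mult.assoc)
  then have "cmod (c n) * cmod x \<le> real n * M" 
    using zero_less_power[OF less_trans[OF zero_less_one x], of m] by (simp add: mult_le_cancel_right)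
  then have "\<delta> * cmod x \<le> real n * M" using \<delta>(2) by (meson mult_right_mono norm_ge_zero order_trans)
  then have "cmod x \<le> real n * M / \<delta>" using \<delta>(1) by (simp add: field_simps)
  then show ?thesis by simp
qed simp

text \<open>Where the leading coefficient does not vanish, f is bounded. Where c does not vanish
  either, the Bezout identity keeps the x-derivative of P away from 0 along f, so implicit
  differentiation bounds f', and half-discs are convex.\<close>

theorem algebraic_locally_lipschitz:
  assumes f: "f holomorphic_on upper" and P0: "P0 \<noteq> 0" "\<forall>z\<in>upper. eval2 P0 z (f z) = 0"
  shows "\<exists>D. finite D \<and> (\<forall>E. E \<notin> D \<longrightarrow> (\<exists>r>0. \<exists>L. \<forall>z\<in>upper \<inter> ball (complex_of_real E) r.
    \<forall>z'\<in>upper \<inter> ball (complex_of_real E) r. cmod (f z - f z') \<le> L * cmod (z - z')))"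
proof -
  obtain P c U V where P: "\<forall>z\<in>upper. eval2 P z (f z) = 0" "P \<noteq> 0" "0 < degree P"
    and c: "c \<noteq> 0" and UV: "U * P + V * pderiv P = [:c:]"
    using annihilator_discriminant[OF assms] by (elim exE conjE)
  \<comment> \<open>The real zeros of q are the exceptional points: poles and branch points of f can
    lie only there.\<close>
  define q where "q = c * lead_coeff P"
  have q: "q \<noteq> 0" unfolding q_def using c P by simp
  define D where "D = complex_of_real -` {z. poly q z = 0}"
  have "finite D" unfolding D_def by (intro finite_vimageI poly_roots_finite q) (simp add: inj_on_def)
  moreover have "\<exists>r>0. \<exists>L. \<forall>z\<in>upper \<inter> ball (complex_of_real E) r.
    \<forall>z'\<in>upper \<inter> ball (complex_of_real E) r. cmod (f z - f z') \<le> L * cmod (z - z')" if E: "E \<notin> D" for E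
  proof -
    let ?E = "complex_of_real E"
    define G where "G = {z. poly q z \<noteq> 0}"
    have "open G" unfolding G_def by (intro open_Collect_neq continuous_intros)
    moreover have "?E \<in> G" using E by (simp add: D_def G_def)
    ultimately obtain r where r: "0 < r" "cball ?E r \<subseteq> G" using open_contains_cball[of G] by blast
    have nz: "poly c z \<noteq> 0" "poly (lead_coeff P) z \<noteq> 0" if "z \<in> cball ?E r" for z
      using r(2) that by (auto simp: q_def G_def)
    obtain \<delta>1 where \<delta>1: "0 < \<delta>1" "\<And>z. z \<in> cball ?E r \<Longrightarrow> \<delta>1 \<le> cmod (poly c z)"
      using poly_bounded_below[of ?E r c] nz by blast
    obtain \<delta>2 where \<delta>2: "0 < \<delta>2" "\<And>z. z \<in> cball ?E r \<Longrightarrow> \<delta>2 \<le> cmod (poly (lead_coeff P) z)"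
      using poly_bounded_below[of ?E r "lead_coeff P"] nz by blast
    have "\<forall>i. \<exists>m. 0 < m \<and> (\<forall>z\<in>cball ?E r. cmod (poly (coeff P i) z) \<le> m)"
      using eval2_bounded[of ?E r 0 "[:coeff P _:]"] by (simp add: eval2_const)
    from choice[OF this] obtain M where
      "\<forall>i. 0 < M i \<and> (\<forall>z\<in>cball ?E r. cmod (poly (coeff P i) z) \<le> M i)" by (rule exE)
    then have M: "\<And>i. 0 < M i" "\<And>i z. z \<in> cball ?E r \<Longrightarrow> cmod (poly (coeff P i) z) \<le> M i" by auto
    define M' where "M' = (\<Sum>i\<le>degree P. M i)"
    have M': "M i \<le> M'" if "i \<le> degree P" for i
      unfolding M'_def using that M(1) by (intro member_le_sum) (auto intro: less_imp_le)
    have M'0: "0 \<le> M'" unfolding M'_def using M(1) by (intro sum_nonneg) (auto intro: less_imp_le)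
    define B where "B = max 1 (real (degree P) * M' / \<delta>2)"
    have fB: "cmod (f z) \<le> B" if "z \<in> upper" "z \<in> cball ?E r" for z
      unfolding B_def
    proof (rule root_bound)
      show "(\<Sum>i\<le>degree P. poly (coeff P i) z * f z ^ i) = 0" using bspec[OF P(1) that(1)] by (simp add: eval2_altdef)
      show "cmod (poly (coeff P i) z) \<le> M'" if "i < degree P" for i
        using M(2)[OF \<open>z \<in> cball ?E r\<close>, of i] M'[of i] that by simp
    qed (use P(3) \<delta>2 that M'0 in auto)
    obtain K where K: "0 < K" "\<And>z x. z \<in> cball ?E r \<Longrightarrow> x \<in> cball 0 B \<Longrightarrow> cmod (eval2 V z x) \<le> K"
      using eval2_bounded by blast
    obtain N where N: "0 < N" "\<And>z x. z \<in> cball ?E r \<Longrightarrow> x \<in> cball 0 B \<Longrightarrow> cmod (eval2 (map_poly pderiv P) z x) \<le> N"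
      using eval2_bounded by blast
    define f' where "f' = deriv f"
    have der: "(f has_field_derivative f' z) (at z)" if "z \<in> upper" for z
      unfolding f'_def using holomorphic_derivI[OF f open_upper that] .
    have bound: "cmod (f' z) \<le> N * K / \<delta>1" if z: "z \<in> upper" "z \<in> cball ?E r" for z
    proof -
      let ?a = "eval2 (map_poly pderiv P) z (f z)" and ?b = "eval2 (pderiv P) z (f z)"
      have mem: "f z \<in> cball 0 B" using fB[OF z] by simp
      have "((\<lambda>z. eval2 P z (f z)) has_field_derivative ?a + ?b * f' z) (at z)"
        by (rule eval2_has_field_derivative[OF der[OF z(1)]])
      moreover have "((\<lambda>z. eval2 P z (f z)) has_field_derivative 0) (at z)"
        by (rule has_field_derivative_transform_within_open[OF DERIV_const[of 0] open_upper z(1)]) (simp add: bspec[OF P(1)])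
      ultimately have ab: "?a + ?b * f' z = 0" by (rule DERIV_unique)
      have "eval2 (U * P + V * pderiv P) z (f z) = poly c z" unfolding UV eval2_const ..
      \<comment> \<open>As P vanishes along f, only the second term of the Bezout identity
        remains.\<close>
      then have "eval2 V z (f z) * ?b = poly c z" using bspec[OF P(1) z(1)] by (simp add: eval2_add eval2_mult)
      then have "\<delta>1 \<le> cmod (eval2 V z (f z)) * cmod ?b" using \<delta>1(2)[OF z(2)] by (simp flip: norm_mult)
      also have "\<dots> \<le> K * cmod ?b" using K(2)[OF z(2) mem] by (intro mult_right_mono) auto
      finally have b: "\<delta>1 \<le> K * cmod ?b" .
      have "cmod ?b * cmod (f' z) = cmod ?a"
        using ab by (metis add_eq_0_iff2 norm_minus_cancel norm_mult)
      also have "\<dots> \<le> N" by (rule N(2)[OF z(2) mem])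
      finally have "K * (cmod ?b * cmod (f' z)) \<le> K * N" using K(1) by (intro mult_left_mono) auto
      moreover have "\<delta>1 * cmod (f' z) \<le> (K * cmod ?b) * cmod (f' z)" using b by (intro mult_right_mono) auto
      ultimately have "cmod (f' z) * \<delta>1 \<le> N * K"
        by (simp only: mult.commute[of "cmod (f' z)"] mult.commute[of N] mult.assoc)
      then show ?thesis using \<delta>1(1) by (simp only: pos_le_divide_eq)
    qed
    have "cmod (f z - f z') \<le> N * K / \<delta>1 * cmod (z - z')"
      if "z \<in> upper \<inter> ball ?E r" "z' \<in> upper \<inter> ball ?E r" for z z'
    proof (rule field_differentiable_bound[OF _ _ _ that])
      show "convex (upper \<inter> ball ?E r)" by (intro convex_Int convex_upper convex_ball)
      fix x assume x: "x \<in> upper \<inter> ball ?E r"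
      show "(f has_field_derivative f' x) (at x within upper \<inter> ball ?E r)"
        by (rule has_field_derivative_at_within[OF der]) (use x in blast)
      show "cmod (f' x) \<le> N * K / \<delta>1" using x ball_subset_cball by (intro bound) blast+
    qed
    then show ?thesis using r(1) by blast
  qed
  ultimately show ?thesis by blast
qed

section \<open>Boundary values on the real axis\<close>

definition closed_upper_minus :: "real set \<Rightarrow> complex set" where
  "closed_upper_minus D = {z. 0 \<le> Im z} - complex_of_real ` D"

lemma upper_subset_closed_upper_minus: "upper \<subseteq> closed_upper_minus D"
  by (auto simp: closed_upper_minus_def)

lemma of_real_in_closed_upper_minus: "complex_of_real E \<in> closed_upper_minus D \<longleftrightarrow> E \<notin> D"
  by (auto simp: closed_upper_minus_def)

lemma closed_upper_minus_cases:
  assumes "z \<in> closed_upper_minus D"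
  obtains "z \<in> upper" | E where "z = complex_of_real E" "E \<notin> D"
proof (cases "0 < Im z")
  case False
  then have "z = complex_of_real (Re z)" using assms by (simp add: closed_upper_minus_def complex_eq_iff)
  then show thesis using that(2)[of "Re z"] assms of_real_in_closed_upper_minus[of "Re z" D] by simp
qed (use that in auto)

lemma real_at_within_upper: "at (complex_of_real E) within upper \<noteq> bot"
proof -
  have "complex_of_real E islimpt upper"
    unfolding islimpt_approachable
  proof (intro allI impI)
    fix e :: real assume "0 < e"
    then show "\<exists>x'\<in>upper. x' \<noteq> complex_of_real E \<and> dist x' (complex_of_real E) < e"
      by (intro bexI[of _ "Complex E (e / 2)"]) (auto simp: dist_norm cmod_def complex_eq_iff)
  qed
  then show ?thesis by (simp add: trivial_limit_within)
qed

lemma lipschitz_limit_upper: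
  fixes f :: "complex \<Rightarrow> complex"
  assumes r: "0 < r" and L: "\<And>z z'. z \<in> upper \<inter> ball (complex_of_real E) r \<Longrightarrow>
    z' \<in> upper \<inter> ball (complex_of_real E) r \<Longrightarrow> cmod (f z - f z') \<le> L * cmod (z - z')"
    and w: "\<bar>x - E\<bar> < r"
  shows "\<exists>l. (f \<longlongrightarrow> l) (at (complex_of_real x) within upper)"
proof -
  let ?S = "upper \<inter> ball (complex_of_real E) r" and ?x = "complex_of_real x"
  have x: "?x \<in> ball (complex_of_real E) r" using w by (simp add: dist_of_real dist_commute dist_real_def)
  have "(max L 0)-lipschitz_on ?S f"
  proof (rule lipschitz_onI)
    fix z z' assume z: "z \<in> ?S" "z' \<in> ?S"
    have "cmod (f z - f z') \<le> L * cmod (z - z')" by (rule L[OF z])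
    also have "\<dots> \<le> max L 0 * cmod (z - z')" by (intro mult_right_mono) auto
    finally show "dist (f z) (f z') \<le> max L 0 * dist z z'" by (simp add: dist_norm)
  qed simp
  then have uc: "uniformly_continuous_on ?S f" by (rule lipschitz_on_uniformly_continuous)
  have eq: "at ?x within ?S = at ?x within upper"
    by (rule at_within_nhd[of _ "ball (complex_of_real E) r"]) (use x in auto)
  have "?x islimpt ?S"
    using real_at_within_upper[of x] unfolding eq[symmetric] by (simp add: trivial_limit_within)
  then have "?x \<in> closure ?S" by (simp add: closure_def)
  from uniformly_continuous_on_extension_at_closure[OF uc this] show ?thesis
    unfolding eq by blast
qed

text \<open>At a real energy the vector of imaginary parts is fixed by the nonnegative matrix
  |x_k|^2 w_kl: there is no source term Im z.\<close>

lemma green_boundary_imaginary_part: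
  assumes "x * (of_real E + (\<Sum>l\<in>UNIV. complex_of_real (w l) * y l)) = - 1"
  shows "Im x = (cmod x)\<^sup>2 * (\<Sum>l\<in>UNIV. w l * Im (y l))"
proof -
  define u where "u = of_real E + (\<Sum>l\<in>UNIV. complex_of_real (w l) * y l)"
  have x: "x = - 1 / u" using assms by (intro eq_neg_inverse) (simp add: u_def)
  have "Im x = Im u / (cmod u)\<^sup>2" unfolding x by (rule Im_neg_inverse)
  also have "\<dots> = (cmod x)\<^sup>2 * Im u" unfolding x by (simp add: norm_divide power_divide)
  finally show ?thesis by (simp add: u_def)
qed

lemma green_upper_imaginary_part:
  assumes "x * (z + (\<Sum>l\<in>UNIV. complex_of_real (w l) * y l)) = - 1"
  shows "Im x = (cmod x)\<^sup>2 * (Im z + (\<Sum>l\<in>UNIV. w l * Im (y l)))"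
proof -
  define u where "u = z + (\<Sum>l\<in>UNIV. complex_of_real (w l) * y l)"
  have x: "x = - 1 / u" using assms by (intro eq_neg_inverse) (simp add: u_def)
  have "Im x = Im u / (cmod u)\<^sup>2" unfolding x by (rule Im_neg_inverse)
  also have "\<dots> = (cmod x)\<^sup>2 * Im u" unfolding x by (simp add: norm_divide power_divide)
  finally show ?thesis by (simp add: u_def)
qed

text \<open>A strictly positive strict supersolution of a nonnegative matrix excludes nonnegative
  eigenvectors with eigenvalue 1.\<close>

lemma nonneg_fixed_vector_zero:
  fixes h v :: "'k::finite \<Rightarrow> real"
  assumes A: "\<And>k l. 0 \<le> A k l" and v: "\<And>k. 0 < v k" "\<And>k. (\<Sum>l\<in>UNIV. A k l * v l) < v k"
    and h: "\<And>k. 0 \<le> h k" "\<And>k. h k = (\<Sum>l\<in>UNIV. A k l * h l)"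
  shows "h k = 0"
proof -
  \<comment> \<open>With t the largest ratio h/v one has h \<le> t v with equality at m, and
    applying A at m contradicts the strict inequality unless t = 0.\<close>
  obtain m where m: "\<And>l. h l / v l \<le> h m / v m" using finite_type_max[of "\<lambda>l. h l / v l"] by blast
  define t where "t = h m / v m"
  have t: "h l \<le> t * v l" for l using m[of l] v(1)[of l] by (simp add: t_def field_simps)
  have "t = 0"
  proof (rule ccontr)
    assume "t \<noteq> 0"
    then have t0: "0 < t" using h(1)[of m] v(1)[of m] by (simp add: t_def less_le)
    have "h m \<le> (\<Sum>l\<in>UNIV. A m l * (t * v l))" unfolding h(2)[of m] by (intro sum_mono mult_left_mono t A)
    also have "\<dots> = t * (\<Sum>l\<in>UNIV. A m l * v l)" by (simp add: sum_distrib_left mult_ac)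
    also have "\<dots> < t * v m" using t0 v(2) by simp
    finally show False using v(1)[of m] by (simp add: t_def)
  qed
  then show ?thesis using t[of k] h(1)[of k] by simp
qed

text \<open>The states with real boundary value at E satisfy the equivalence in the irreducibility
  hypothesis, so they are none or all of them. That the real case is open needs the supersolution
  argument, for which the Lipschitz constants are kept.\<close>

theorem boundary_values:
  fixes w :: "'k::finite \<Rightarrow> 'k \<Rightarrow> real"
  assumes w: "\<And>k l. 0 \<le> w k l" and \<zeta>: "green_solution w \<zeta>"
    and irr: "\<And>X. X \<noteq> {} \<Longrightarrow> (\<And>k. k \<in> X \<longleftrightarrow> (\<forall>l. 0 < w k l \<longrightarrow> l \<in> X)) \<Longrightarrow> X = UNIV"
  shows "\<exists>D Z. finite D \<and> (\<forall>k. \<forall>z\<in>upper. Z k z = \<zeta> k z) \<and>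
    (\<forall>k. continuous_on (closed_upper_minus D) (Z k)) \<and>
    (\<forall>z\<in>closed_upper_minus D. green_eq w z (\<lambda>k. Z k z)) \<and>
    (\<forall>E. E \<notin> D \<longrightarrow> (\<forall>k. 0 < Im (Z k (complex_of_real E))) \<or>
      (\<exists>r>0. \<forall>E'. \<bar>E' - E\<bar> < r \<longrightarrow> E' \<notin> D \<and> (\<forall>k. Im (Z k (complex_of_real E')) = 0)))"
proof -
  have hol: "\<zeta> k holomorphic_on upper" for k using \<zeta> by (simp add: green_solution_def)
  have Im_pos: "0 < Im (\<zeta> k z)" if "z \<in> upper" for k z using \<zeta> that by (simp add: green_solution_def)
  have eq: "\<zeta> k z * (z + (\<Sum>l\<in>UNIV. complex_of_real (w k l) * \<zeta> l z)) = - 1" if "z \<in> upper" for k z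
    using \<zeta> that unfolding green_solution_def green_eq_def by blast
  define lip where "lip k E r L \<longleftrightarrow> (\<forall>z\<in>upper \<inter> ball (complex_of_real E) r.
    \<forall>z'\<in>upper \<inter> ball (complex_of_real E) r. cmod (\<zeta> k z - \<zeta> k z') \<le> L * cmod (z - z'))" for k E r L
  have "\<forall>k. \<exists>D. finite D \<and> (\<forall>E. E \<notin> D \<longrightarrow> (\<exists>r>0. \<exists>L. lip k E r L))"
  proof
    fix k
    obtain P where "P \<noteq> 0" "\<forall>z\<in>upper. eval2 P z (\<zeta> k z) = 0"
      using green_solution_algebraic[OF w \<zeta>] by blast
    from algebraic_locally_lipschitz[OF hol this] show "\<exists>D. finite D \<and> (\<forall>E. E \<notin> D \<longrightarrow> (\<exists>r>0. \<exists>L. lip k E r L))"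
      unfolding lip_def .
  qed
  from choice[OF this] obtain Dk where Dk: "\<forall>k. finite (Dk k) \<and> (\<forall>E. E \<notin> Dk k \<longrightarrow> (\<exists>r>0. \<exists>L. lip k E r L))"
    by (rule exE)
  define D where "D = (\<Union>k. Dk k)"
  have fin: "finite D" unfolding D_def using Dk by simp
  have lip_mono: "lip k E r' L'" if "lip k E r L" "r' \<le> r" "L \<le> L'" for k E r r' L L'
    unfolding lip_def
  proof (intro ballI)
    fix z z' assume z: "z \<in> upper \<inter> ball (complex_of_real E) r'" "z' \<in> upper \<inter> ball (complex_of_real E) r'"
    have "cmod (\<zeta> k z - \<zeta> k z') \<le> L * cmod (z - z')" using that z unfolding lip_def by auto
    also have "\<dots> \<le> L' * cmod (z - z')" using that by (intro mult_right_mono) auto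
    finally show "cmod (\<zeta> k z - \<zeta> k z') \<le> L' * cmod (z - z')" .
  qed
  have local: "\<exists>r>0. \<exists>L>0. (\<forall>x. \<bar>x - E\<bar> < r \<longrightarrow> x \<notin> D) \<and> (\<forall>k. lip k E r L)" if E: "E \<notin> D" for E
  proof -
    have "\<forall>k. \<exists>r. 0 < r \<and> (\<exists>L. lip k E r L)" using Dk E unfolding D_def by auto
    from choice[OF this] obtain rk where rk: "\<forall>k. 0 < rk k \<and> (\<exists>L. lip k E (rk k) L)" by (rule exE)
    then have "\<forall>k. \<exists>L. lip k E (rk k) L" by blast
    from choice[OF this] obtain Lk where Lk: "\<forall>k. lip k E (rk k) (Lk k)" by (rule exE)
    have "open (- D)" using fin by (simp add: finite_imp_closed open_Compl)
    then obtain r0 where r0: "0 < r0" "ball E r0 \<subseteq> - D" using E open_contains_ball[of "- D"] by auto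
    define r where "r = min r0 (Min (range rk))"
    define L where "L = 1 + (\<Sum>k\<in>UNIV. \<bar>Lk k\<bar>)"
    have r: "0 < r" "r \<le> r0" "r \<le> rk k" for k
      unfolding r_def using r0 rk by (auto simp: min.coboundedI2)
    have L: "0 < L" "Lk k \<le> L" for k
    proof -
      have "\<bar>Lk k\<bar> \<le> (\<Sum>k\<in>UNIV. \<bar>Lk k\<bar>)" by (intro member_le_sum) auto
      then show "0 < L" "Lk k \<le> L" unfolding L_def by (auto simp: add_pos_nonneg sum_nonneg)
    qed
    have "x \<notin> D" if "\<bar>x - E\<bar> < r" for x
      using r0(2) r(2) that by (auto simp: subset_iff dist_real_def)
    then show ?thesis using r(1) L(1) lip_mono[OF Lk[rule_format] r(3) L(2)] by (intro exI[of _ r] exI[of _ L] conjI) auto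
  qed
  \<comment> \<open>On the real line the value is the limit from above; it exists outside D by the
    Lipschitz bound.\<close>
  define Z where "Z k z = (if 0 < Im z then \<zeta> k z else Lim (at z within upper) (\<zeta> k))" for k z
  have Z_upper: "Z k z = \<zeta> k z" if "z \<in> upper" for k z using that by (simp add: Z_def)
  have lim_real: "(\<zeta> k \<longlongrightarrow> Z k (complex_of_real x)) (at (complex_of_real x) within upper)" if x: "x \<notin> D" for k x
  proof -
    obtain r L where "0 < r" "\<forall>k. lip k x r L" using local[OF x] by blast
    then obtain l where l: "(\<zeta> k \<longlongrightarrow> l) (at (complex_of_real x) within upper)"
      using lipschitz_limit_upper[of r x "\<zeta> k" L x] unfolding lip_def by auto
    have "Z k (complex_of_real x) = l"
      unfolding Z_def using tendsto_Lim[OF real_at_within_upper l] by simp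
    then show ?thesis using l by simp
  qed
  have lim: "(\<zeta> k \<longlongrightarrow> Z k z) (at z within upper)" and nontriv: "at z within upper \<noteq> bot"
    if z: "z \<in> closed_upper_minus D" for k z
  proof -
    have "(\<zeta> k \<longlongrightarrow> Z k z) (at z within upper) \<and> at z within upper \<noteq> bot"
      using z
    proof (cases rule: closed_upper_minus_cases)
      case 1
      have "continuous_on upper (\<zeta> k)" by (rule holomorphic_on_imp_continuous_on[OF hol])
      then have "(\<zeta> k \<longlongrightarrow> \<zeta> k z) (at z within upper)" using 1 unfolding continuous_on_def by blast
      moreover have "at z within upper \<noteq> bot" using at_within_open[OF 1 open_upper] by simp
      ultimately show ?thesis using 1 by (simp add: Z_upper)
    next
      case (2 E)
      then show ?thesis using lim_real real_at_within_upper by simp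
    qed
    then show "(\<zeta> k \<longlongrightarrow> Z k z) (at z within upper)" "at z within upper \<noteq> bot" by auto
  qed
  have lipZ: "cmod (Z k z - Z k z') \<le> L * cmod (z - z')"
    if l: "lip k E r L" and z: "z \<in> closed_upper_minus D" "z \<in> ball (complex_of_real E) r"
      and z': "z' \<in> closed_upper_minus D" "z' \<in> ball (complex_of_real E) r" for k E r L z z'
  proof -
    have ev: "\<forall>\<^sub>F x in at a within upper. x \<in> upper \<inter> ball (complex_of_real E) r"
      if "a \<in> ball (complex_of_real E) r" for a
    proof -
      have "\<forall>\<^sub>F x in at a within upper. x \<in> ball (complex_of_real E) r"
        using that eventually_nhds_in_open[of "ball (complex_of_real E) r" a]
        by (auto simp: eventually_at_filter elim: eventually_mono)
      moreover have "\<forall>\<^sub>F x in at a within upper. x \<in> upper" by (auto simp: eventually_at_filter)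
      ultimately show ?thesis by eventually_elim auto
    qed
    \<comment> \<open>The Lipschitz bound is passed to the boundary in one variable at a
      time.\<close>
    have 1: "cmod (Z k z - \<zeta> k y) \<le> L * cmod (z - y)" if y: "y \<in> upper \<inter> ball (complex_of_real E) r" for y
    proof (rule tendsto_le[OF nontriv[OF z(1)]])
      show "((\<lambda>x. cmod (\<zeta> k x - \<zeta> k y)) \<longlongrightarrow> cmod (Z k z - \<zeta> k y)) (at z within upper)"
        by (intro tendsto_intros lim z)
      show "((\<lambda>x. L * cmod (x - y)) \<longlongrightarrow> L * cmod (z - y)) (at z within upper)"
        by (intro tendsto_intros)
      show "\<forall>\<^sub>F x in at z within upper. cmod (\<zeta> k x - \<zeta> k y) \<le> L * cmod (x - y)"
        using ev[OF z(2)] by eventually_elim (use l y in \<open>auto simp: lip_def\<close>)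
    qed
    show ?thesis
    proof (rule tendsto_le[OF nontriv[OF z'(1)]])
      show "((\<lambda>y. cmod (Z k z - \<zeta> k y)) \<longlongrightarrow> cmod (Z k z - Z k z')) (at z' within upper)"
        by (intro tendsto_intros lim z')
      show "((\<lambda>y. L * cmod (z - y)) \<longlongrightarrow> L * cmod (z - z')) (at z' within upper)"
        by (intro tendsto_intros)
      show "\<forall>\<^sub>F y in at z' within upper. cmod (Z k z - \<zeta> k y) \<le> L * cmod (z - y)"
        using ev[OF z'(2)] by eventually_elim (rule 1)
    qed
  qed
  have cont: "continuous_on (closed_upper_minus D) (Z k)" for k
    unfolding continuous_on_def
  proof
    fix z assume z: "z \<in> closed_upper_minus D"
    then show "(Z k \<longlongrightarrow> Z k z) (at z within closed_upper_minus D)"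
    proof (cases rule: closed_upper_minus_cases)
      case 1
      have "(\<zeta> k \<longlongrightarrow> \<zeta> k z) (at z)"
        using holomorphic_on_imp_continuous_on[OF hol, of k] 1 open_upper
        by (simp add: continuous_on_eq_continuous_at isCont_def)
      moreover have "\<forall>\<^sub>F x in at z. \<zeta> k x = Z k x"
        using eventually_at_in_open'[OF open_upper 1] by eventually_elim (simp add: Z_upper)
      ultimately have "(Z k \<longlongrightarrow> \<zeta> k z) (at z)" by (rule Lim_transform_eventually)
      then show ?thesis using 1 by (simp add: Z_upper tendsto_within_subset[of _ _ _ UNIV])
    next
      case (2 E)
      obtain r L where r: "0 < r" and L: "\<forall>k. lip k E r L" using local[OF 2(2)] by blast
      have "\<forall>\<^sub>F x in at z within closed_upper_minus D. x \<in> ball z r"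
        using r eventually_nhds_in_open[of "ball z r" z] by (auto simp: eventually_at_filter elim: eventually_mono)
      moreover have "\<forall>\<^sub>F x in at z within closed_upper_minus D. x \<in> closed_upper_minus D" by (auto simp: eventually_at_filter)
      ultimately have ev: "\<forall>\<^sub>F x in at z within closed_upper_minus D. norm (Z k x - Z k z) \<le> L * cmod (x - z)"
        by eventually_elim (use lipZ[OF L[rule_format]] 2 z r in auto)
      have lm: "((\<lambda>x. L * cmod (x - z)) \<longlongrightarrow> L * cmod (z - z)) (at z within closed_upper_minus D)"
        by (intro tendsto_intros)
      have "((\<lambda>x. Z k x - Z k z) \<longlongrightarrow> 0) (at z within closed_upper_minus D)"
        using lm by (intro Lim_null_comparison[OF ev]) (simp only: diff_self norm_zero mult_zero_right)
      then show ?thesis by (rule Lim_null[THEN iffD2])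
    qed
  qed
  have eqZ: "Z k z * (z + (\<Sum>l\<in>UNIV. complex_of_real (w k l) * Z l z)) = - 1" if z: "z \<in> closed_upper_minus D" for k z
  proof -
    have "((\<lambda>y. \<zeta> k y * (y + (\<Sum>l\<in>UNIV. complex_of_real (w k l) * \<zeta> l y))) \<longlongrightarrow>
        Z k z * (z + (\<Sum>l\<in>UNIV. complex_of_real (w k l) * Z l z))) (at z within upper)"
      by (intro tendsto_intros lim z)
    moreover have "\<forall>\<^sub>F y in at z within upper. \<zeta> k y * (y + (\<Sum>l\<in>UNIV. complex_of_real (w k l) * \<zeta> l y)) = - 1"
      using eq by (simp only: eventually_at_filter) (simp add: always_eventually)
    ultimately have "((\<lambda>y. - 1) \<longlongrightarrow> Z k z * (z + (\<Sum>l\<in>UNIV. complex_of_real (w k l) * Z l z))) (at z within upper)"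
      by (rule Lim_transform_eventually)
    from tendsto_unique[OF nontriv[OF z] this tendsto_const] show ?thesis .
  qed
  have nn: "0 \<le> Im (Z k z)" if z: "z \<in> closed_upper_minus D" for k z
  proof (rule tendsto_lowerbound[OF tendsto_Im[OF lim[OF z]] _ nontriv[OF z]])
    show "\<forall>\<^sub>F y in at z within upper. 0 \<le> Im (\<zeta> k y)"
      unfolding eventually_at_filter by (intro always_eventually allI impI less_imp_le Im_pos)
  qed
  have nz: "Z k z \<noteq> 0" if z: "z \<in> closed_upper_minus D" for k z using eqZ[OF z, of k] by auto
  \<comment> \<open>At a point z1 above E the scaled imaginary parts form a strict supersolution of
    the matrix |Z_k(z1)|^2 w_kl. The gap stays bounded below and survives replacing z1 by nearby
    real E', where the imaginary parts are a fixed vector and so vanish.\<close>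
  have real_case: "\<exists>r>0. \<forall>E'. \<bar>E' - E\<bar> < r \<longrightarrow> E' \<notin> D \<and> (\<forall>k. Im (Z k (complex_of_real E')) = 0)"
    if E: "E \<notin> D" and real: "\<And>k. Im (Z k (complex_of_real E)) = 0" for E
  proof -
    let ?E = "complex_of_real E"
    have mE: "?E \<in> closed_upper_minus D" using E by (simp add: of_real_in_closed_upper_minus)
    obtain r L where r: "0 < r" "\<And>x. \<bar>x - E\<bar> < r \<Longrightarrow> x \<notin> D" and L: "0 < L" "\<And>k. lip k E r L"
      using local[OF E] by blast
    define m where "m k z = (cmod (Z k z))\<^sup>2" for k z
    define W where "W = (\<Sum>k\<in>UNIV. \<Sum>l\<in>UNIV. w k l)"
    have W: "(\<Sum>l\<in>UNIV. w k l) \<le> W" for k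
      unfolding W_def by (intro member_le_sum sum_nonneg w) auto
    have W0: "0 \<le> W" unfolding W_def by (intro sum_nonneg w)
    define c where "c = Min (range (\<lambda>k. m k ?E)) / 2"
    have "0 < Min (range (\<lambda>k. m k ?E))" using nz[OF mE] by (simp add: m_def)
    then have c: "0 < c" by (simp add: c_def)
    have "Min (range (\<lambda>k. m k ?E)) \<le> m k ?E" for k by (intro Min_le) auto
    then have c2: "2 * c \<le> m k ?E" for k by (simp add: c_def)
    \<comment> \<open>Chosen so that a change of the matrix factors by \<epsilon> costs at most
      \<epsilon> W L \<le> c/2, half of the gap c.\<close>
    define \<epsilon> where "\<epsilon> = c / (2 * (W * L + 1))"
    have WL: "0 \<le> W * L" using W0 L by simp
    have \<epsilon>: "0 < \<epsilon>" "\<epsilon> \<le> c" "\<epsilon> * (W * L) \<le> c / 2"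
    proof -
      show "0 < \<epsilon>" unfolding \<epsilon>_def using c WL by (simp add: add_nonneg_pos)
      have "\<epsilon> * (2 * (W * L + 1)) = c" unfolding \<epsilon>_def using WL by simp
      then have *: "2 * (\<epsilon> * (W * L)) + 2 * \<epsilon> = c" by (simp add: algebra_simps)
      have "0 \<le> \<epsilon> * (W * L)" using \<open>0 < \<epsilon>\<close> WL by simp
      then show "\<epsilon> \<le> c" "\<epsilon> * (W * L) \<le> c / 2" using * \<open>0 < \<epsilon>\<close> by linarith+
    qed
    have "\<exists>s. 0 < s \<and> (\<forall>z\<in>closed_upper_minus D. dist z ?E < s \<longrightarrow> dist (m k z) (m k ?E) < \<epsilon> / 2)" for k
    proof -
      have "continuous_on (closed_upper_minus D) (m k)" unfolding m_def by (intro continuous_intros cont)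
      then show ?thesis using mE \<epsilon>(1) unfolding continuous_on_iff by (metis half_gt_zero)
    qed
    then have "\<forall>k. \<exists>s. 0 < s \<and> (\<forall>z\<in>closed_upper_minus D. dist z ?E < s \<longrightarrow> dist (m k z) (m k ?E) < \<epsilon> / 2)" by blast
    from choice[OF this] obtain sk where sk: "\<forall>k. 0 < sk k \<and> (\<forall>z\<in>closed_upper_minus D. dist z ?E < sk k \<longrightarrow> dist (m k z) (m k ?E) < \<epsilon> / 2)"
      by (rule exE)
    define s where "s = min r (Min (range sk))"
    have s: "0 < s" "s \<le> r" "s \<le> sk k" for k unfolding s_def using r sk by (auto simp: min.coboundedI2)
    have near: "\<bar>m k z - m k ?E\<bar> < \<epsilon> / 2" if "z \<in> closed_upper_minus D" "dist z ?E < s" for k z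
      using sk that s(3)[of k] by (auto simp: dist_real_def)
    define \<eta> where "\<eta> = s / 2"
    define z1 where "z1 = Complex E \<eta>"
    have \<eta>: "0 < \<eta>" using s by (simp add: \<eta>_def)
    have z1: "z1 \<in> upper" "z1 \<in> closed_upper_minus D" "dist z1 ?E < s" "cmod (z1 - ?E) = \<eta>" "Im z1 = \<eta>"
      using \<eta> upper_subset_closed_upper_minus[of D] by (auto simp: z1_def dist_norm cmod_def \<eta>_def)
    \<comment> \<open>Dividing by \<eta> = Im z1 turns the source term into 1. As Z is real at E,
      the Lipschitz bound gives v \<le> L however small \<eta> is.\<close>
    define v where "v k = Im (Z k z1) / \<eta>" for k
    have v_eq: "v k = m k z1 * (1 + (\<Sum>l\<in>UNIV. w k l * v l))" for k
    proof -
      have "Im (Z k z1) = m k z1 * (\<eta> + (\<Sum>l\<in>UNIV. w k l * Im (Z l z1)))"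
        using green_upper_imaginary_part[OF eqZ[OF z1(2)]] unfolding m_def z1(5) .
      then have "v k = m k z1 * ((\<eta> + (\<Sum>l\<in>UNIV. w k l * Im (Z l z1))) / \<eta>)" by (simp add: v_def)
      also have "(\<eta> + (\<Sum>l\<in>UNIV. w k l * Im (Z l z1))) / \<eta> = 1 + (\<Sum>l\<in>UNIV. w k l * v l)"
        using \<eta> by (simp add: add_divide_distrib sum_divide_distrib v_def)
      finally show ?thesis .
    qed
    have v_le: "v k \<le> L" for k
    proof -
      have "\<bar>Im (Z k z1 - Z k ?E)\<bar> \<le> cmod (Z k z1 - Z k ?E)" by (rule abs_Im_le_cmod)
      also have "\<dots> \<le> L * cmod (z1 - ?E)"
        using z1 mE r(1) s(2) by (intro lipZ[OF L(2)]) (auto simp: dist_commute)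
      finally have "Im (Z k z1) \<le> L * \<eta>" using real[of k] by (simp add: z1(4))
      then show ?thesis using \<eta> by (simp add: v_def field_simps)
    qed
    have v_nn: "0 \<le> v k" for k unfolding v_def using nn[OF z1(2)] \<eta> by simp
    have m_ge: "c \<le> m k z1" for k using near[OF z1(2,3), of k] c2[of k] \<epsilon>(2) by linarith
    have sum_nn: "0 \<le> (\<Sum>l\<in>UNIV. w k l * v l)" for k by (intro sum_nonneg mult_nonneg_nonneg w v_nn)
    have v_pos: "0 < v k" for k
    proof -
      have "0 < m k z1 * (1 + (\<Sum>l\<in>UNIV. w k l * v l))"
        using m_ge[of k] c sum_nn[of k] by (intro mult_pos_pos) linarith+
      then show ?thesis unfolding v_eq[of k, symmetric] .
    qed
    have sum_le: "(\<Sum>l\<in>UNIV. w k l * v l) \<le> W * L" for k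
    proof -
      have "(\<Sum>l\<in>UNIV. w k l * v l) \<le> (\<Sum>l\<in>UNIV. w k l * L)" by (intro sum_mono mult_left_mono v_le w)
      also have "\<dots> \<le> W * L" using W[of k] L by (simp add: mult_right_mono flip: sum_distrib_right)
      finally show ?thesis .
    qed
    have "E' \<notin> D \<and> (\<forall>k. Im (Z k (complex_of_real E')) = 0)" if E': "\<bar>E' - E\<bar> < s" for E'
    proof -
      let ?E' = "complex_of_real E'"
      have nD: "E' \<notin> D" using r(2) E' s(2) by auto
      then have mE': "?E' \<in> closed_upper_minus D" by (simp add: of_real_in_closed_upper_minus)
      have d: "dist ?E' ?E < s" using E' by (simp add: dist_of_real dist_real_def)
      \<comment> \<open>The term m_k(z1), at least c, is the gap; the error from passing to E' is
        absorbed by it.\<close>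
      have super: "(\<Sum>l\<in>UNIV. m k ?E' * w k l * v l) < v k" for k
      proof -
        have "m k ?E' \<le> m k z1 + \<epsilon>" using near[OF z1(2,3), of k] near[OF mE' d, of k] by linarith
        then have "m k ?E' * (\<Sum>l\<in>UNIV. w k l * v l) \<le> (m k z1 + \<epsilon>) * (\<Sum>l\<in>UNIV. w k l * v l)"
          using sum_nn by (intro mult_right_mono)
        also have "\<dots> = (v k - m k z1) + \<epsilon> * (\<Sum>l\<in>UNIV. w k l * v l)"
          unfolding v_eq[of k] distrib_right distrib_left by (simp only: mult_1_right add_diff_cancel_left')
        also have "\<dots> \<le> (v k - c) + \<epsilon> * (W * L)"
          using m_ge[of k] mult_left_mono[OF sum_le less_imp_le[OF \<epsilon>(1)], of k] by linarith
        also have "\<dots> < v k" using \<epsilon>(3) c by linarith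
        finally show ?thesis by (simp add: sum_distrib_left mult.assoc)
      qed
      have fixp: "Im (Z k ?E') = (\<Sum>l\<in>UNIV. m k ?E' * w k l * Im (Z l ?E'))" for k
        unfolding m_def mult.assoc sum_distrib_left[symmetric] by (rule green_boundary_imaginary_part[OF eqZ[OF mE']])
      have "Im (Z k ?E') = 0" for k
        by (rule nonneg_fixed_vector_zero[OF _ v_pos super nn[OF mE'] fixp]) (simp add: m_def w)
      then show ?thesis using nD by blast
    qed
    then show ?thesis using s(1) by blast
  qed
  have dich: "(\<forall>k. 0 < Im (Z k (complex_of_real E))) \<or> (\<forall>k. Im (Z k (complex_of_real E)) = 0)" if E: "E \<notin> D" for E
  proof -
    let ?E = "complex_of_real E"
    have mE: "?E \<in> closed_upper_minus D" using E by (simp add: of_real_in_closed_upper_minus)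
    define X where "X = {k. Im (Z k ?E) = 0}"
    have iff: "k \<in> X \<longleftrightarrow> (\<forall>l. 0 < w k l \<longrightarrow> l \<in> X)" for k
    proof -
      have "Im (Z k ?E) = (cmod (Z k ?E))\<^sup>2 * (\<Sum>l\<in>UNIV. w k l * Im (Z l ?E))"
        by (rule green_boundary_imaginary_part[OF eqZ[OF mE]])
      then have "k \<in> X \<longleftrightarrow> (\<Sum>l\<in>UNIV. w k l * Im (Z l ?E)) = 0" using nz[OF mE, of k] by (simp add: X_def)
      also have "\<dots> \<longleftrightarrow> (\<forall>l. w k l * Im (Z l ?E) = 0)"
        using w nn[OF mE] by (subst sum_nonneg_eq_0_iff) auto
      also have "\<dots> \<longleftrightarrow> (\<forall>l. 0 < w k l \<longrightarrow> l \<in> X)"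
        using w[of k] by (auto simp: X_def less_le)
      finally show ?thesis .
    qed
    show ?thesis
    proof (cases "X = {}")
      case True
      then have "Im (Z k ?E) \<noteq> 0" for k by (auto simp: X_def)
      then have "0 < Im (Z k ?E)" for k using nn[OF mE, of k] by (metis order_le_less)
      then show ?thesis by blast
    next
      case False
      then have "X = UNIV" by (rule irr[OF _ iff])
      then show ?thesis unfolding X_def by blast
    qed
  qed
  show ?thesis
  proof (intro exI conjI)
    show "\<forall>E. E \<notin> D \<longrightarrow> (\<forall>k. 0 < Im (Z k (complex_of_real E))) \<or>
      (\<exists>r>0. \<forall>E'. \<bar>E' - E\<bar> < r \<longrightarrow> E' \<notin> D \<and> (\<forall>k. Im (Z k (complex_of_real E')) = 0))"
      using dich real_case by blast
    show "\<forall>z\<in>closed_upper_minus D. green_eq w z (\<lambda>k. Z k z)"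
      unfolding green_eq_def by (intro ballI allI eqZ)
    show "\<forall>k. \<forall>z\<in>upper. Z k z = \<zeta> k z" by (intro ballI allI Z_upper)
  qed (use fin cont in blast)+
qed

section \<open>Non-backtracking walks\<close>

text \<open>A cycle traversed in one direction: the darts \<open>ed k\<close> meet each vertex once
  and contain exactly one of the two darts of every edge.\<close>

definition is_orbit_cycle :: "('o \<Rightarrow> 'r) \<Rightarrow> ('o \<Rightarrow> 'r) \<Rightarrow> ('o \<Rightarrow> 'o) \<Rightarrow> bool" where
  "is_orbit_cycle src tgt rv \<longleftrightarrow> (\<exists>n>0. \<exists>w ed. bij_betw w {..<n} UNIV \<and>
     (\<forall>k<n. src (ed k) = w k \<and> tgt (ed k) = w (Suc k mod n)) \<and>
     (\<forall>j<n. \<forall>k<n. ed j \<noteq> rv (ed k)) \<and> (\<forall>p. \<exists>k<n. p = ed k \<or> p = rv (ed k)))"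

text \<open>Each edge is two darts exchanged by the fixed-point-free \<open>rv\<close>, so a loop
  gives two distinct darts at its vertex. Connectedness is stated through vertex sets closed under
  darts.\<close>

locale dart_graph =
  fixes src tgt :: "'o::finite \<Rightarrow> 'r::finite" and rv :: "'o \<Rightarrow> 'o"
  assumes rv_rv [simp]: "rv (rv p) = p" and rv_neq: "rv p \<noteq> p" and src_rv [simp]: "src (rv p) = tgt p"
    and conn: "W \<noteq> {} \<Longrightarrow> (\<And>p. src p \<in> W \<Longrightarrow> tgt p \<in> W) \<Longrightarrow> W = UNIV"
    and deg: "2 \<le> card {p. src p = x}"
begin

lemma tgt_rv [simp]: "tgt (rv p) = src p"
  using src_rv[of "rv p"] by simp

definition outs :: "'r \<Rightarrow> 'o set" where "outs x = {p. src p = x}"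

definition ins :: "'r \<Rightarrow> 'o set" where "ins x = {p. tgt p = x}"

definition follows :: "'o \<Rightarrow> 'o \<Rightarrow> bool" where "follows p q \<longleftrightarrow> src q = tgt p \<and> q \<noteq> rv p"

lemma rv_image_ins: "rv ` ins x = outs x"
proof
  show "outs x \<subseteq> rv ` ins x" by (auto simp: ins_def outs_def image_iff intro!: exI[of _ "rv _"])
qed (auto simp: ins_def outs_def)

lemma inj_rv: "inj rv"
  by (metis injI rv_rv)

lemma card_ins: "card (ins x) = card (outs x)"
  using card_image[OF inj_on_subset[OF inj_rv subset_UNIV], of "ins x"] by (simp add: rv_image_ins)

lemma card_outs: "2 \<le> card (outs x)"
  using deg by (simp add: outs_def)

text \<open>A vertex of degree 2 through which Z passes exactly once: in by p, out by the
  continuation q.\<close>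

definition simple_at :: "'o set \<Rightarrow> 'r \<Rightarrow> bool" where
  "simple_at Z x \<longleftrightarrow> (\<exists>p q. ins x \<inter> Z = {p} \<and> outs x \<inter> Z = {q} \<and> q \<noteq> rv p \<and> outs x = {rv p, q})"

lemma card_by_vertices:
  fixes A :: "'r \<Rightarrow> 'o set"
  assumes "\<And>p. p \<in> A (f p)" "\<And>p x. p \<in> A x \<Longrightarrow> f p = x"
  shows "card Z = (\<Sum>x\<in>UNIV. card (A x \<inter> Z))"
proof -
  have "Z = (\<Union>x\<in>UNIV. A x \<inter> Z)" using assms(1) by blast
  then have "card Z = card (\<Union>x\<in>UNIV. A x \<inter> Z)" by simp
  also have "\<dots> = (\<Sum>x\<in>UNIV. card (A x \<inter> Z))"
    by (intro card_UN_disjoint) (auto dest: assms(2))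
  finally show ?thesis .
qed

text \<open>A successor-closed set contains at least as many outgoing as incoming darts at every vertex;
  both counts have the same total, so they agree at every vertex.\<close>

lemma closed_set_at_vertex:
  assumes cl: "\<And>p q. p \<in> Z \<Longrightarrow> follows p q \<Longrightarrow> q \<in> Z"
  shows "(ins x \<inter> Z = {} \<and> outs x \<inter> Z = {}) \<or> simple_at Z x \<or> (ins x \<subseteq> Z \<and> outs x \<subseteq> Z)"
proof -
  have sub: "outs x - {rv p} \<subseteq> Z" if "p \<in> ins x \<inter> Z" for x p
    using that cl[of p] by (auto simp: ins_def outs_def follows_def)
  have two: "outs x \<subseteq> Z" if "p \<in> ins x \<inter> Z" "p' \<in> ins x \<inter> Z" "p \<noteq> p'" for x p p'
  proof -
    have "rv p \<noteq> rv p'" using that(3) rv_rv by metis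
    then show ?thesis using sub[OF that(1)] sub[OF that(2)] by blast
  qed
  \<comment> \<open>Two incoming darts of Z force all outgoing ones; a single one forces all but its
    reverse, which is at least one since degrees are at least 2.\<close>
  have le: "card (ins x \<inter> Z) \<le> card (outs x \<inter> Z)" for x
  proof (cases "\<exists>p p'. p \<in> ins x \<inter> Z \<and> p' \<in> ins x \<inter> Z \<and> p \<noteq> p'")
    case True
    then have "outs x \<subseteq> Z" using two by blast
    then have "outs x \<inter> Z = outs x" by blast
    moreover have "card (ins x \<inter> Z) \<le> card (ins x)" by (rule card_mono) auto
    ultimately show ?thesis by (simp add: card_ins)
  next
    case False
    show ?thesis
    proof (cases "ins x \<inter> Z = {}")
      case no: False
      then obtain p where p: "p \<in> ins x \<inter> Z" by blast
      then have "ins x \<inter> Z = {p}" using False by blast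
      moreover have "card (outs x - {rv p}) \<le> card (outs x \<inter> Z)" using sub[OF p] by (intro card_mono) auto
      moreover have "card (outs x) - 1 \<le> card (outs x - {rv p})" by (simp add: card_Diff_singleton_if)
      ultimately show ?thesis using card_outs[of x] by simp
    qed simp
  qed
  have "(\<Sum>x\<in>UNIV. card (ins x \<inter> Z)) = (\<Sum>x\<in>UNIV. card (outs x \<inter> Z))"
  proof (rule trans[OF sym])
    show "card Z = (\<Sum>x\<in>UNIV. card (ins x \<inter> Z))" by (rule card_by_vertices[of ins tgt]) (simp_all add: ins_def)
    show "card Z = (\<Sum>x\<in>UNIV. card (outs x \<inter> Z))" by (rule card_by_vertices[of outs src]) (simp_all add: outs_def)
  qed
  \<comment> \<open>A termwise inequality between families of equal sum is an equality.\<close>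
  then have eq: "card (ins x \<inter> Z) = card (outs x \<inter> Z)"
    by (rule sum_mono_inv[where f = "\<lambda>x. card (ins x \<inter> Z)" and g = "\<lambda>x. card (outs x \<inter> Z)"])
      (simp_all add: le)
  show ?thesis
  proof (cases "ins x \<inter> Z = {}")
    case True
    then show ?thesis using eq by simp
  next
    case False
    then obtain p where p: "p \<in> ins x \<inter> Z" by blast
    show ?thesis
    proof (cases "ins x \<inter> Z = {p}")
      case True
      then have "card (outs x \<inter> Z) = 1" using eq by simp
      then obtain q where q: "outs x \<inter> Z = {q}" by (rule card_1_singletonE)
      have rp: "rv p \<in> outs x" using p by (simp add: ins_def outs_def)
      have subq: "outs x - {rv p} \<subseteq> {q}" using sub[OF p] q by blast
      have "card (outs x - {rv p}) = card (outs x) - 1" using rp by simp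
      then have "card (outs x - {rv p}) \<noteq> 0" using card_outs[of x] by linarith
      then have "outs x - {rv p} \<noteq> {}" by (metis card.empty)
      then have d: "outs x - {rv p} = {q}" using subq by (metis subset_singletonD)
      have "q \<in> outs x - {rv p}" unfolding d by simp
      moreover have "outs x = {rv p, q}" using insert_Diff[OF rp] unfolding d by simp
      ultimately have "q \<noteq> rv p \<and> outs x = {rv p, q}" by simp
      then show ?thesis unfolding simple_at_def using True q by metis
    next
      case no: False
      then obtain p' where "p' \<in> ins x \<inter> Z" "p' \<noteq> p" using p by blast
      then have o: "outs x \<subseteq> Z" using two p by blast
      then have "outs x \<inter> Z = outs x" by blast
      then have "card (ins x \<inter> Z) = card (ins x)" using eq by (simp add: card_ins)
      then have "ins x \<inter> Z = ins x" by (intro card_subset_eq) auto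
      then show ?thesis using o by blast
    qed
  qed
qed

text \<open>Both nontrivial local types spread along edges. A vertex wholly in Z puts an edge with
  both directions in Z at its neighbour, which is impossible at a simple vertex; with no such
  vertex, simple ones have only simple neighbours.\<close>

lemma closed_set_cases:
  assumes cl: "\<And>p q. p \<in> Z \<Longrightarrow> follows p q \<Longrightarrow> q \<in> Z" and ne: "Z \<noteq> {}"
  shows "Z = UNIV \<or> (\<forall>x. simple_at Z x)"
proof -
  have vc: "(ins x \<inter> Z = {} \<and> outs x \<inter> Z = {}) \<or> simple_at Z x \<or> (ins x \<subseteq> Z \<and> outs x \<subseteq> Z)" for x
    by (rule closed_set_at_vertex) (rule cl)
  define W where "W = {x. ins x \<subseteq> Z \<and> outs x \<subseteq> Z}"
  show ?thesis
  proof (cases "W = {}")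
    case False
    have "tgt p \<in> W" if "src p \<in> W" for p
    proof -
      have p: "p \<in> Z" "rv p \<in> Z" using that by (auto simp: W_def ins_def outs_def)
      have mem: "p \<in> ins (tgt p) \<inter> Z" "rv p \<in> outs (tgt p) \<inter> Z" using p by (auto simp: ins_def outs_def)
      have "\<not> simple_at Z (tgt p)"
      proof
        assume "simple_at Z (tgt p)"
        then obtain p' q where e: "ins (tgt p) \<inter> Z = {p'}" "outs (tgt p) \<inter> Z = {q}" "q \<noteq> rv p'"
          unfolding simple_at_def by (elim exE conjE)
        have "p = p'" "rv p = q" using mem unfolding e by simp_all
        then show False using e(3) by simp
      qed
      then show ?thesis using vc[where x = "tgt p"] mem by (auto simp: W_def)
    qed
    then have "W = UNIV" using False conn by blast
    then have "p \<in> Z" for p by (auto simp: W_def outs_def)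
    then show ?thesis by blast
  next
    case True
    define T where "T = {x. simple_at Z x}"
    have T: "x \<in> T" if "p \<in> Z" "tgt p = x \<or> src p = x" for x p
    proof -
      have "\<not> (ins x \<inter> Z = {} \<and> outs x \<inter> Z = {})" using that by (auto simp: ins_def outs_def)
      moreover have "x \<notin> W" using True by blast
      ultimately show ?thesis using vc[where x = x] by (auto simp: T_def W_def)
    qed
    have "tgt p \<in> T" if src: "src p \<in> T" for p
    proof -
      obtain p' q where pq: "ins (src p) \<inter> Z = {p'}" "outs (src p) \<inter> Z = {q}" "outs (src p) = {rv p', q}"
        using src by (auto simp: T_def simple_at_def)
      have "p \<in> {rv p', q}" unfolding pq(3)[symmetric] by (simp add: outs_def)
      then show ?thesis
      proof
        assume "p = rv p'"
        moreover have "p' \<in> Z" using pq(1) by blast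
        ultimately show ?thesis using T[of p' "src p'"] by simp
      next
        assume "p \<in> {q}"
        then have "p \<in> Z" using pq(2) by blast
        then show ?thesis using T[of p "tgt p"] by simp
      qed
    qed
    moreover have "T \<noteq> {}" using ne T by blast
    ultimately have "T = UNIV" using conn by blast
    then show ?thesis by (auto simp: T_def)
  qed
qed

text \<open>Following the unique outgoing dart in Z is an injective self-map of a finite vertex set.
  One orbit closes up, is closed under both neighbours of each of its vertices, and so is everything
  by connectedness.\<close>

lemma simple_everywhere_cycle:
  assumes simple: "\<And>x. simple_at Z x"
  shows "is_orbit_cycle src tgt rv"
proof -
  have "\<forall>x. \<exists>q. \<exists>p. ins x \<inter> Z = {p} \<and> outs x \<inter> Z = {q} \<and> q \<noteq> rv p \<and> outs x = {rv p, q}"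
    using simple unfolding simple_at_def by blast
  from choice[OF this] obtain nx where
    "\<forall>x. \<exists>p. ins x \<inter> Z = {p} \<and> outs x \<inter> Z = {nx x} \<and> nx x \<noteq> rv p \<and> outs x = {rv p, nx x}" by (rule exE)
  from choice[OF this] obtain pv where
    *: "\<forall>x. ins x \<inter> Z = {pv x} \<and> outs x \<inter> Z = {nx x} \<and> nx x \<noteq> rv (pv x) \<and> outs x = {rv (pv x), nx x}"
    by (rule exE)
  note ** = *[THEN spec]
  have pv: "ins x \<inter> Z = {pv x}" for x by (rule conjunct1[OF **])
  have nx: "outs x \<inter> Z = {nx x}" for x by (rule conjunct1[OF conjunct2[OF **]])
  have neq: "nx x \<noteq> rv (pv x)" for x by (rule conjunct1[OF conjunct2[OF conjunct2[OF **]]])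
  have outs: "outs x = {rv (pv x), nx x}" for x by (rule conjunct2[OF conjunct2[OF conjunct2[OF **]]])
  define s where "s x = tgt (nx x)" for x
  have "nx x \<in> outs x \<inter> Z" "pv x \<in> ins x \<inter> Z" for x unfolding nx pv by simp_all
  then have nxZ: "nx x \<in> Z" "src (nx x) = x" and pvZ: "pv x \<in> Z" "tgt (pv x) = x" for x
    by (auto simp: outs_def ins_def)
  have nx_src: "nx (src p) = p" if "p \<in> Z" for p
  proof -
    have "p \<in> outs (src p) \<inter> Z" using that by (simp add: outs_def)
    then show ?thesis unfolding nx by simp
  qed
  have pv_tgt: "pv (tgt p) = p" if "p \<in> Z" for p
  proof -
    have "p \<in> ins (tgt p) \<inter> Z" using that by (simp add: ins_def)
    then show ?thesis unfolding pv by simp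
  qed
  have s_inj: "inj s"
  proof (rule injI)
    fix x y assume "s x = s y"
    then have "nx x = nx y" using pv_tgt[OF nxZ(1)] unfolding s_def by metis
    then show "x = y" using nxZ(2) by metis
  qed
  have s_src_pv: "s (src (pv x)) = x" for x unfolding s_def using nx_src[OF pvZ(1)] pvZ(2) by simp
  obtain x0 :: 'r where True by simp
  define P where "P n \<longleftrightarrow> 0 < n \<and> (s ^^ n) x0 = x0" for n
  \<comment> \<open>The least period makes the n vertices of the orbit distinct.\<close>
  define n where "n = (LEAST n. P n)"
  have shift: "P (j - i)" if "i < j" "(s ^^ i) x0 = (s ^^ j) x0" for i j
  proof -
    have "(s ^^ i) x0 = (s ^^ (i + (j - i))) x0" using that by simp
    also have "\<dots> = (s ^^ i) ((s ^^ (j - i)) x0)" by (simp only: funpow_add o_apply)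
    finally have "x0 = (s ^^ (j - i)) x0" by (rule injD[OF inj_fn[OF s_inj]])
    then show ?thesis unfolding P_def using that(1) by simp
  qed
  obtain n0 where "0 < n0" "(s ^^ n0) x0 = x0" by (rule funpow_inj_finite[OF s_inj]) auto
  then have "P n0" by (simp add: P_def)
  then have Pn: "P n" unfolding n_def by (rule LeastI)
  then have n: "0 < n" "(s ^^ n) x0 = x0" by (auto simp: P_def)
  define w where "w k = (s ^^ k) x0" for k
  have w_inj: "inj_on w {..<n}"
  proof -
    have False if "i < j" "j < n" "w i = w j" for i j
    proof -
      have "P (j - i)" using shift that by (simp add: w_def)
      then have "n \<le> j - i" unfolding n_def by (rule Least_le)
      then show False using that by simp
    qed
    note * = this
    show ?thesis
    proof (rule inj_onI, rule ccontr)
      fix i j assume "i \<in> {..<n}" "j \<in> {..<n}" "w i = w j" "i \<noteq> j"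
      then show False using *[of i j] *[of j i] by (cases "i < j") auto
    qed
  qed
  have w_Suc: "w (Suc k mod n) = s (w k)" if "k < n" for k
  proof (cases "Suc k = n")
    case True
    then show ?thesis using n(2) by (auto simp: w_def)
  next
    case False
    then show ?thesis using that by (simp add: w_def)
  qed
  have pred: "src (pv (w k)) \<in> w ` {..<n}" if "k < n" for k
  proof (cases k)
    case 0
    have "w 0 = s (w (n - 1))" using w_Suc[of "n - 1"] n(1) by simp
    then have "s (src (pv (w k))) = s (w (n - 1))" unfolding s_src_pv 0 .
    then have "src (pv (w k)) = w (n - 1)" by (rule injD[OF s_inj])
    moreover have "n - 1 \<in> {..<n}" using n(1) by simp
    ultimately show ?thesis by (rule image_eqI)
  next
    case (Suc m)
    then have "w k = s (w m)" by (simp add: w_def)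
    then have "s (src (pv (w k))) = s (w m)" unfolding s_src_pv .
    then have "src (pv (w k)) = w m" by (rule injD[OF s_inj])
    moreover have "m \<in> {..<n}" using that Suc by simp
    ultimately show ?thesis by (rule image_eqI)
  qed
  have "w ` {..<n} = UNIV"
  proof (rule conn)
    show "w ` {..<n} \<noteq> {}" using n(1) by auto
    fix p assume "src p \<in> w ` {..<n}"
    then obtain k where k: "k < n" "src p = w k" by auto
    have "p \<in> {rv (pv (w k)), nx (w k)}" unfolding outs[symmetric] using k by (simp add: outs_def)
    then show "tgt p \<in> w ` {..<n}"
    proof
      assume "p = rv (pv (w k))"
      then show ?thesis using pred[OF k(1)] by simp
    next
      assume "p \<in> {nx (w k)}"
      then have "tgt p = w (Suc k mod n)" using w_Suc[OF k(1)] by (simp add: s_def)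
      then show ?thesis using n(1) by simp
    qed
  qed
  then have bij: "bij_betw w {..<n} UNIV" using w_inj by (simp add: bij_betw_def)
  define ed where "ed k = nx (w k)" for k
  have 1: "src (ed k) = w k \<and> tgt (ed k) = w (Suc k mod n)" if "k < n" for k
    using w_Suc[OF that] nxZ(2) by (simp add: ed_def s_def)
  have 2: "ed j \<noteq> rv (ed k)" for j k
  proof
    assume eq: "ed j = rv (ed k)"
    then have "tgt (ed j) = w k" using nxZ(2) by (simp add: ed_def)
    then have "pv (w k) = ed j" using pv_tgt[of "ed j"] nxZ(1) by (simp add: ed_def)
    then have "rv (pv (w k)) = ed k" using eq by simp
    then show False using neq[of "w k"] by (simp add: ed_def)
  qed
  have 3: "\<exists>k<n. p = ed k \<or> p = rv (ed k)" for p
  proof -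
    have surj: "\<exists>k<n. x = w k" for x using bij by (auto simp: bij_betw_def)
    have "p \<in> {rv (pv (src p)), nx (src p)}" unfolding outs[symmetric] by (simp add: outs_def)
    then show ?thesis
    proof
      assume p: "p = rv (pv (src p))"
      obtain k where "k < n" "src (pv (src p)) = w k" using surj by blast
      then have "pv (src p) = ed k" using nx_src[OF pvZ(1)] unfolding ed_def by metis
      then show ?thesis using p \<open>k < n\<close> by metis
    next
      assume "p \<in> {nx (src p)}"
      moreover obtain k where "k < n" "src p = w k" using surj by blast
      ultimately show ?thesis by (auto simp: ed_def)
    qed
  qed
  show ?thesis unfolding is_orbit_cycle_def using n(1) bij 1 2 3 by blast
qed

text \<open>Darts after which the next n steps of a non-backtracking walk are forced;
  \<open>unbranched N = {}\<close> says that every walk meets a branching within N steps.\<close>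

fun unbranched :: "nat \<Rightarrow> 'o set" where
  "unbranched 0 = UNIV"
| "unbranched (Suc n) = {p. (\<exists>!q. follows p q) \<and> (\<forall>q. follows p q \<longrightarrow> q \<in> unbranched n)}"

lemma unbranched_Suc_iff:
  "p \<in> unbranched (Suc n) \<longleftrightarrow> (\<exists>!q. follows p q) \<and> (\<forall>q. follows p q \<longrightarrow> q \<in> unbranched n)"
  by simp

declare unbranched.simps(2) [simp del]

lemma unbranched_antimono: "unbranched (Suc n) \<subseteq> unbranched n"
proof (induction n)
  case (Suc n)
  show ?case
  proof
    fix p assume "p \<in> unbranched (Suc (Suc n))"
    then have *: "(\<exists>!q. follows p q) \<and> (\<forall>q. follows p q \<longrightarrow> q \<in> unbranched (Suc n))"
      by (rule unbranched_Suc_iff[THEN iffD1])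
    show "p \<in> unbranched (Suc n)"
      unfolding unbranched_Suc_iff[of p n]
    proof (rule conjI[OF conjunct1[OF *]], intro allI impI)
      fix q assume "follows p q"
      then have "q \<in> unbranched (Suc n)" by (rule *[THEN conjunct2, rule_format])
      then show "q \<in> unbranched n" by (rule subsetD[OF Suc])
    qed
  qed
qed simp

context
  assumes not_cycle: "\<not> is_orbit_cycle src tgt rv"
begin

text \<open>Strong connectivity of the non-backtracking walk: what is reachable from one dart is
  every dart.\<close>

theorem closed_set_UNIV:
  assumes "\<And>p q. p \<in> Z \<Longrightarrow> follows p q \<Longrightarrow> q \<in> Z" "Z \<noteq> {}"
  shows "Z = UNIV"
proof -
  have "Z = UNIV \<or> (\<forall>x. simple_at Z x)"
  proof (rule closed_set_cases)
    show "q \<in> Z" if "p \<in> Z" "follows p q" for p q using that by (rule assms(1))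
  qed (rule assms(2))
  then show ?thesis using simple_everywhere_cycle[of Z] not_cycle by blast
qed

text \<open>Otherwise the darts with a forever forced future form a nonempty closed set, so every
  dart has a single follower. The orbit of a dart p0 is then closed and must contain
  \<open>rv p0\<close>, yet a forced walk cannot turn around.\<close>

theorem unbranched_empty: "\<exists>N. unbranched N = {}"
proof (rule ccontr)
  assume "\<not> (\<exists>N. unbranched N = {})"
  then have ne: "unbranched N \<noteq> {}" for N by simp
  have mono: "unbranched n \<subseteq> unbranched m" if "m \<le> n" for m n
    using that by (induction rule: dec_induct) (use unbranched_antimono in blast)+
  define B where "B = (\<Inter>n. unbranched n)"
  have "B \<noteq> {}"
  proof
    assume "B = {}"
    then have "\<forall>p. \<exists>n. p \<notin> unbranched n" unfolding B_def by blast
    from choice[OF this] obtain f where f: "\<forall>p. p \<notin> unbranched (f p)" by (rule exE)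
    define N where "N = Max (range f)"
    have "p \<notin> unbranched N" for p
      using f mono[of "f p" N] Max_ge[of "range f" "f p"] unfolding N_def by auto
    then show False using ne[of N] by blast
  qed
  have B_closed: "q \<in> B" if "p \<in> B" "follows p q" for p q
  proof -
    have "q \<in> unbranched n" for n
    proof -
      have "p \<in> unbranched (Suc n)" using that(1) unfolding B_def by blast
      from this[unfolded unbranched_Suc_iff, THEN conjunct2, rule_format, OF that(2)] show ?thesis .
    qed
    then show ?thesis unfolding B_def by blast
  qed
  have "B = UNIV"
  proof (rule closed_set_UNIV)
    show "q \<in> B" if "p \<in> B" "follows p q" for p q using that by (rule B_closed)
  qed (rule \<open>B \<noteq> {}\<close>)
  then have "\<exists>!q. follows p q" for p
  proof -
    have "p \<in> unbranched (Suc 0)" using \<open>B = UNIV\<close> unfolding B_def by blast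
    from this[unfolded unbranched_Suc_iff, THEN conjunct1] show ?thesis .
  qed
  then have "\<forall>p. \<exists>q. follows p q \<and> (\<forall>q'. follows p q' \<longrightarrow> q' = q)" by blast
  from choice[OF this] obtain s where s: "\<And>p. follows p (s p)" "\<And>p q. follows p q \<Longrightarrow> q = s p" by blast
  \<comment> \<open>Reversal in time: p precedes s p, so the reverse of p is the follower of the
    reverse of s p.\<close>
  have s_rv: "s (rv (s p)) = rv p" for p
  proof -
    have "follows (rv (s p)) (rv p)" using s(1)[of p] unfolding follows_def by auto
    then show ?thesis using s(2) by metis
  qed
  have s_inj: "p = q" if "s p = s q" for p q using s_rv[of p] s_rv[of q] that rv_rv by metis
  \<comment> \<open>A walk from p to its reverse would fold onto itself: cancelling one step at each
    end leads from p and k to s p and k - 2, until a dart equals its reverse or is followed by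
    it.\<close>
  have no: "rv p \<noteq> (s ^^ k) p" for k p
  proof (induction k arbitrary: p rule: less_induct)
    case (less k)
    consider "k = 0" | "k = 1" | m where "k = Suc (Suc m)" by (metis One_nat_def not0_implies_Suc)
    then show ?case
    proof cases
      case 1
      then show ?thesis using rv_neq by simp
    next
      case 2
      have "s p \<noteq> rv p" using s(1)[of p] by (simp add: follows_def)
      then show ?thesis using 2 by auto
    next
      case 3
      show ?thesis
      proof
        assume eq: "rv p = (s ^^ k) p"
        have "s (rv (s p)) = s ((s ^^ Suc m) p)" using eq s_rv[of p] by (simp add: 3)
        then have "rv (s p) = (s ^^ Suc m) p" by (rule s_inj)
        then have "rv (s p) = (s ^^ m) (s p)" by (simp only: funpow_Suc_right o_apply)
        then show False using less[of m "s p"] 3 by simp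
      qed
    qed
  qed
  obtain p0 :: 'o where True by simp
  define Z where "Z = range (\<lambda>k. (s ^^ k) p0)"
  have "Z = UNIV"
  proof (rule closed_set_UNIV)
    fix p q assume "p \<in> Z" "follows p q"
    then obtain k where "p = (s ^^ k) p0" "q = s p" using s(2) by (auto simp: Z_def)
    then have "q = (s ^^ Suc k) p0" by simp
    then show "q \<in> Z" unfolding Z_def by blast
  qed (simp add: Z_def)
  then have "rv p0 \<in> Z" by blast
  then show False using no[of p0] by (auto simp: Z_def)
qed

end

end

section \<open>Darts of a multigraph\<close>

definition dart_src :: "('r, 'd) pre_digraph \<Rightarrow> 'd \<times> bool \<Rightarrow> 'r" where
  "dart_src H p = (if snd p then tail H (fst p) else head H (fst p))"

definition dart_tgt :: "('r, 'd) pre_digraph \<Rightarrow> 'd \<times> bool \<Rightarrow> 'r" where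
  "dart_tgt H p = (if snd p then head H (fst p) else tail H (fst p))"

definition dart_rev :: "'d \<times> bool \<Rightarrow> 'd \<times> bool" where
  "dart_rev p = (fst p, \<not> snd p)"

lemma dart_rev_rev [simp]: "dart_rev (dart_rev p) = p"
  by (simp add: dart_rev_def)

lemma dart_rev_eq_iff [simp]: "dart_rev p = dart_rev q \<longleftrightarrow> p = q"
  by (metis dart_rev_rev)

lemma connected_vertex_set:
  fixes H :: "('r::finite, 'd::finite) pre_digraph"
  assumes V: "verts H = UNIV" and "arcs H = UNIV" and conn: "Digraph_Component.connected H"
    and W: "W \<noteq> {}" "\<And>p. dart_src H p \<in> W \<Longrightarrow> dart_tgt H p \<in> W"
  shows "W = UNIV"
proof -
  obtain u where u: "u \<in> W" using W(1) by blast
  have "v \<in> W" for v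
  proof -
    have "u \<rightarrow>\<^sup>*\<^bsub>with_proj (mk_symmetric H)\<^esub> v"
      using conn V unfolding Digraph_Component.connected_def strongly_connected_def by simp
    then have "(u, v) \<in> rtrancl_on (verts (with_proj (mk_symmetric H))) (arcs_ends (with_proj (mk_symmetric H)))"
      unfolding reachable_def .
    then show ?thesis
    proof (induction rule: rtrancl_on_induct)
      case base
      show ?case by (rule u)
    next
      case (step v w)
      then have "(v, w) \<in> parcs (mk_symmetric H)" by simp
      then obtain e where "(v, w) = (tail H e, head H e) \<or> (v, w) = (head H e, tail H e)"
        by (auto simp: parcs_mk_symmetric)
      then show ?case using W(2)[of "(e, True)"] W(2)[of "(e, False)"] step by (auto simp: dart_src_def dart_tgt_def)
    qed
  qed
  then show ?thesis by blast
qed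

text \<open>A loop leaves its vertex by both of its darts, which matches its contribution 2 to the
  degree.\<close>

lemma dart_degree:
  fixes H :: "('r::finite, 'd::finite) pre_digraph"
  assumes A: "arcs H = UNIV"
  shows "card {p. dart_src H p = x} = vertex_degree H x"
proof -
  have "{p. dart_src H p = x} = (\<lambda>e. (e, True)) ` out_arcs H x \<union> (\<lambda>e. (e, False)) ` in_arcs H x"
    by (auto simp: dart_src_def out_arcs_def in_arcs_def A image_iff split: if_splits)
  moreover have "card \<dots> = card (out_arcs H x) + card (in_arcs H x)"
    by (subst card_Un_disjoint) (auto simp: card_image inj_on_def)
  ultimately show ?thesis by (simp add: vertex_degree_def in_degree_def out_degree_def)
qed

lemma dart_graph_of_digraph:
  fixes H :: "('r::finite, 'd::finite) pre_digraph"
  assumes "verts H = UNIV" "arcs H = UNIV" "Digraph_Component.connected H" "\<And>x. 2 \<le> vertex_degree H x"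
  shows "dart_graph (dart_src H) (dart_tgt H) dart_rev"
proof
  show "W = UNIV" if "W \<noteq> {}" "\<And>p. dart_src H p \<in> W \<Longrightarrow> dart_tgt H p \<in> W" for W
  proof (rule connected_vertex_set[OF assms(1-3) that(1)])
    show "dart_tgt H p \<in> W" if "dart_src H p \<in> W" for p using that by (rule \<open>\<And>p. dart_src H p \<in> W \<Longrightarrow> dart_tgt H p \<in> W\<close>)
  qed
  show "2 \<le> card {p. dart_src H p = x}" for x using assms(4) by (simp add: dart_degree[OF assms(2)])
qed (auto simp: dart_rev_def dart_src_def dart_tgt_def prod_eq_iff)

text \<open>Forgetting directions keeps the edges distinct because no dart of the orbit is the
  reverse of another.\<close>

lemma orbit_cycle_is_cycle:
  fixes H :: "('r::finite, 'd::finite) pre_digraph"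
  assumes "verts H = UNIV" "arcs H = UNIV" "is_orbit_cycle (dart_src H) (dart_tgt H) dart_rev"
  shows "is_cycle H"
proof -
  obtain n w ed where n: "0 < n" and w: "bij_betw w {..<n} UNIV"
    and st: "\<And>k. k < n \<Longrightarrow> dart_src H (ed k) = w k \<and> dart_tgt H (ed k) = w (Suc k mod n)"
    and ne: "\<And>j k. j < n \<Longrightarrow> k < n \<Longrightarrow> ed j \<noteq> dart_rev (ed k)"
    and ex: "\<And>p. \<exists>k<n. p = ed k \<or> p = dart_rev (ed k)"
    using assms(3) unfolding is_orbit_cycle_def by blast
  define e where "e k = fst (ed k)" for k
  have "inj_on e {..<n}"
  proof (rule inj_onI)
    fix j k assume jk: "j \<in> {..<n}" "k \<in> {..<n}" and eq: "e j = e k"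
    then have "ed j = ed k \<or> ed j = dart_rev (ed k)"
      by (auto simp: e_def dart_rev_def prod_eq_iff)
    then have "ed j = ed k" using ne jk by auto
    then have "w j = w k" using st[of j] st[of k] jk by simp
    then show "j = k" using w jk by (auto simp: bij_betw_def inj_on_def)
  qed
  moreover have "e ` {..<n} = UNIV"
  proof -
    have "i \<in> e ` {..<n}" for i
    proof -
      obtain k where "k < n" "(i, True) = ed k \<or> (i, True) = dart_rev (ed k)" using ex by blast
      then have "e k = i" by (auto simp: e_def dart_rev_def prod_eq_iff)
      then show ?thesis using \<open>k < n\<close> by blast
    qed
    then show ?thesis by blast
  qed
  ultimately have "bij_betw e {..<n} (arcs H)" by (simp add: bij_betw_def assms(2))
  moreover have "{tail H (e k), head H (e k)} = {w k, w (Suc k mod n)}" if "k < n" for k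
    using st[OF that] by (cases "snd (ed k)") (auto simp: dart_src_def dart_tgt_def e_def)
  ultimately show ?thesis unfolding is_cycle_def using n w assms(1) by (intro exI[of _ n] conjI exI[of _ w] exI[of _ e]) auto
qed

section \<open>Reduced words\<close>

definition of_word :: "('d \<times> bool) list \<Rightarrow> 'd free_group" where
  "of_word w = abs_free_group w"

definition letter :: "'d \<times> bool \<Rightarrow> 'd free_group" where
  "letter p = of_word [p]"

fun reduced :: "('d \<times> bool) list \<Rightarrow> bool" where
  "reduced [] = True"
| "reduced [p] = True"
| "reduced (p # q # w) = (p \<noteq> dart_rev q \<and> reduced (q # w))"

text \<open>Left multiplication by a letter, carried out on reduced words.\<close>

definition push :: "'d \<times> bool \<Rightarrow> ('d \<times> bool) list \<Rightarrow> ('d \<times> bool) list" where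
  "push p w = (case w of [] \<Rightarrow> [p] | q # v \<Rightarrow> if p = dart_rev q then v else p # w)"

definition reduce :: "('d \<times> bool) list \<Rightarrow> ('d \<times> bool) list" where
  "reduce w = foldr push w []"

lemma reduced_tl: "reduced (p # w) \<Longrightarrow> reduced w"
  by (cases w) auto

lemma reduced_push: "reduced w \<Longrightarrow> reduced (push p w)"
  by (cases w) (auto simp: push_def reduced_tl)

lemma reduced_reduce: "reduced (reduce w)"
  unfolding reduce_def by (induction w) (auto intro: reduced_push)

text \<open>Van der Waerden's trick: letters act on reduced words by mutually inverse maps, so
  cancelling a pair does not change the action, and equivalent words have the same reduced
  form.\<close>

lemma push_push_rev: "reduced w \<Longrightarrow> push p (push (dart_rev p) w) = w"
proof (cases w)
  case (Cons q v)
  assume r: "reduced w"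
  show ?thesis
  proof (cases "dart_rev p = dart_rev q")
    case True
    then have pq: "p = q" using dart_rev_rev by metis
    show ?thesis
    proof (cases v)
      case Nil
      then show ?thesis using Cons pq by (simp add: push_def)
    next
      case (Cons q' v')
      then show ?thesis using r \<open>w = q # v\<close> pq by (simp add: push_def)
    qed
  next
    case False
    then show ?thesis using Cons by (simp add: push_def)
  qed
qed (simp add: push_def)

lemma reduce_Cons: "reduce (p # w) = push p (reduce w)"
  by (simp add: reduce_def)

lemma reduce_reduced: "reduced w \<Longrightarrow> reduce w = w"
proof (induction w)
  case (Cons p w)
  then show ?case using reduced_tl[OF Cons.prems] by (cases w) (auto simp: reduce_Cons push_def)
qed (simp add: reduce_def)

lemma reduce_cancel_step: "cancel_step xs ys \<Longrightarrow> reduce xs = reduce ys"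
proof (induction rule: cancel_step.induct)
  case (1 xs i b ys)
  have "push (i, b) (push (i, \<not> b) (reduce ys)) = reduce ys"
    using push_push_rev[OF reduced_reduce, of "(i, b)" ys] by (simp add: dart_rev_def)
  then show ?case by (simp add: reduce_def)
qed

lemma reduce_word_eq: "word_eq xs ys \<Longrightarrow> reduce xs = reduce ys"
proof (induction rule: equivclp_induct)
  case (step y z)
  then show ?case using reduce_cancel_step[of y z] reduce_cancel_step[of z y] by auto
qed simp

lemma of_word_eq_iff: "of_word xs = of_word ys \<longleftrightarrow> word_eq xs ys"
  unfolding of_word_def by (rule free_group.abs_eq_iff)

lemma of_word_surj: "\<exists>xs. g = of_word xs"
  unfolding of_word_def by (metis Quotient_abs_rep[OF Quotient_free_group])

lemma of_word_append: "of_word (xs @ ys) = of_word xs * of_word ys"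
  unfolding of_word_def by (simp add: times_free_group.abs_eq)

lemma of_word_Nil: "of_word [] = 1"
  unfolding of_word_def by (simp add: one_free_group_def)

lemma of_word_Cons: "of_word (p # w) = letter p * of_word w"
  using of_word_append[of "[p]" w] by (simp add: letter_def)

lemma letter_rev_mult: "letter (dart_rev p) * letter p = 1"
proof -
  have "cancel_step ([] @ (fst p, \<not> snd p) # (fst p, \<not> \<not> snd p) # []) ([] @ [])" by (rule cancel_step.intros)
  then have "word_eq [dart_rev p, p] []" by (simp add: dart_rev_def r_into_equivclp)
  then have "of_word [dart_rev p, p] = of_word []" by (simp add: of_word_eq_iff)
  then show ?thesis by (simp add: of_word_Cons of_word_Nil)
qed

lemma letter_rev_cancel: "letter (dart_rev p) * (letter p * g) = g"
  using letter_rev_mult[of p] by (simp flip: mult.assoc)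

lemma letter_cancel: "letter p * (letter (dart_rev p) * g) = g"
  using letter_rev_cancel[of "dart_rev p"] by simp

lemma inverse_letter: "inverse (letter p) = letter (dart_rev p)"
  by (metis free_group_left_inverse letter_rev_mult letter_cancel mult.assoc mult_1_left mult_1_right)

lemma letter_True: "letter (i, True) = free_gen i"
  unfolding letter_def of_word_def by (simp add: free_gen_def)

lemma letter_False: "letter (i, False) = inverse (free_gen i)"
  using inverse_letter[of "(i, True)"] by (simp add: letter_True dart_rev_def)

text \<open>The representative picked by \<open>SOME\<close> is irrelevant, as equivalent words
  reduce to the same word.\<close>

definition normal_form :: "'d free_group \<Rightarrow> ('d \<times> bool) list" where
  "normal_form g = reduce (SOME xs. of_word xs = g)"

lemma normal_form_of_word: "normal_form (of_word xs) = reduce xs"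
proof -
  have "of_word (SOME ys. of_word ys = of_word xs) = of_word xs" by (rule someI[of _ xs]) simp
  then show ?thesis unfolding normal_form_def of_word_eq_iff by (rule reduce_word_eq)
qed

lemma reduced_normal_form: "reduced (normal_form g)"
  unfolding normal_form_def by (rule reduced_reduce)

lemma normal_form_letter_mult: "normal_form (letter p * g) = push p (normal_form g)"
proof -
  obtain xs where g: "g = of_word xs" using of_word_surj by blast
  show ?thesis unfolding g of_word_Cons[symmetric] normal_form_of_word reduce_Cons ..
qed

lemma of_word_push: "of_word (push p w) = letter p * of_word w"
proof (cases w)
  case (Cons q v)
  then show ?thesis by (auto simp: push_def of_word_Cons letter_rev_cancel)
qed (simp add: push_def of_word_Cons)

lemma of_word_reduce: "of_word (reduce w) = of_word w"
  by (induction w) (auto simp: reduce_Cons of_word_push of_word_Cons, simp add: reduce_def)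

lemma of_word_normal_form: "of_word (normal_form g) = g"
proof -
  obtain xs where g: "g = of_word xs" using of_word_surj by blast
  show ?thesis unfolding g normal_form_of_word by (rule of_word_reduce)
qed

lemma normal_form_reduced: "reduced w \<Longrightarrow> normal_form (of_word w) = w"
  by (simp add: normal_form_of_word reduce_reduced)

lemma normal_form_1: "normal_form 1 = []"
  using normal_form_reduced[of "[]"] by (simp add: of_word_Nil)

lemma bij_normal_form: "bij_betw normal_form UNIV {w. reduced w}"
  by (rule bij_betw_byWitness[where f' = of_word])
    (auto simp: of_word_normal_form normal_form_reduced reduced_normal_form)

lemma word_length_le:
  assumes "ws \<in> words_over S" "prod_list ws = g"
  shows "word_length S g \<le> length ws"
  unfolding word_length_def using assms by (intro Least_le) blast

text \<open>Each free letter is a word over S, and K bounds the lengths of these finitely many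
  words. Only this direction matters, since decay in the reduced length has to beat a power of the
  length for S.\<close>

lemma word_length_linear_bound:
  fixes S :: "'d::finite free_group set"
  assumes "generates S"
  shows "\<exists>K. \<forall>g. word_length S g \<le> K * length (normal_form g)"
proof -
  have "\<forall>p. \<exists>ws. ws \<in> words_over S \<and> prod_list ws = letter p"
    using assms unfolding generates_def by (metis UNIV_I imageE)
  from choice[OF this] obtain f where f: "\<forall>p. f p \<in> words_over S \<and> prod_list (f p) = letter p" by (rule exE)
  define K where "K = (\<Sum>p\<in>UNIV. length (f p))"
  have K: "length (f p) \<le> K" for p unfolding K_def by (intro member_le_sum) auto
  have "\<exists>ws. ws \<in> words_over S \<and> prod_list ws = of_word w \<and> length ws \<le> K * length w" for w
  proof (induction w)
    case Nil
    show ?case by (intro exI[of _ "[]"]) (simp add: words_over_def of_word_Nil)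
  next
    case (Cons p w)
    then obtain ws where ws: "ws \<in> words_over S" "prod_list ws = of_word w" "length ws \<le> K * length w" by blast
    show ?case
    proof (intro exI conjI)
      show "f p @ ws \<in> words_over S" using f[THEN spec, of p] ws(1) by (simp add: words_over_def)
      show "prod_list (f p @ ws) = of_word (p # w)" using f[THEN spec, of p] ws(2) by (simp add: of_word_Cons)
      show "length (f p @ ws) \<le> K * length (p # w)" using K[of p] ws(3) by simp
    qed
  qed
  then have "word_length S g \<le> K * length (normal_form g)" for g
    using word_length_le by (metis of_word_normal_form order_trans)
  then show ?thesis by blast
qed

section \<open>Square-summable functions\<close>

lemma ell2_eqI: "(\<And>x. ell2_apply f x = ell2_apply g x) \<Longrightarrow> f = g"
  by (metis ell2_apply_inject ext)

lemma ell2_apply_simps [simp]: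
  "ell2_apply 0 x = 0" "ell2_apply (f + g) x = ell2_apply f x + ell2_apply g x"
  "ell2_apply (f - g) x = ell2_apply f x - ell2_apply g x" "ell2_apply (- f) x = - ell2_apply f x"
  "ell2_apply (c *\<^sub>C f) x = c * ell2_apply f x" "ell2_apply (r *\<^sub>R f) x = complex_of_real r * ell2_apply f x"
  "ell2_apply (ell2_delta y) x = (if x = y then 1 else 0)"
  by (simp_all add: zero_ell2.rep_eq plus_ell2.rep_eq minus_ell2.rep_eq uminus_ell2.rep_eq
      scaleC_ell2.rep_eq scaleR_ell2_def ell2_delta.rep_eq)

lemma ell2_apply_sum: "ell2_apply (sum F A) x = (\<Sum>i\<in>A. ell2_apply (F i) x)"
  by (induction A rule: infinite_finite_induct) simp_all

lemma norm_ell2_sq: "(norm f)\<^sup>2 = (\<Sum>\<^sub>\<infinity>x. (cmod (ell2_apply f x))\<^sup>2)"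
  unfolding norm_ell2_def ell2_norm_def by (simp add: infsum_nonneg)

lemma sum_le_norm_ell2_sq:
  assumes "finite A" shows "(\<Sum>x\<in>A. (cmod (ell2_apply f x))\<^sup>2) \<le> (norm f)\<^sup>2"
  unfolding norm_ell2_sq by (rule finite_sum_le_infsum[OF ell2_square_summable assms]) auto

lemma cmod_ell2_apply_le: "cmod (ell2_apply f x) \<le> norm f"
proof -
  have "(cmod (ell2_apply f x))\<^sup>2 \<le> (norm f)\<^sup>2" using sum_le_norm_ell2_sq[of "{x}" f] by simp
  then show ?thesis by (rule power2_le_imp_le) simp
qed

lemma norm_ell2_le:
  assumes "\<And>A. finite A \<Longrightarrow> (\<Sum>x\<in>A. (cmod (ell2_apply f x))\<^sup>2) \<le> C\<^sup>2" "0 \<le> C"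
  shows "norm f \<le> C"
proof -
  have "(norm f)\<^sup>2 \<le> C\<^sup>2"
    unfolding norm_ell2_sq by (rule infsum_le_finite_sums[OF ell2_square_summable assms(1)])
  then show ?thesis using assms(2) by (rule power2_le_imp_le)
qed

lemma ell2_of_bounded_sums:
  assumes "\<And>A. finite A \<Longrightarrow> (\<Sum>x\<in>A. (cmod (f x))\<^sup>2) \<le> B"
  shows "\<exists>g. ell2_apply g = f"
proof -
  have "(\<lambda>x. (cmod (f x))\<^sup>2) summable_on UNIV"
    by (rule nonneg_bounded_partial_sums_imp_summable_on) (use assms in \<open>auto simp: eventually_finite_subsets_at_top intro: exI[of _ "{}"]\<close>)
  then show ?thesis by (intro exI[of _ "Abs_ell2 f"]) (simp add: Abs_ell2_inverse)
qed

lemma norm_scaleC: "norm (c *\<^sub>C f) = cmod c * norm f"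
proof -
  have "(norm (c *\<^sub>C f))\<^sup>2 = (\<Sum>\<^sub>\<infinity>x. (cmod c)\<^sup>2 * (cmod (ell2_apply f x))\<^sup>2)"
    unfolding norm_ell2_sq by (simp add: norm_mult power_mult_distrib)
  also have "\<dots> = (cmod c * norm f)\<^sup>2"
    by (simp add: infsum_cmult_right' norm_ell2_sq power_mult_distrib)
  finally show ?thesis by (rule power2_eq_imp_eq) simp_all
qed

lemma scaleC_simps [simp]:
  "c *\<^sub>C (0 :: 'x ell2) = 0" "0 *\<^sub>C f = 0" "1 *\<^sub>C f = f"
  "c *\<^sub>C (d *\<^sub>C f) = (c * d) *\<^sub>C f"
  by (rule ell2_eqI, simp)+

lemma scaleC_distribs:
  "c *\<^sub>C (f + g) = c *\<^sub>C f + c *\<^sub>C g" "c *\<^sub>C (f - g) = c *\<^sub>C f - c *\<^sub>C g"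
  "(c + d) *\<^sub>C f = c *\<^sub>C f + d *\<^sub>C f" "(c - d) *\<^sub>C f = c *\<^sub>C f - d *\<^sub>C f"
  by (rule ell2_eqI, simp add: algebra_simps)+

lemma norm_ell2_delta: "norm (ell2_delta x) = 1"
proof -
  have "(norm (ell2_delta x))\<^sup>2 = (\<Sum>\<^sub>\<infinity>y. if y = x then 1 else 0)"
    unfolding norm_ell2_sq by (intro infsum_cong) simp
  also have "\<dots> = (\<Sum>\<^sub>\<infinity>y\<in>{x}. 1 :: real)" by (rule infsum_cong_neutral) auto
  finally have "(norm (ell2_delta x))\<^sup>2 = 1\<^sup>2" by simp
  then show ?thesis by (rule power2_eq_imp_eq) simp_all
qed

lemma cinner_summable: "(\<lambda>x. cnj (ell2_apply f x) * ell2_apply g x) summable_on UNIV"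
proof (rule abs_summable_summable, rule summable_on_comparison_test)
  show "(\<lambda>x. (cmod (ell2_apply f x))\<^sup>2 + (cmod (ell2_apply g x))\<^sup>2) summable_on UNIV"
    by (intro summable_on_add ell2_square_summable)
  fix x
  have "0 \<le> cmod (ell2_apply f x) * cmod (ell2_apply g x)" by simp
  then show "norm (cnj (ell2_apply f x) * ell2_apply g x) \<le> (cmod (ell2_apply f x))\<^sup>2 + (cmod (ell2_apply g x))\<^sup>2"
    using sum_squares_bound[of "cmod (ell2_apply f x)" "cmod (ell2_apply g x)"]
    unfolding norm_mult complex_mod_cnj by linarith
qed simp

lemma cinner_add_right: "cinner f (g + h) = cinner f g + cinner f h"
  unfolding cinner_def by (simp add: distrib_left infsum_add cinner_summable)

lemma cinner_scaleC_right: "cinner f (c *\<^sub>C g) = c * cinner f g"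
proof -
  have "cinner f (c *\<^sub>C g) = (\<Sum>\<^sub>\<infinity>x. c * (cnj (ell2_apply f x) * ell2_apply g x))"
    unfolding cinner_def by (simp add: mult_ac)
  then show ?thesis unfolding cinner_def by (simp only: infsum_cmult_right')
qed

lemma cinner_cnj: "cnj (cinner f g) = cinner g f"
  unfolding cinner_def infsum_cnj[symmetric] by (simp add: mult.commute)

lemma cinner_add_left: "cinner (f + g) h = cinner f h + cinner g h"
  using arg_cong[OF cinner_add_right[of h f g], of cnj] by (simp add: cinner_cnj)

lemma cinner_scaleC_left: "cinner (c *\<^sub>C f) g = cnj c * cinner f g"
  using arg_cong[OF cinner_scaleC_right[of g c f], of cnj] by (simp add: cinner_cnj)

lemma cinner_minus_right: "cinner f (- g) = - cinner f g"
  using cinner_scaleC_right[of f "- 1" g] by (metis ell2_apply_simps(4,5) ell2_eqI mult_minus1)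

lemma cinner_diff_right: "cinner f (g - h) = cinner f g - cinner f h"
  using cinner_add_right[of f g "- h"] by (simp add: cinner_minus_right)

lemma cinner_diff_left: "cinner (f - g) h = cinner f h - cinner g h"
  using arg_cong[OF cinner_diff_right[of h f g], of cnj] by (simp add: cinner_cnj)

lemma cinner_0: "cinner 0 f = 0" "cinner f 0 = 0"
  by (simp_all add: cinner_def)

lemma cinner_sum_right: "cinner f (sum F A) = (\<Sum>i\<in>A. cinner f (F i))"
  by (induction A rule: infinite_finite_induct) (simp_all add: cinner_0 cinner_add_right)

lemma cinner_sum_left: "cinner (sum F A) f = (\<Sum>i\<in>A. cinner (F i) f)"
  by (induction A rule: infinite_finite_induct) (simp_all add: cinner_0 cinner_add_left)

lemma Re_cinner: "Re (cinner f g) = f \<bullet> g"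
  unfolding cinner_def inner_ell2_def using infsum_Re[OF cinner_summable[of f g]]
  by (simp add: inner_complex_def)

lemma cinner_self: "cinner f f = complex_of_real ((norm f)\<^sup>2)"
proof -
  have "Im (cinner f f) = 0" using arg_cong[OF cinner_cnj[of f f], of Im] by simp
  moreover have "Re (cinner f f) = (norm f)\<^sup>2" by (simp only: Re_cinner power2_norm_eq_inner)
  ultimately show ?thesis by (simp only: complex_eq_iff Re_complex_of_real Im_complex_of_real)
qed

lemma cinner_Cauchy_Schwarz: "cmod (cinner f g) \<le> norm f * norm g"
proof (cases "cinner f g = 0")
  case False
  \<comment> \<open>A phase that makes the inner product real and nonnegative, so that the real
    Cauchy-Schwarz inequality applies.\<close>
  define c where "c = cnj (cinner f g) / complex_of_real (cmod (cinner f g))"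
  have c: "cmod c = 1" using False by (simp add: c_def norm_divide)
  have "cinner f (c *\<^sub>C g) = complex_of_real (cmod (cinner f g))"
    using False unfolding cinner_scaleC_right c_def
    by (simp add: mult.commute[of "cnj _"] flip: complex_norm_square) (simp add: power2_eq_square)
  then have "cmod (cinner f g) = f \<bullet> (c *\<^sub>C g)" by (simp flip: Re_cinner)
  also have "\<dots> \<le> norm f * norm (c *\<^sub>C g)" by (rule norm_cauchy_schwarz)
  finally show ?thesis by (simp add: norm_scaleC c)
qed simp

lemma cinner_delta_left: "cinner (ell2_delta x) f = ell2_apply f x"
proof -
  have "cinner (ell2_delta x) f = (\<Sum>\<^sub>\<infinity>y\<in>{x}. ell2_apply f y)"
    unfolding cinner_def by (rule infsum_cong_neutral) auto
  then show ?thesis by simp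
qed

lemma cinner_delta_right: "cinner f (ell2_delta x) = cnj (ell2_apply f x)"
  using cinner_delta_left[of x f] by (metis cinner_cnj)

text \<open>Fatou's lemma for counting measure: norm bounds pass to pointwise limits through finite
  sums.\<close>

lemma pointwise_limit_in_ell2:
  assumes lim: "\<And>x. (\<lambda>n. ell2_apply (g n) x) \<longlonglongrightarrow> f x" and bd: "\<forall>\<^sub>F n in sequentially. norm (g n) \<le> C"
  shows "\<exists>h. ell2_apply h = f \<and> norm h \<le> C"
proof -
  obtain n0 where "norm (g n0) \<le> C" using eventually_happens'[OF _ bd] by auto
  then have C: "0 \<le> C" using norm_ge_zero order_trans by blast
  have fin: "(\<Sum>x\<in>A. (cmod (f x))\<^sup>2) \<le> C\<^sup>2" if "finite A" for A
  proof (rule tendsto_upperbound)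
    show "(\<lambda>n. \<Sum>x\<in>A. (cmod (ell2_apply (g n) x))\<^sup>2) \<longlonglongrightarrow> (\<Sum>x\<in>A. (cmod (f x))\<^sup>2)"
      by (intro tendsto_intros lim)
    show "\<forall>\<^sub>F n in sequentially. (\<Sum>x\<in>A. (cmod (ell2_apply (g n) x))\<^sup>2) \<le> C\<^sup>2"
      using bd
    proof eventually_elim
      case (elim n)
      have "(\<Sum>x\<in>A. (cmod (ell2_apply (g n) x))\<^sup>2) \<le> (norm (g n))\<^sup>2" by (rule sum_le_norm_ell2_sq[OF that])
      also have "\<dots> \<le> C\<^sup>2" using elim by (intro power_mono) auto
      finally show ?case .
    qed
  qed simp
  then obtain h where h: "ell2_apply h = f" using ell2_of_bounded_sums by blast
  then have "norm h \<le> C" using fin C by (intro norm_ell2_le) simp_all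
  then show ?thesis using h by blast
qed

text \<open>The pointwise limit F is recovered as an element by subtracting from one late term its
  difference with F, which is square-summable by the preceding lemma.\<close>

lemma ell2_Cauchy_convergent:
  fixes g :: "nat \<Rightarrow> 'x ell2"
  assumes cau: "\<And>e. 0 < e \<Longrightarrow> \<exists>N. \<forall>m\<ge>N. \<forall>n\<ge>N. norm (g m - g n) \<le> e"
  shows "\<exists>f. \<forall>e>0. \<exists>N. \<forall>n\<ge>N. norm (g n - f) \<le> e"
proof -
  have "\<exists>l. (\<lambda>n. ell2_apply (g n) x) \<longlonglongrightarrow> l" for x
  proof -
    have "Cauchy (\<lambda>n. ell2_apply (g n) x)"
    proof (rule metric_CauchyI)
      fix e :: real assume "0 < e"
      then obtain N where N: "\<forall>m\<ge>N. \<forall>n\<ge>N. norm (g m - g n) \<le> e / 2" using cau[of "e / 2"] by auto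
      have "dist (ell2_apply (g m) x) (ell2_apply (g n) x) < e" if "m \<ge> N" "n \<ge> N" for m n
      proof -
        have "dist (ell2_apply (g m) x) (ell2_apply (g n) x) \<le> norm (g m - g n)"
          using cmod_ell2_apply_le[of "g m - g n" x] by (simp add: dist_norm)
        also have "\<dots> \<le> e / 2" using N that by blast
        finally show ?thesis using \<open>0 < e\<close> by simp
      qed
      then show "\<exists>N. \<forall>m\<ge>N. \<forall>n\<ge>N. dist (ell2_apply (g m) x) (ell2_apply (g n) x) < e" by blast
    qed
    then show ?thesis by (simp add: Cauchy_convergent_iff convergent_def)
  qed
  then have "\<forall>x. \<exists>l. (\<lambda>n. ell2_apply (g n) x) \<longlonglongrightarrow> l" by blast
  from choice[OF this] obtain F where F: "\<forall>x. (\<lambda>n. ell2_apply (g n) x) \<longlonglongrightarrow> F x" by (rule exE)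
  have key: "\<exists>h. ell2_apply h = (\<lambda>x. ell2_apply (g n) x - F x) \<and> norm h \<le> e"
    if "\<forall>m\<ge>N. \<forall>n\<ge>N. norm (g m - g n) \<le> e" "n \<ge> N" for n N e
  proof (rule pointwise_limit_in_ell2)
    show "(\<lambda>m. ell2_apply (g n - g m) x) \<longlonglongrightarrow> ell2_apply (g n) x - F x" for x
      using F by (simp add: tendsto_diff)
    show "\<forall>\<^sub>F m in sequentially. norm (g n - g m) \<le> e"
      using that unfolding eventually_sequentially by blast
  qed
  obtain N1 where "\<forall>m\<ge>N1. \<forall>n\<ge>N1. norm (g m - g n) \<le> 1" using cau[of 1] by auto
  from key[OF this order_refl] obtain h1 where h1: "ell2_apply h1 = (\<lambda>x. ell2_apply (g N1) x - F x)" by blast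
  define f where "f = g N1 - h1"
  have f: "ell2_apply f x = F x" for x unfolding f_def using h1 by simp
  have "\<exists>N. \<forall>n\<ge>N. norm (g n - f) \<le> e" if e: "0 < e" for e
  proof -
    obtain N where N: "\<forall>m\<ge>N. \<forall>n\<ge>N. norm (g m - g n) \<le> e" using cau[OF e] by blast
    have "norm (g n - f) \<le> e" if n: "n \<ge> N" for n
    proof -
      obtain h where h: "ell2_apply h = (\<lambda>x. ell2_apply (g n) x - F x)" "norm h \<le> e" using key[OF N n] by blast
      have "g n - f = h" by (rule ell2_eqI) (simp add: h(1) f)
      then show ?thesis using h(2) by simp
    qed
    then show ?thesis by blast
  qed
  then show ?thesis by blast
qed

definition truncate :: "'x set \<Rightarrow> 'x ell2 \<Rightarrow> 'x ell2" where
  "truncate A f = (\<Sum>x\<in>A. ell2_apply f x *\<^sub>C ell2_delta x)"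

lemma truncate_apply: "finite A \<Longrightarrow> ell2_apply (truncate A f) x = (if x \<in> A then ell2_apply f x else 0)"
  by (simp add: truncate_def ell2_apply_sum sum.delta' if_distrib cong: if_cong)

lemma truncate_approx:
  assumes "0 < e" shows "\<exists>A. finite A \<and> norm (f - truncate A f) \<le> e"
proof -
  let ?q = "\<lambda>x. (cmod (ell2_apply f x))\<^sup>2"
  obtain A where A: "finite A" "dist (sum ?q A) (infsum ?q UNIV) \<le> e\<^sup>2"
    using infsum_finite_approximation[OF ell2_square_summable[of f], of "e\<^sup>2"] assms by auto
  have "norm (f - truncate A f) \<le> e"
  proof (rule norm_ell2_le)
    fix B :: "'a set" assume B: "finite B"
    have "(\<Sum>x\<in>B. (cmod (ell2_apply (f - truncate A f) x))\<^sup>2) = (\<Sum>x\<in>B - A. ?q x)"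
      using A(1) B by (intro sum.mono_neutral_cong_right) (auto simp: truncate_apply)
    also have "\<dots> = sum ?q (A \<union> (B - A)) - sum ?q A"
      using A(1) B by (subst sum.union_disjoint) auto
    also have "sum ?q (A \<union> (B - A)) \<le> infsum ?q UNIV"
      using A(1) B by (intro finite_sum_le_infsum ell2_square_summable) auto
    finally show "(\<Sum>x\<in>B. (cmod (ell2_apply (f - truncate A f) x))\<^sup>2) \<le> e\<^sup>2"
      using A(2) by (simp add: dist_real_def abs_le_iff)
  qed (use assms in simp)
  then show ?thesis using A(1) by blast
qed

section \<open>Self-adjoint operators with finite rows\<close>

text \<open>Finite rows make T linear and compatible with pointwise limits. Solvability for basis
  vectors off the real axis is what the explicit Green columns supply; together with symmetry and
  completeness it gives the full resolvent.\<close>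

locale finite_row_operator =
  fixes T :: "'x ell2 \<Rightarrow> 'x ell2" and nb :: "'x \<Rightarrow> 'i set" and pt :: "'x \<Rightarrow> 'i \<Rightarrow> 'x"
    and co :: "'x \<Rightarrow> 'i \<Rightarrow> complex" and K :: real
  assumes row: "ell2_apply (T f) x = (\<Sum>i\<in>nb x. co x i * ell2_apply f (pt x i))"
    and sym: "cinner (T f) g = cinner f (T g)"
    and bdd: "norm (T f) \<le> K * norm f"
    and solvable: "Im z \<noteq> 0 \<Longrightarrow> \<exists>f. op_shift T z f = ell2_delta x"
begin

lemma T_add: "T (f + g) = T f + T g"
  by (rule ell2_eqI) (simp add: row sum.distrib distrib_left)

lemma T_diff: "T (f - g) = T f - T g"
  by (rule ell2_eqI) (simp add: row sum_subtractf right_diff_distrib)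

lemma T_scaleC: "T (c *\<^sub>C f) = c *\<^sub>C T f"
  by (rule ell2_eqI) (simp add: row sum_distrib_left mult_ac)

lemma shift_add: "op_shift T z (f + g) = op_shift T z f + op_shift T z g"
  by (simp add: op_shift_def T_add scaleC_distribs)

lemma shift_diff: "op_shift T z (f - g) = op_shift T z f - op_shift T z g"
  by (simp add: op_shift_def T_diff scaleC_distribs)

lemma shift_scaleC: "op_shift T z (c *\<^sub>C f) = c *\<^sub>C op_shift T z f"
  by (simp add: op_shift_def T_scaleC scaleC_distribs mult.commute)

lemma shift_0: "op_shift T z 0 = 0"
  using shift_scaleC[of z 0 0] by simp

lemma shift_sum: "op_shift T z (sum F A) = (\<Sum>i\<in>A. op_shift T z (F i))"
  by (induction A rule: infinite_finite_induct) (simp_all add: shift_0 shift_add)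

lemma cinner_T_real: "Im (cinner f (T f)) = 0"
proof -
  have "cnj (cinner f (T f)) = cinner f (T f)" by (simp add: cinner_cnj sym)
  then show ?thesis by (simp add: complex_eq_iff)
qed

lemma shift_symmetric: "cinner (op_shift T (cnj z) f) g = cinner f (op_shift T z g)"
  by (simp add: op_shift_def cinner_diff_left cinner_diff_right sym cinner_scaleC_left cinner_scaleC_right)

lemma Im_cinner_shift: "Im (cinner f (op_shift T z f)) = - Im z * (norm f)\<^sup>2"
  by (simp add: op_shift_def cinner_diff_right cinner_T_real cinner_scaleC_right cinner_self)

text \<open>By symmetry the inner product of f with T f is real, so Im z alone determines the
  imaginary part of the inner product of f with (T - z) f; then Cauchy-Schwarz.\<close>

lemma shift_bounded_below: "\<bar>Im z\<bar> * norm f \<le> norm (op_shift T z f)"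
proof (cases "f = 0")
  case False
  have "\<bar>Im z\<bar> * (norm f)\<^sup>2 = \<bar>Im (cinner f (op_shift T z f))\<bar>" by (simp add: Im_cinner_shift abs_mult)
  also have "\<dots> \<le> cmod (cinner f (op_shift T z f))" by (rule abs_Im_le_cmod)
  also have "\<dots> \<le> norm f * norm (op_shift T z f)" by (rule cinner_Cauchy_Schwarz)
  finally have "norm f * (\<bar>Im z\<bar> * norm f) \<le> norm f * norm (op_shift T z f)" by (simp add: power2_eq_square mult_ac)
  then show ?thesis using False by (simp add: mult_le_cancel_left)
qed simp

lemma shift_pointwise_limit:
  assumes "\<And>x. (\<lambda>n. ell2_apply (g n) x) \<longlonglongrightarrow> ell2_apply f x"
  shows "(\<lambda>n. ell2_apply (op_shift T z (g n)) x) \<longlonglongrightarrow> ell2_apply (op_shift T z f) x"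
  unfolding op_shift_def ell2_apply_simps row by (intro tendsto_intros assms)

text \<open>Approximate solutions suffice: \<open>T - z\<close> has closed range when it is bounded below.\<close>

lemma shift_surj_closed:
  assumes below: "\<And>f. \<kappa> * norm f \<le> norm (op_shift T z f)" and \<kappa>: "0 < \<kappa>"
    and approx: "\<And>e. 0 < e \<Longrightarrow> \<exists>f. norm (op_shift T z f - g) \<le> e"
  shows "\<exists>f. op_shift T z f = g"
proof -
  have "\<forall>n. \<exists>f. norm (op_shift T z f - g) \<le> 1 / real (Suc n)" by (intro allI approx) simp
  from choice[OF this] obtain u where u: "\<forall>n. norm (op_shift T z (u n) - g) \<le> 1 / real (Suc n)" by (rule exE)
  have small: "\<exists>N. \<forall>n\<ge>N. norm (op_shift T z (u n) - g) \<le> e" if e: "0 < e" for e :: real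
  proof -
    obtain N where N: "1 / real (Suc N) < e" by (rule nat_approx_posE[OF e])
    have "norm (op_shift T z (u n) - g) \<le> e" if "n \<ge> N" for n
    proof -
      have "norm (op_shift T z (u n) - g) \<le> 1 / real (Suc n)" using u by blast
      also have "\<dots> \<le> 1 / real (Suc N)" using that by (simp add: frac_le)
      finally show ?thesis using N by simp
    qed
    then show ?thesis by blast
  qed
  have "\<exists>N. \<forall>m\<ge>N. \<forall>n\<ge>N. norm (u m - u n) \<le> e" if "0 < e" for e
  proof -
    have "0 < e * \<kappa> / 2" using that \<kappa> by simp
    from small[OF this] obtain N where N: "\<And>n. n \<ge> N \<Longrightarrow> norm (op_shift T z (u n) - g) \<le> e * \<kappa> / 2" by blast
    have "norm (u m - u n) \<le> e" if "m \<ge> N" "n \<ge> N" for m n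
    proof -
      have "\<kappa> * norm (u m - u n) \<le> norm ((op_shift T z (u m) - g) - (op_shift T z (u n) - g))"
        using below[of "u m - u n"] by (simp add: shift_diff)
      also have "\<dots> \<le> e * \<kappa> / 2 + e * \<kappa> / 2"
        by (intro order_trans[OF norm_triangle_ineq4] add_mono N that)
      finally show ?thesis using \<kappa> by (simp add: mult.commute)
    qed
    then show ?thesis by blast
  qed
  from ell2_Cauchy_convergent[OF this] obtain f where f: "\<forall>e>0. \<exists>N. \<forall>n\<ge>N. norm (u n - f) \<le> e" by blast
  have pw: "(\<lambda>n. ell2_apply (h n) x) \<longlonglongrightarrow> ell2_apply h' x"
    if h: "\<forall>e>0. \<exists>N. \<forall>n\<ge>N. norm (h n - h') \<le> e" for h x and h' :: "'x ell2"
  proof (rule metric_LIMSEQ_I)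
    fix e :: real assume "0 < e"
    then obtain N where N: "\<forall>n\<ge>N. norm (h n - h') \<le> e / 2" using h \<open>0 < e\<close> by (meson half_gt_zero)
    have "dist (ell2_apply (h n) x) (ell2_apply h' x) < e" if "n \<ge> N" for n
    proof -
      have "dist (ell2_apply (h n) x) (ell2_apply h' x) \<le> norm (h n - h')"
        using cmod_ell2_apply_le[of "h n - h'" x] by (simp add: dist_norm)
      also have "\<dots> \<le> e / 2" using N that by blast
      finally show ?thesis using \<open>0 < e\<close> by simp
    qed
    then show "\<exists>N. \<forall>n\<ge>N. dist (ell2_apply (h n) x) (ell2_apply h' x) < e" by blast
  qed
  have "op_shift T z f = g"
  proof (rule ell2_eqI)
    fix x
    have "(\<lambda>n. ell2_apply (op_shift T z (u n)) x) \<longlonglongrightarrow> ell2_apply (op_shift T z f) x"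
      by (rule shift_pointwise_limit) (rule pw[OF f])
    moreover have "(\<lambda>n. ell2_apply (op_shift T z (u n)) x) \<longlonglongrightarrow> ell2_apply g x"
      by (rule pw) (use small in blast)
    ultimately show "ell2_apply (op_shift T z f) x = ell2_apply g x" by (rule LIMSEQ_unique)
  qed
  then show ?thesis by blast
qed

text \<open>Finite combinations of the solutions for basis vectors hit all truncations, hence
  approximate every right-hand side.\<close>

lemma shift_surj:
  assumes z: "Im z \<noteq> 0" shows "\<exists>f. op_shift T z f = g"
proof (rule shift_surj_closed[of "\<bar>Im z\<bar>"])
  fix e :: real assume "0 < e"
  then obtain A where A: "finite A" "norm (g - truncate A g) \<le> e" using truncate_approx by blast
  have "\<forall>x. \<exists>f. op_shift T z f = ell2_delta x" using solvable[OF z] by blast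
  from choice[OF this] obtain G where G: "\<forall>x. op_shift T z (G x) = ell2_delta x" by (rule exE)
  have "op_shift T z (\<Sum>x\<in>A. ell2_apply g x *\<^sub>C G x) = truncate A g"
    using G by (simp add: shift_sum shift_scaleC truncate_def)
  then have "norm (op_shift T z (\<Sum>x\<in>A. ell2_apply g x *\<^sub>C G x) - g) \<le> e" using A(2) by (simp add: norm_minus_commute)
  then show "\<exists>f. norm (op_shift T z f - g) \<le> e" by blast
qed (use z shift_bounded_below in auto)

lemma shift_inj:
  assumes below: "\<And>f. \<kappa> * norm f \<le> norm (op_shift T z f)" and \<kappa>: "0 < \<kappa>"
  shows "inj (op_shift T z)"
proof (rule injI)
  fix f g assume "op_shift T z f = op_shift T z g"
  then have "\<kappa> * norm (f - g) \<le> 0" using below[of "f - g"] by (simp add: shift_diff)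
  then have "norm (f - g) \<le> 0" using \<kappa> by (simp add: mult_le_0_iff)
  then show "f = g" by simp
qed

lemma regular_point:
  assumes below: "\<And>f. \<kappa> * norm f \<le> norm (op_shift T z f)" and \<kappa>: "0 < \<kappa>"
    and surj: "\<And>g. \<exists>f. op_shift T z f = g"
  shows "bij (op_shift T z)" "bounded_linear (resolvent T z)" "op_shift T z (resolvent T z g) = g"
    "resolvent T z (op_shift T z f) = f" "norm (resolvent T z g) \<le> norm g / \<kappa>"
proof -
  have inj: "inj (op_shift T z)" by (rule shift_inj[OF below \<kappa>])
  have sj: "surj (op_shift T z)" using surj unfolding surj_def by metis
  show bij: "bij (op_shift T z)" using inj sj by (simp add: bij_def)
  have right: "op_shift T z (resolvent T z g) = g" for g
    unfolding resolvent_def by (rule surj_f_inv_f[OF sj])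
  have left: "resolvent T z (op_shift T z f) = f" for f
    unfolding resolvent_def by (rule inv_f_f[OF inj])
  have bound: "norm (resolvent T z g) \<le> norm g / \<kappa>" for g
    using below[of "resolvent T z g"] \<kappa> unfolding right by (simp add: pos_le_divide_eq mult.commute)
  show "op_shift T z (resolvent T z g) = g" "resolvent T z (op_shift T z f) = f"
    "norm (resolvent T z g) \<le> norm g / \<kappa>" by (fact right left bound)+
  show "bounded_linear (resolvent T z)"
  proof (rule bounded_linear_intro[of _ "1 / \<kappa>"])
    show "resolvent T z (f + g) = resolvent T z f + resolvent T z g" for f g
    proof -
      have "op_shift T z (resolvent T z f + resolvent T z g) = f + g" by (simp add: shift_add right)
      then show ?thesis using left by metis
    qed
    show "resolvent T z (r *\<^sub>R f) = r *\<^sub>R resolvent T z f" for r f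
    proof -
      have "op_shift T z (r *\<^sub>R resolvent T z f) = r *\<^sub>R f" by (simp add: scaleR_ell2_def shift_scaleC right)
      then show ?thesis using left by metis
    qed
    show "norm (resolvent T z f) \<le> norm f * (1 / \<kappa>)" for f using bound[of f] by simp
  qed
qed

context
  fixes z assumes z: "Im z \<noteq> 0"
begin

lemma shift_resolvent: "op_shift T z (resolvent T z g) = g"
  by (rule regular_point(3)[OF shift_bounded_below _ shift_surj[OF z]]) (use z in simp)

lemma resolvent_shift: "resolvent T z (op_shift T z f) = f"
  by (rule regular_point(4)[OF shift_bounded_below _ shift_surj[OF z]]) (use z in simp)

lemma norm_resolvent_le: "norm (resolvent T z g) \<le> norm g / \<bar>Im z\<bar>"
  by (rule regular_point(5)[OF shift_bounded_below _ shift_surj[OF z]]) (use z in simp)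

lemma resolvent_eqI: "op_shift T z f = g \<Longrightarrow> resolvent T z g = f"
  using resolvent_shift by blast

lemma nonreal_not_spectrum: "z \<notin> spectrum T"
  unfolding spectrum_def
  using regular_point(1)[OF shift_bounded_below _ shift_surj[OF z]]
    regular_point(2)[OF shift_bounded_below _ shift_surj[OF z]] z by simp

lemma resolvent_sum_scaleC:
  "resolvent T z (\<Sum>i\<in>A. c i *\<^sub>C F i) = (\<Sum>i\<in>A. c i *\<^sub>C resolvent T z (F i))"
  by (rule resolvent_eqI) (simp add: shift_sum shift_scaleC shift_resolvent)

text \<open>Im z times a squared resolvent norm: this identity converts bounds on diagonal entries
  into bounds on the resolvent near the real axis.\<close>

lemma Im_cinner_resolvent: "Im (cinner f (resolvent T z f)) = Im z * (norm (resolvent T z f))\<^sup>2"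
proof -
  have "cinner f (resolvent T z f) = cnj (cinner (resolvent T z f) (op_shift T z (resolvent T z f)))"
    by (simp add: shift_resolvent cinner_cnj)
  then show ?thesis using Im_cinner_shift[of "resolvent T z f" z] by simp
qed

end

lemma resolvent_adjoint:
  assumes z: "Im z \<noteq> 0"
  shows "cinner (resolvent T (cnj z) f) g = cinner f (resolvent T z g)"
proof -
  have z': "Im (cnj z) \<noteq> 0" using z by simp
  have "cinner (resolvent T (cnj z) f) (op_shift T z (resolvent T z g)) =
      cinner (op_shift T (cnj z) (resolvent T (cnj z) f)) (resolvent T z g)"
    by (simp add: shift_symmetric)
  then show ?thesis by (simp add: shift_resolvent[OF z] shift_resolvent[OF z'])
qed

lemma op_adjoint_resolvent:
  assumes z: "Im z \<noteq> 0"
  shows "op_adjoint (resolvent T z) = resolvent T (cnj z)"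
  unfolding op_adjoint_def
proof (rule the_equality)
  show "\<forall>f g. cinner (resolvent T (cnj z) f) g = cinner f (resolvent T z g)"
    using resolvent_adjoint[OF z] by blast
  fix Q assume Q: "\<forall>f g. cinner (Q f) g = cinner f (resolvent T z g)"
  show "Q = resolvent T (cnj z)"
  proof (rule ext, rule ell2_eqI)
    fix f x
    have "cinner (Q f) (ell2_delta x) = cinner (resolvent T (cnj z) f) (ell2_delta x)"
      using Q resolvent_adjoint[OF z] by simp
    then have "cnj (ell2_apply (Q f) x) = cnj (ell2_apply (resolvent T (cnj z) f) x)" by (simp only: cinner_delta_right)
    then show "ell2_apply (Q f) x = ell2_apply (resolvent T (cnj z) f) x" by (simp only: complex_cnj_cancel_iff)
  qed
qed

end

section \<open>The operator of a weighted graph\<close>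

lemma op_tensor_apply:
  "ell2_apply (op_tensor A T f) (i, x) = (\<Sum>j\<in>UNIV. A $ i $ j * ell2_apply (T (component j f)) x)"
  by (simp add: op_tensor_def of_components.rep_eq ell2_apply_sum)

lemma ell2_pair_eqI: "(\<And>i x. ell2_apply f (i, x) = ell2_apply g (i, x)) \<Longrightarrow> f = g"
  by (rule ell2_eqI) (metis surj_pair)

lemma op_tensor_add: "op_tensor (A + B) T f = op_tensor A T f + op_tensor B T f"
  by (rule ell2_pair_eqI) (simp add: op_tensor_apply distrib_right sum.distrib)

lemma op_tensor_0: "op_tensor 0 T f = 0"
  by (rule ell2_pair_eqI) (simp add: op_tensor_apply)

lemma lambda_matrix_superset:
  assumes "finite B" "Poly_Mapping.keys p \<subseteq> B"
  shows "lambda_matrix p f = (\<Sum>g\<in>B. op_tensor (Poly_Mapping.lookup p g) (left_regular g) f)"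
  unfolding lambda_matrix_def using assms
  by (intro sum.mono_neutral_left) (auto simp: in_keys_iff op_tensor_0)

lemma lambda_matrix_add: "lambda_matrix (p + q) f = lambda_matrix p f + lambda_matrix q f"
proof -
  let ?B = "Poly_Mapping.keys p \<union> Poly_Mapping.keys q"
  have "lambda_matrix (p + q) f = (\<Sum>g\<in>?B. op_tensor (Poly_Mapping.lookup (p + q) g) (left_regular g) f)"
    using keys_add[of p q] by (intro lambda_matrix_superset) auto
  also have "\<dots> = (\<Sum>g\<in>?B. op_tensor (Poly_Mapping.lookup p g) (left_regular g) f) +
      (\<Sum>g\<in>?B. op_tensor (Poly_Mapping.lookup q g) (left_regular g) f)"
    by (simp add: lookup_add op_tensor_add sum.distrib)
  also have "\<dots> = lambda_matrix p f + lambda_matrix q f"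
    by (intro arg_cong2[of _ _ _ _ "(+)"] lambda_matrix_superset[symmetric]) auto
  finally show ?thesis .
qed

lemma lambda_matrix_0: "lambda_matrix 0 f = 0"
  by (simp add: lambda_matrix_def)

lemma lambda_matrix_sum: "lambda_matrix (sum F A) f = (\<Sum>i\<in>A. lambda_matrix (F i) f)"
  by (induction A rule: infinite_finite_induct) (simp_all add: lambda_matrix_0 lambda_matrix_add)

lemma lambda_matrix_single: "lambda_matrix (Poly_Mapping.single g m) f = op_tensor m (left_regular g) f"
  by (subst lambda_matrix_superset[of "{g}"]) (auto simp: lookup_single)

lemma conj_transpose_matrix_unit: "conj_transpose (matrix_unit c v u) = matrix_unit (cnj c) u v"
  by (simp add: conj_transpose_def matrix_unit_def vec_eq_iff)

definition dart_weight :: "('d \<Rightarrow> complex) \<Rightarrow> 'd \<times> bool \<Rightarrow> complex" where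
  "dart_weight a p = (if snd p then a (fst p) else cnj (a (fst p)))"

lemma dart_weight_rev: "dart_weight a (dart_rev p) = cnj (dart_weight a p)"
  by (simp add: dart_weight_def dart_rev_def)

lemma dart_weight_rev_mult: "dart_weight a p * dart_weight a (dart_rev p) = complex_of_real ((cmod (dart_weight a p))\<^sup>2)"
  by (simp only: dart_weight_rev complex_norm_square)

lemma cmod_dart_weight_rev: "cmod (dart_weight a (dart_rev p)) = cmod (dart_weight a p)"
  by (simp add: dart_weight_rev)

text \<open>One summand of \<lambda>(p) per dart: the two darts of an edge carry the term of g_i and
  its adjoint.\<close>

definition dart_op :: "('r::finite, 'd) pre_digraph \<Rightarrow> ('d \<Rightarrow> complex) \<Rightarrow> 'd \<times> bool \<Rightarrow>
    ('r \<times> 'd free_group) ell2 \<Rightarrow> ('r \<times> 'd free_group) ell2" where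
  "dart_op H a p = op_tensor (matrix_unit (dart_weight a p) (dart_tgt H p) (dart_src H p)) (left_regular (letter p))"

lemma dart_op_apply:
  "ell2_apply (dart_op H a p f) (v, h) =
    (if v = dart_tgt H p then dart_weight a p * ell2_apply f (dart_src H p, letter (dart_rev p) * h) else 0)"
proof -
  have "ell2_apply (dart_op H a p f) (v, h) = (\<Sum>j\<in>UNIV. if j = dart_src H p then
      (if v = dart_tgt H p then dart_weight a p * ell2_apply f (dart_src H p, letter (dart_rev p) * h) else 0) else 0)"
    unfolding dart_op_def op_tensor_apply
    by (intro sum.cong) (auto simp: matrix_unit_def left_regular.rep_eq component.rep_eq inverse_letter)
  then show ?thesis by simp
qed

locale weighted_graph =
  fixes H :: "('r::finite, 'd::finite) pre_digraph" and a :: "'d \<Rightarrow> complex"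
  assumes arcs: "arcs H = UNIV"
begin

abbreviation "src \<equiv> dart_src H"
abbreviation "tgt \<equiv> dart_tgt H"
abbreviation "wt \<equiv> dart_weight a"
abbreviation "T \<equiv> lambda_matrix (graph_poly H a)"

lemma src_rev [simp]: "src (dart_rev p) = tgt p" and tgt_rev [simp]: "tgt (dart_rev p) = src p"
  by (auto simp: dart_src_def dart_tgt_def dart_rev_def)

lemma T_eq: "T f = (\<Sum>p\<in>UNIV. dart_op H a p f)"
proof -
  have pair: "lambda_matrix (Poly_Mapping.single (free_gen i) (matrix_unit (a i) (head H i) (tail H i)) +
      Poly_Mapping.single (inverse (free_gen i)) (conj_transpose (matrix_unit (a i) (head H i) (tail H i)))) f
    = (\<Sum>b\<in>UNIV. dart_op H a (i, b) f)" for i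
    by (simp add: lambda_matrix_add lambda_matrix_single conj_transpose_matrix_unit UNIV_bool dart_op_def
        dart_weight_def dart_tgt_def dart_src_def letter_True letter_False add.commute)
  have "T f = (\<Sum>i\<in>UNIV. \<Sum>b\<in>UNIV. dart_op H a (i, b) f)"
    unfolding graph_poly_def arcs lambda_matrix_sum pair ..
  also have "\<dots> = (\<Sum>p\<in>UNIV. dart_op H a p f)"
    by (simp add: sum.cartesian_product)
  finally show ?thesis .
qed

lemma T_row: "ell2_apply (T f) (v, h) = (\<Sum>p | tgt p = v. wt p * ell2_apply f (src p, letter (dart_rev p) * h))"
proof -
  have "ell2_apply (T f) (v, h) = (\<Sum>p\<in>UNIV. if tgt p = v then wt p * ell2_apply f (src p, letter (dart_rev p) * h) else 0)"
    unfolding T_eq ell2_apply_sum dart_op_apply by (intro sum.cong) auto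
  then show ?thesis by (simp add: sum.If_cases)
qed

lemma infsum_fibre:
  "(\<Sum>\<^sub>\<infinity>x. if fst x = v then F (snd x) else 0) = (\<Sum>\<^sub>\<infinity>h. F h)"
  for F :: "'d free_group \<Rightarrow> complex" and v :: 'r
proof -
  have "(\<Sum>\<^sub>\<infinity>x. if fst x = v then F (snd x) else 0) = (\<Sum>\<^sub>\<infinity>x\<in>range (Pair v). F (snd x))"
    by (rule infsum_cong_neutral) auto
  also have "\<dots> = (\<Sum>\<^sub>\<infinity>h. F h)" by (subst infsum_reindex) (auto simp: inj_def o_def)
  finally show ?thesis .
qed

text \<open>Both sides are sums over one fibre of the group, matched by the substitution h to
  \<open>letter (dart_rev p) * h\<close>.\<close>

lemma dart_op_adjoint: "cinner (dart_op H a p f) g = cinner f (dart_op H a (dart_rev p) g)"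
proof -
  let ?F = "\<lambda>h. cnj (wt p) * cnj (ell2_apply f (src p, h)) * ell2_apply g (tgt p, letter p * h)"
  have "cinner (dart_op H a p f) g =
      (\<Sum>\<^sub>\<infinity>x. if fst x = tgt p then cnj (wt p) * cnj (ell2_apply f (src p, letter (dart_rev p) * snd x)) * ell2_apply g (tgt p, snd x) else 0)"
    unfolding cinner_def by (intro infsum_cong) (auto simp: dart_op_apply)
  also have "\<dots> = (\<Sum>\<^sub>\<infinity>h. cnj (wt p) * cnj (ell2_apply f (src p, letter (dart_rev p) * h)) * ell2_apply g (tgt p, h))"
    by (rule infsum_fibre)
  also have "\<dots> = (\<Sum>\<^sub>\<infinity>h. ?F (letter (dart_rev p) * h))" by (simp add: letter_cancel)
  also have "\<dots> = (\<Sum>\<^sub>\<infinity>h. ?F h)" by (rule infsum_reindex_bij_betw[OF free_group_left_mult_bij])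
  also have "\<dots> = (\<Sum>\<^sub>\<infinity>x. if fst x = src p then ?F (snd x) else 0)" by (rule infsum_fibre[symmetric])
  also have "\<dots> = cinner f (dart_op H a (dart_rev p) g)"
    unfolding cinner_def by (intro infsum_cong) (auto simp: dart_op_apply dart_weight_rev)
  finally show ?thesis .
qed

lemma bij_dart_rev: "bij dart_rev"
  by (rule bijI') (metis dart_rev_rev, metis dart_rev_rev)

lemma T_symmetric: "cinner (T f) g = cinner f (T g)"
proof -
  have "cinner (T f) g = (\<Sum>p\<in>UNIV. cinner f (dart_op H a (dart_rev p) g))"
    by (simp add: T_eq cinner_sum_left dart_op_adjoint)
  also have "\<dots> = (\<Sum>p\<in>UNIV. cinner f (dart_op H a p g))"
    by (rule sum.reindex_bij_betw[OF bij_dart_rev])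
  finally show ?thesis by (simp add: T_eq cinner_sum_right)
qed

lemma norm_dart_op: "norm (dart_op H a p f) \<le> cmod (wt p) * norm f"
proof (rule norm_ell2_le)
  fix A :: "('r \<times> 'd free_group) set" assume A: "finite A"
  define B where "B = {x\<in>A. fst x = tgt p}"
  define m where "m x = (src p, letter (dart_rev p) * snd x)" for x :: "'r \<times> 'd free_group"
  have inj: "inj_on m B"
  proof (rule inj_onI)
    fix x y assume xy: "x \<in> B" "y \<in> B" "m x = m y"
    then have "letter p * (letter (dart_rev p) * snd x) = letter p * (letter (dart_rev p) * snd y)" by (simp add: m_def)
    then have "snd x = snd y" by (simp only: letter_cancel)
    then show "x = y" using xy by (simp add: B_def prod_eq_iff)
  qed
  have "(\<Sum>x\<in>A. (cmod (ell2_apply (dart_op H a p f) x))\<^sup>2) = (\<Sum>x\<in>B. (cmod (wt p))\<^sup>2 * (cmod (ell2_apply f (m x)))\<^sup>2)"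
    using A unfolding B_def m_def
    by (intro sum.mono_neutral_cong_right) (auto simp: dart_op_apply norm_mult power_mult_distrib split: if_splits)
  also have "\<dots> = (cmod (wt p))\<^sup>2 * (\<Sum>y\<in>m ` B. (cmod (ell2_apply f y))\<^sup>2)"
    by (simp add: sum_distrib_left sum.reindex[OF inj] o_def)
  also have "\<dots> \<le> (cmod (wt p))\<^sup>2 * (norm f)\<^sup>2"
    using A by (intro mult_left_mono sum_le_norm_ell2_sq) (auto simp: B_def)
  finally show "(\<Sum>x\<in>A. (cmod (ell2_apply (dart_op H a p f) x))\<^sup>2) \<le> (cmod (wt p) * norm f)\<^sup>2"
    by (simp add: power_mult_distrib)
qed simp

lemma norm_T: "norm (T f) \<le> (\<Sum>p\<in>UNIV. cmod (wt p)) * norm f"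
  unfolding T_eq sum_distrib_right by (intro sum_norm_le norm_dart_op)

section \<open>The Green function\<close>

text \<open>A state is the last dart of a walk, or the starting vertex of an empty walk.\<close>

definition allowed :: "('d \<times> bool) + 'r \<Rightarrow> 'd \<times> bool \<Rightarrow> bool" where
  "allowed k q = (case k of Inl p \<Rightarrow> src q = tgt p \<and> q \<noteq> dart_rev p | Inr i \<Rightarrow> src q = i)"

definition gw :: "('d \<times> bool) + 'r \<Rightarrow> ('d \<times> bool) + 'r \<Rightarrow> real" where
  "gw k l = (case l of Inl q \<Rightarrow> if allowed k q then (cmod (wt q))\<^sup>2 else 0 | Inr _ \<Rightarrow> 0)"

lemma gw_nonneg: "0 \<le> gw k l"
  by (auto simp: gw_def split: sum.split)

text \<open>The function G is the identity or the coercion to complex numbers, so that one statement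
  serves the equation and its imaginary part.\<close>

lemma sum_gw:
  fixes F :: "('d \<times> bool) + 'r \<Rightarrow> 'b::comm_ring_1"
  assumes G: "G 0 = 0"
  shows "(\<Sum>l\<in>UNIV. G (gw k l) * F l) = (\<Sum>q | allowed k q. G ((cmod (wt q))\<^sup>2) * F (Inl q))"
proof -
  have "(\<Sum>l\<in>UNIV. G (gw k l) * F l) = (\<Sum>q\<in>UNIV. G (gw k (Inl q)) * F (Inl q)) + (\<Sum>i\<in>UNIV. G (gw k (Inr i)) * F (Inr i))"
    unfolding UNIV_Plus_UNIV[symmetric] by (subst sum.Plus) auto
  also have "(\<Sum>i\<in>UNIV. G (gw k (Inr i)) * F (Inr i)) = 0" by (simp add: gw_def G)
  also have "(\<Sum>q\<in>UNIV. G (gw k (Inl q)) * F (Inl q)) = (\<Sum>q\<in>UNIV. if allowed k q then G ((cmod (wt q))\<^sup>2) * F (Inl q) else 0)"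
    by (intro sum.cong) (auto simp: gw_def G)
  finally show ?thesis by (simp add: sum.If_cases)
qed

text \<open>Words are read with the latest step at the head, because left multiplication by a letter
  prepends it.\<close>

definition state :: "'r \<Rightarrow> ('d \<times> bool) list \<Rightarrow> ('d \<times> bool) + 'r" where
  "state i w = (case w of [] \<Rightarrow> Inr i | p # _ \<Rightarrow> Inl p)"

definition endpoint :: "'r \<Rightarrow> ('d \<times> bool) list \<Rightarrow> 'r" where
  "endpoint i w = (case w of [] \<Rightarrow> i | p # _ \<Rightarrow> tgt p)"

text \<open>On a tree resolvent entries factor: \<zeta> at a vertex state is the diagonal entry,
  \<zeta> at a dart q the diagonal entry of the branch behind q, and crossing q multiplies by minus
  its weight times that entry (Schur complement).\<close>

fun psi :: "(('d \<times> bool) + 'r \<Rightarrow> complex) \<Rightarrow> 'r \<Rightarrow> ('d \<times> bool) list \<Rightarrow> complex" where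
  "psi \<zeta> i [] = \<zeta> (Inr i)"
| "psi \<zeta> i (q # w) = (if allowed (state i w) q then - \<zeta> (Inl q) * wt q * psi \<zeta> i w else 0)"

text \<open>\<lambda>(p) commutes with right translations, so the column rooted at h0 depends on h
  only through \<open>h * inverse h0\<close>. The vertex coordinate must be the one where the walk
  ends.\<close>

definition green_column :: "(('d \<times> bool) + 'r \<Rightarrow> complex) \<Rightarrow> 'r \<Rightarrow> 'd free_group \<Rightarrow> 'r \<times> 'd free_group \<Rightarrow> complex" where
  "green_column \<zeta> i h0 x = (let w = normal_form (snd x * inverse h0) in if fst x = endpoint i w then psi \<zeta> i w else 0)"

lemma state_simps [simp]: "state i [] = Inr i" "state i (p # w) = Inl p"
  by (simp_all add: state_def)

lemma endpoint_simps [simp]: "endpoint i [] = i" "endpoint i (p # w) = tgt p"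
  by (simp_all add: endpoint_def)

lemma allowed_simps [simp]: "allowed (Inr i) q \<longleftrightarrow> src q = i" "allowed (Inl p) q \<longleftrightarrow> src q = tgt p \<and> q \<noteq> dart_rev p"
  by (simp_all add: allowed_def)

lemma allowed_state_reduced:
  assumes "reduced (q # w)" shows "allowed (state i w) q \<longleftrightarrow> src q = endpoint i w"
  using assms by (cases w) auto

lemma allowed_image: "dart_rev ` ({p. tgt p = tgt r} - {r}) = {q. allowed (Inl r) q}"
proof (rule set_eqI)
  fix q
  show "q \<in> dart_rev ` ({p. tgt p = tgt r} - {r}) \<longleftrightarrow> q \<in> {q. allowed (Inl r) q}"
  proof
    assume "q \<in> {q. allowed (Inl r) q}"
    then have "src q = tgt r" "q \<noteq> dart_rev r" by simp_all
    then have "dart_rev q \<in> {p. tgt p = tgt r} - {r}" using dart_rev_rev[of q] by auto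
    then have "dart_rev (dart_rev q) \<in> dart_rev ` ({p. tgt p = tgt r} - {r})" by (rule imageI)
    then show "q \<in> dart_rev ` ({p. tgt p = tgt r} - {r})" by simp
  qed auto
qed

lemma cmod_psi_cnj: "cmod (psi (\<lambda>k. cnj (\<zeta> k)) i w) = cmod (psi \<zeta> i w)"
  by (induction w) (simp_all add: norm_mult)

text \<open>At a word w the neighbours are its parent, obtained by deleting the head, and its
  children, obtained by prepending a letter. The children contribute the sum in the Riccati equation
  of the state of w, and the parent contributes the remaining term.\<close>

lemma column_equation:
  assumes eq: "green_eq gw z \<zeta>"
  shows "(\<Sum>p | tgt p = v. wt p * green_column \<zeta> i h0 (src p, letter (dart_rev p) * h)) - z * green_column \<zeta> i h0 (v, h)
    = (if (v, h) = (i, h0) then 1 else 0)"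
proof -
  define u where "u = h * inverse h0"
  define w where "w = normal_form u"
  have red: "reduced w" unfolding w_def by (rule reduced_normal_form)
  have right_inv: "g * inverse g = 1" for g :: "'d free_group"
    by (metis free_group_left_inverse mult.assoc mult_1_left mult_1_right)
  have w_Nil: "w = [] \<longleftrightarrow> h = h0"
  proof
    assume "w = []"
    then have "u = 1" using of_word_normal_form[of u] by (simp add: w_def of_word_Nil)
    then have "u * h0 = h0" by simp
    then show "h = h0" by (simp add: u_def mult.assoc free_group_left_inverse)
  qed (simp add: w_def u_def right_inv normal_form_1)
  have col: "green_column \<zeta> i h0 (v, h) = (if v = endpoint i w then psi \<zeta> i w else 0)"
    by (simp add: green_column_def w_def u_def)
  have col_nb: "green_column \<zeta> i h0 (src p, letter (dart_rev p) * h) =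
      (if src p = endpoint i (push (dart_rev p) w) then psi \<zeta> i (push (dart_rev p) w) else 0)" for p
    by (simp add: green_column_def mult.assoc normal_form_letter_mult w_def u_def)
  have z_eq: "\<zeta> k * (z + (\<Sum>q | allowed k q. complex_of_real ((cmod (wt q))\<^sup>2) * \<zeta> (Inl q))) = - 1" for k
  proof -
    have "\<zeta> k * (z + (\<Sum>l\<in>UNIV. complex_of_real (gw k l) * \<zeta> l)) = - 1"
      using eq unfolding green_eq_def by blast
    then show ?thesis unfolding sum_gw[where G = complex_of_real, OF of_real_0] .
  qed
  show ?thesis
  \<comment> \<open>At the root there is no parent, and the -1 of the Riccati equation becomes the 1
    of the delta function.\<close>
  proof (cases w)
    case Nil
    have summand: "wt p * green_column \<zeta> i h0 (src p, letter (dart_rev p) * h) =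
        (if v = i then - \<zeta> (Inr i) * (complex_of_real ((cmod (wt (dart_rev p)))\<^sup>2) * \<zeta> (Inl (dart_rev p))) else 0)"
      if "tgt p = v" for p
      using that Nil unfolding col_nb cmod_dart_weight_rev dart_weight_rev_mult[symmetric] by (simp add: push_def mult_ac)
    have "(\<Sum>p | tgt p = v. wt p * green_column \<zeta> i h0 (src p, letter (dart_rev p) * h)) =
        (\<Sum>p | tgt p = v. if v = i then - \<zeta> (Inr i) * (complex_of_real ((cmod (wt (dart_rev p)))\<^sup>2) * \<zeta> (Inl (dart_rev p))) else 0)"
      by (intro sum.cong summand) auto
    also have "\<dots> = (\<Sum>q | src q = v. if v = i then - \<zeta> (Inr i) * (complex_of_real ((cmod (wt q))\<^sup>2) * \<zeta> (Inl q)) else 0)"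
      by (rule sum.reindex_bij_witness[of _ dart_rev dart_rev]) auto
    also have "\<dots> = (if v = i then - \<zeta> (Inr i) * (\<Sum>q | src q = v. complex_of_real ((cmod (wt q))\<^sup>2) * \<zeta> (Inl q)) else 0)"
      by (simp add: sum_distrib_left sum_negf)
    finally have s: "(\<Sum>p | tgt p = v. wt p * green_column \<zeta> i h0 (src p, letter (dart_rev p) * h)) =
       (if v = i then - \<zeta> (Inr i) * (\<Sum>q | src q = v. complex_of_real ((cmod (wt q))\<^sup>2) * \<zeta> (Inl q)) else 0)" .
    have h: "h = h0" using Nil w_Nil by simp
    show ?thesis
    proof (cases "v = i")
      case True
      define Q where "Q = (\<Sum>q | src q = i. complex_of_real ((cmod (wt q))\<^sup>2) * \<zeta> (Inl q))"
      have "\<zeta> (Inr i) * (z + Q) = - 1" using z_eq[of "Inr i"] unfolding allowed_simps Q_def .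
      moreover have "- \<zeta> (Inr i) * Q - z * \<zeta> (Inr i) = - (\<zeta> (Inr i) * (z + Q))" by (simp add: algebra_simps)
      ultimately have "- \<zeta> (Inr i) * Q - z * \<zeta> (Inr i) = 1" by simp
      then show ?thesis unfolding s col Nil using True h by (simp add: Q_def)
    next
      case False
      then show ?thesis unfolding s col Nil by simp
    qed
  next
    case (Cons r w')
    have h: "h \<noteq> h0" using Cons w_Nil by auto
    have red': "reduced (r # w')" using red Cons by simp
    have push_r: "push (dart_rev r) w = w'" by (simp add: push_def Cons)
    have push_p: "push (dart_rev p) w = dart_rev p # r # w'" if "p \<noteq> r" for p
      using that by (simp add: push_def Cons)
    show ?thesis
    proof (cases "v = tgt r")
      case False
      have "wt p * green_column \<zeta> i h0 (src p, letter (dart_rev p) * h) = 0" if "tgt p = v" for p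
      proof -
        have "p \<noteq> r" using that False by auto
        then show ?thesis unfolding col_nb push_p[OF \<open>p \<noteq> r\<close>] using that False by simp
      qed
      then have "(\<Sum>p | tgt p = v. wt p * green_column \<zeta> i h0 (src p, letter (dart_rev p) * h)) = 0"
        by (intro sum.neutral) blast
      then show ?thesis using False h unfolding col Cons by simp
    next
      case True
      \<comment> \<open>The entry at the parent; it is 0 when the walk w' does not end where r
        starts.\<close>
      define X where "X = (if src r = endpoint i w' then psi \<zeta> i w' else 0)"
      have psi_w: "psi \<zeta> i w = - \<zeta> (Inl r) * wt r * X"
        unfolding Cons psi.simps allowed_state_reduced[OF red'] X_def by simp
      have "(\<Sum>p | tgt p = v. wt p * green_column \<zeta> i h0 (src p, letter (dart_rev p) * h)) =
          wt r * green_column \<zeta> i h0 (src r, letter (dart_rev r) * h) +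
          (\<Sum>p\<in>{p. tgt p = v} - {r}. wt p * green_column \<zeta> i h0 (src p, letter (dart_rev p) * h))"
        using True by (intro sum.remove) auto
      also have "green_column \<zeta> i h0 (src r, letter (dart_rev r) * h) = X"
        unfolding col_nb push_r X_def ..
      also have "(\<Sum>p\<in>{p. tgt p = v} - {r}. wt p * green_column \<zeta> i h0 (src p, letter (dart_rev p) * h)) =
          (\<Sum>p\<in>{p. tgt p = v} - {r}. - psi \<zeta> i w * (complex_of_real ((cmod (wt (dart_rev p)))\<^sup>2) * \<zeta> (Inl (dart_rev p))))"
      proof (rule sum.cong[OF refl])
        fix p assume p: "p \<in> {p. tgt p = v} - {r}"
        then have pr: "p \<noteq> r" "dart_rev p \<noteq> dart_rev r" by simp_all
        have "green_column \<zeta> i h0 (src p, letter (dart_rev p) * h) = - \<zeta> (Inl (dart_rev p)) * wt (dart_rev p) * psi \<zeta> i w"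
          unfolding col_nb push_p[OF pr(1)] unfolding Cons[symmetric] using p True pr(2) by (simp add: Cons)
        then show "wt p * green_column \<zeta> i h0 (src p, letter (dart_rev p) * h) =
            - psi \<zeta> i w * (complex_of_real ((cmod (wt (dart_rev p)))\<^sup>2) * \<zeta> (Inl (dart_rev p)))"
          unfolding cmod_dart_weight_rev dart_weight_rev_mult[symmetric] by (simp add: mult_ac)
      qed
      also have "\<dots> = (\<Sum>q\<in>dart_rev ` ({p. tgt p = v} - {r}). - psi \<zeta> i w * (complex_of_real ((cmod (wt q))\<^sup>2) * \<zeta> (Inl q)))"
        unfolding sum.reindex[OF inj_on_subset[OF bij_is_inj[OF bij_dart_rev] subset_UNIV]] o_def ..
      also have "\<dots> = - psi \<zeta> i w * (\<Sum>q | allowed (Inl r) q. complex_of_real ((cmod (wt q))\<^sup>2) * \<zeta> (Inl q))"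
        unfolding True allowed_image sum_distrib_left ..
      finally have s: "(\<Sum>p | tgt p = v. wt p * green_column \<zeta> i h0 (src p, letter (dart_rev p) * h)) =
        wt r * X + - psi \<zeta> i w * (\<Sum>q | allowed (Inl r) q. complex_of_real ((cmod (wt q))\<^sup>2) * \<zeta> (Inl q))" .
      have c: "green_column \<zeta> i h0 (v, h) = psi \<zeta> i w" unfolding col using True Cons by simp
      define Q where "Q = (\<Sum>q | allowed (Inl r) q. complex_of_real ((cmod (wt q))\<^sup>2) * \<zeta> (Inl q))"
      have "wt r * X + - psi \<zeta> i w * Q - z * psi \<zeta> i w = wt r * X * (1 + \<zeta> (Inl r) * (z + Q))"
        unfolding psi_w by algebra
      also have "\<zeta> (Inl r) * (z + Q) = - 1" unfolding Q_def by (rule z_eq)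
      finally have "wt r * X + - psi \<zeta> i w * Q - z * psi \<zeta> i w = 0" by simp
      then show ?thesis unfolding s c Q_def using h by simp
    qed
  qed
qed

section \<open>Energy balance along non-backtracking walks\<close>

definition energy :: "(('d \<times> bool) + 'r \<Rightarrow> complex) \<Rightarrow> 'r \<Rightarrow> ('d \<times> bool) list \<Rightarrow> real" where
  "energy \<zeta> i w = (cmod (psi \<zeta> i w))\<^sup>2 * (Im (\<zeta> (state i w)) / (cmod (\<zeta> (state i w)))\<^sup>2)"

abbreviation words :: "nat \<Rightarrow> ('d \<times> bool) list set" where
  "words n \<equiv> {w. length w = n}"

lemma finite_words: "finite (words n)"
  using finite_lists_length_eq[of "UNIV :: ('d \<times> bool) set" n] by simp

lemma sum_words_Suc: "(\<Sum>w\<in>words (Suc n). F w) = (\<Sum>w\<in>words n. \<Sum>q\<in>UNIV. F (q # w))"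
  for F :: "('d \<times> bool) list \<Rightarrow> real"
proof -
  have "words (Suc n) = (\<lambda>(w, q). q # w) ` (words n \<times> UNIV)"
    by (auto simp: image_iff length_Suc_conv)
  then have "(\<Sum>w\<in>words (Suc n). F w) = (\<Sum>x\<in>words n \<times> UNIV. F (case x of (w, q) \<Rightarrow> q # w))"
    by (simp add: sum.reindex inj_on_def case_prod_unfold prod_eq_iff o_def)
  also have "\<dots> = (\<Sum>w\<in>words n. \<Sum>q\<in>UNIV. F (q # w))"
    by (simp add: sum.cartesian_product case_prod_unfold)
  finally show ?thesis .
qed

context
  fixes \<zeta> :: "('d \<times> bool) + 'r \<Rightarrow> complex" and z :: complex
  assumes eq: "green_eq gw z \<zeta>" and pos: "\<And>k. 0 < Im (\<zeta> k)"
begin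

lemma zeta_nonzero: "\<zeta> k \<noteq> 0"
  using nonzero_if_Im_pos[OF pos] .

text \<open>The left side is the imaginary part of -1/\<zeta>_k: what flows into state k is passed
  on to its successors, except for the absorption Im z.\<close>

lemma Im_zeta_eq: "Im (\<zeta> k) / (cmod (\<zeta> k))\<^sup>2 = Im z + (\<Sum>q | allowed k q. (cmod (wt q))\<^sup>2 * Im (\<zeta> (Inl q)))"
proof -
  have "Im (\<zeta> k) = (cmod (\<zeta> k))\<^sup>2 * (Im z + (\<Sum>l\<in>UNIV. gw k l * Im (\<zeta> l)))"
    using eq by (intro green_upper_imaginary_part) (simp add: green_eq_def)
  moreover have "(\<Sum>l\<in>UNIV. gw k l * Im (\<zeta> l)) = (\<Sum>q | allowed k q. (cmod (wt q))\<^sup>2 * Im (\<zeta> (Inl q)))"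
    using sum_gw[of "\<lambda>x. x" k "\<lambda>l. Im (\<zeta> l)"] by simp
  ultimately show ?thesis using zeta_nonzero[of k] by simp
qed

lemma energy_nonneg: "0 \<le> energy \<zeta> i w"
  unfolding energy_def using pos[of "state i w"] by simp

lemma energy_Cons:
  "energy \<zeta> i (q # w) = (if allowed (state i w) q then (cmod (psi \<zeta> i w))\<^sup>2 * ((cmod (wt q))\<^sup>2 * Im (\<zeta> (Inl q))) else 0)"
  using zeta_nonzero[of "Inl q"] by (simp add: energy_def norm_mult power_mult_distrib)

text \<open>Multiply the flow equation of the last state by |psi|^2; a successor carries |psi|^2 |wt
  q|^2 Im \<zeta>_q because the factor |\<zeta>_q|^2 cancels.\<close>

lemma energy_successors: "(\<Sum>q\<in>UNIV. energy \<zeta> i (q # w)) = energy \<zeta> i w - Im z * (cmod (psi \<zeta> i w))\<^sup>2"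
proof -
  have "(\<Sum>q\<in>UNIV. energy \<zeta> i (q # w)) = (cmod (psi \<zeta> i w))\<^sup>2 * (\<Sum>q | allowed (state i w) q. (cmod (wt q))\<^sup>2 * Im (\<zeta> (Inl q)))"
    unfolding energy_Cons by (simp add: sum.If_cases sum_distrib_left)
  then show ?thesis unfolding energy_def Im_zeta_eq by (simp add: algebra_simps)
qed

lemma energy_level: "(\<Sum>w\<in>words n. energy \<zeta> i w) = Im (\<zeta> (Inr i)) - Im z * (\<Sum>m<n. \<Sum>w\<in>words m. (cmod (psi \<zeta> i w))\<^sup>2)"
proof (induction n)
  case 0
  then show ?case using zeta_nonzero[of "Inr i"] by (simp add: energy_def)
next
  case (Suc n)
  have "(\<Sum>w\<in>words (Suc n). energy \<zeta> i w) = (\<Sum>w\<in>words n. energy \<zeta> i w) - Im z * (\<Sum>w\<in>words n. (cmod (psi \<zeta> i w))\<^sup>2)"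
    unfolding sum_words_Suc energy_successors by (simp add: sum_subtractf sum_distrib_left)
  then show ?case using Suc by (simp add: algebra_simps)
qed

lemma psi_square_sum: "Im z * (\<Sum>m<n. \<Sum>w\<in>words m. (cmod (psi \<zeta> i w))\<^sup>2) \<le> Im (\<zeta> (Inr i))"
  using energy_level[where n = n and i = i] sum_nonneg[of "words n" "energy \<zeta> i"] energy_nonneg by simp

text \<open>The absorbed energy of all levels is at most the initial energy Im \<zeta>; a group
  element and the endpoint condition determine at most one row each.\<close>

lemma column_square_sum:
  assumes z: "0 < Im z" and A: "finite A"
  shows "(\<Sum>x\<in>A. (cmod (green_column \<zeta> i h0 x))\<^sup>2) \<le> Im (\<zeta> (Inr i)) / Im z"
proof -
  define f where "f x = normal_form (snd x * inverse h0)" for x :: "'r \<times> 'd free_group"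
  define B where "B = {x\<in>A. fst x = endpoint i (f x)}"
  have inj: "inj_on f B"
  proof (rule inj_onI)
    fix x y assume xy: "x \<in> B" "y \<in> B" "f x = f y"
    then have "snd x * inverse h0 = snd y * inverse h0" unfolding f_def by (metis of_word_normal_form)
    then have "snd x * inverse h0 * h0 = snd y * inverse h0 * h0" by simp
    then have "snd x = snd y" by (simp add: mult.assoc free_group_left_inverse)
    then show "x = y" using xy by (simp add: B_def prod_eq_iff)
  qed
  \<comment> \<open>A level beyond all words met by the finite set A; the inserted 0 covers the
    empty case.\<close>
  define N where "N = Suc (Max (insert 0 (length ` f ` B)))"
  have finB: "finite B" using A by (simp add: B_def)
  have "f ` B \<subseteq> (\<Union>m\<in>{..<N}. words m)"
  proof
    fix w assume "w \<in> f ` B"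
    then have "length w \<le> Max (insert 0 (length ` f ` B))" using finB by (intro Max_ge) auto
    then show "w \<in> (\<Union>m\<in>{..<N}. words m)" unfolding N_def by auto
  qed
  then have sub: "(\<Sum>w\<in>f ` B. (cmod (psi \<zeta> i w))\<^sup>2) \<le> (\<Sum>w\<in>(\<Union>m\<in>{..<N}. words m). (cmod (psi \<zeta> i w))\<^sup>2)"
    using finite_words by (intro sum_mono2) auto
  have "(\<Sum>x\<in>A. (cmod (green_column \<zeta> i h0 x))\<^sup>2) = (\<Sum>x\<in>B. (cmod (psi \<zeta> i (f x)))\<^sup>2)"
    using A by (intro sum.mono_neutral_cong_right) (auto simp: B_def green_column_def f_def Let_def)
  also have "\<dots> = (\<Sum>w\<in>f ` B. (cmod (psi \<zeta> i w))\<^sup>2)" by (simp add: sum.reindex[OF inj])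
  also note sub
  also have "(\<Sum>w\<in>(\<Union>m\<in>{..<N}. words m). (cmod (psi \<zeta> i w))\<^sup>2) = (\<Sum>m<N. \<Sum>w\<in>words m. (cmod (psi \<zeta> i w))\<^sup>2)"
    using finite_words by (intro sum.UNION_disjoint) auto
  also have "\<dots> \<le> Im (\<zeta> (Inr i)) / Im z"
    using psi_square_sum[where n = N and i = i] z by (simp add: pos_le_divide_eq mult.commute)
  finally show ?thesis .
qed

end

lemma cmod_column_cnj: "cmod (green_column (\<lambda>k. cnj (\<zeta> k)) i h0 x) = cmod (green_column \<zeta> i h0 x)"
  by (simp add: green_column_def Let_def cmod_psi_cnj)

lemma green_eq_cnj:
  assumes "green_eq gw z \<zeta>" shows "green_eq gw (cnj z) (\<lambda>k. cnj (\<zeta> k))"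
  unfolding green_eq_def
proof
  fix k
  have "cnj (\<zeta> k * (z + (\<Sum>l\<in>UNIV. complex_of_real (gw k l) * \<zeta> l))) = cnj (- 1)"
    using assms unfolding green_eq_def by metis
  then show "cnj (\<zeta> k) * (cnj z + (\<Sum>l\<in>UNIV. complex_of_real (gw k l) * cnj (\<zeta> l))) = - 1" by simp
qed

lemma column_solves:
  assumes eq: "green_eq gw z \<zeta>" and f: "ell2_apply f = green_column \<zeta> i h0"
  shows "op_shift T z f = ell2_delta (i, h0)"
proof (rule ell2_pair_eqI)
  fix v h
  show "ell2_apply (op_shift T z f) (v, h) = ell2_apply (ell2_delta (i, h0)) (v, h)"
  proof -
    have "(\<Sum>p | tgt p = v. wt p * green_column \<zeta> i h0 (src p, letter (dart_rev p) * h)) - z * green_column \<zeta> i h0 (v, h)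
      = (if (v, h) = (i, h0) then 1 else 0)" by (rule column_equation[OF eq])
    then show ?thesis by (simp add: op_shift_def T_row f)
  qed
qed

lemma column_in_ell2:
  assumes eq: "green_eq gw z \<zeta>" and pos: "\<And>k. 0 < Im (\<zeta> k)" and z: "0 < Im z"
  shows "\<exists>f. ell2_apply f = green_column \<zeta> i h0" "\<exists>f. ell2_apply f = green_column (\<lambda>k. cnj (\<zeta> k)) i h0"
proof -
  show "\<exists>f. ell2_apply f = green_column \<zeta> i h0"
    by (rule ell2_of_bounded_sums) (rule column_square_sum[OF eq pos z])
  show "\<exists>f. ell2_apply f = green_column (\<lambda>k. cnj (\<zeta> k)) i h0"
    by (rule ell2_of_bounded_sums) (unfold cmod_column_cnj, rule column_square_sum[OF eq pos z])
qed

end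

section \<open>Identification of the resolvent with the Green columns\<close>

locale green_graph = weighted_graph +
  fixes \<zeta>
  assumes sol: "green_solution gw \<zeta>"
begin

text \<open>Below the real axis the conjugate values solve the conjugate system, as the weights are
  real.\<close>

definition green_value :: "complex \<Rightarrow> ('b \<times> bool) + 'a \<Rightarrow> complex" where
  "green_value z k = (if 0 < Im z then \<zeta> k z else cnj (\<zeta> k (cnj z)))"

lemma column_exists:
  assumes "Im z \<noteq> 0"
  shows "\<exists>f. ell2_apply f = green_column (green_value z) i h0 \<and> op_shift T z f = ell2_delta (i, h0)"
proof (cases "0 < Im z")
  case True
  then have z: "z \<in> upper" by simp
  have gv: "green_value z = (\<lambda>k. \<zeta> k z)" using True by (simp add: green_value_def fun_eq_iff)
  have eq: "green_eq gw z (\<lambda>k. \<zeta> k z)" and pos: "\<And>k. 0 < Im (\<zeta> k z)"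
    using sol z unfolding green_solution_def by blast+
  show ?thesis unfolding gv using column_in_ell2(1)[OF eq pos True] column_solves[OF eq] by blast
next
  case False
  then have z: "cnj z \<in> upper" using assms by simp
  have gv: "green_value z = (\<lambda>k. cnj (\<zeta> k (cnj z)))" using False by (simp add: green_value_def fun_eq_iff)
  have eq: "green_eq gw (cnj z) (\<lambda>k. \<zeta> k (cnj z))" and pos: "\<And>k. 0 < Im (\<zeta> k (cnj z))"
    using sol z unfolding green_solution_def by blast+
  have eq': "green_eq gw z (\<lambda>k. cnj (\<zeta> k (cnj z)))" using green_eq_cnj[OF eq] by simp
  have "0 < Im (cnj z)" using z by simp
  then show ?thesis unfolding gv using column_in_ell2(2)[OF eq pos] column_solves[OF eq'] by blast
qed

sublocale finite_row_operator T "\<lambda>x. {p. tgt p = fst x}" "\<lambda>x p. (src p, letter (dart_rev p) * snd x)"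
  "\<lambda>_. wt" "\<Sum>p\<in>UNIV. cmod (wt p)"
proof
  show "ell2_apply (T f) x = (\<Sum>p | tgt p = fst x. wt p * ell2_apply f (src p, letter (dart_rev p) * snd x))" for f x
    using T_row[of f "fst x" "snd x"] by simp
  show "\<exists>f. op_shift T z f = ell2_delta x" if "Im z \<noteq> 0" for z x
    using column_exists[OF that, of "fst x" "snd x"] by auto
qed (rule T_symmetric norm_T)+

lemma resolvent_delta:
  assumes "Im z \<noteq> 0"
  shows "ell2_apply (resolvent T z (ell2_delta (i, h0))) = green_column (green_value z) i h0"
proof -
  obtain f where f: "ell2_apply f = green_column (green_value z) i h0" "op_shift T z f = ell2_delta (i, h0)"
    using column_exists[OF assms] by blast
  then show ?thesis using resolvent_eqI[OF assms f(2)] by simp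
qed

end

section \<open>The spectrum near points of holomorphy of the resolvent entries\<close>

text \<open>On the circle \<open>|z - E| = \<rho>\<close> around a real point, \<open>|(z - E)\<^sup>2 - \<rho>\<^sup>2| = 2 \<rho> |Im z|\<close>, which
  compensates the singular bound.\<close>

lemma strip_bound:
  fixes G :: "complex \<Rightarrow> complex" and E \<rho> r B :: real
  assumes hol: "G holomorphic_on ball (complex_of_real E) r" and \<rho>: "0 < \<rho>" "\<rho> < r"
    and G: "\<And>z. z \<in> ball (complex_of_real E) r \<Longrightarrow> Im z \<noteq> 0 \<Longrightarrow> cmod (G z) \<le> B / \<bar>Im z\<bar>"
    and B: "0 \<le> B" and z: "cmod (z - complex_of_real E) \<le> \<rho> / 2"
  shows "cmod (G z) \<le> 4 * B / \<rho>"
proof -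
  let ?E = "complex_of_real E"
  define h where "h w = G w * ((w - ?E)\<^sup>2 - (complex_of_real \<rho>)\<^sup>2)" for w
  have sub: "cball ?E \<rho> \<subseteq> ball ?E r" using \<rho> by auto
  have hol_h: "h holomorphic_on ball ?E r" unfolding h_def by (intro holomorphic_intros hol)
  have h_z: "cmod (h z) \<le> 2 * \<rho> * B"
  proof (rule maximum_modulus_frontier[where f = h and S = "ball ?E \<rho>"])
    show "h holomorphic_on interior (ball ?E \<rho>)" using hol_h \<rho> by (simp add: holomorphic_on_subset subset_ball)
    show "continuous_on (closure (ball ?E \<rho>)) h"
      using holomorphic_on_imp_continuous_on[OF holomorphic_on_subset[OF hol_h sub]] \<rho> by simp
    show "z \<in> ball ?E \<rho>" using z \<rho> by (simp add: dist_norm norm_minus_commute)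
    fix w assume "w \<in> frontier (ball ?E \<rho>)"
    then have w: "cmod (w - ?E) = \<rho>" using \<rho> by (simp add: frontier_ball sphere_def dist_norm norm_minus_commute)
    define u where "u = w - ?E"
    have cu: "cmod u = \<rho>" and Imu: "Im u = Im w" using w by (simp_all add: u_def)
    have "(complex_of_real \<rho>)\<^sup>2 = u * cnj u"
      using complex_norm_square[of u] unfolding cu of_real_power .
    then have "u\<^sup>2 - (complex_of_real \<rho>)\<^sup>2 = u * (u - cnj u)" by (simp add: power2_eq_square algebra_simps)
    also have "cmod (u * (u - cnj u)) = \<rho> * (2 * \<bar>Im w\<bar>)"
      by (simp add: norm_mult complex_diff_cnj abs_mult cu Imu)
    finally have m: "cmod (u\<^sup>2 - (complex_of_real \<rho>)\<^sup>2) = \<rho> * (2 * \<bar>Im w\<bar>)" .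
    have "cmod (h w) = cmod (G w) * (\<rho> * (2 * \<bar>Im w\<bar>))" unfolding h_def norm_mult using m by (simp add: u_def)
    also have "\<dots> \<le> 2 * \<rho> * B"
    \<comment> \<open>At the two real points of the circle the added factor vanishes, so no bound on
      G is needed there.\<close>
    proof (cases "Im w = 0")
      case False
      have "w \<in> ball ?E r" using w \<rho> by (simp add: dist_norm norm_minus_commute)
      then have "cmod (G w) * \<bar>Im w\<bar> \<le> B" using G[OF _ False] False by (simp add: pos_le_divide_eq)
      then have "2 * \<rho> * (cmod (G w) * \<bar>Im w\<bar>) \<le> 2 * \<rho> * B" using \<rho> by (intro mult_left_mono) auto
      then show ?thesis by (simp add: mult_ac)
    qed (use \<rho> B in simp)
    finally show "cmod (h w) \<le> 2 * \<rho> * B" .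
  qed simp
  have "\<rho>\<^sup>2 - (\<rho> / 2)\<^sup>2 \<le> cmod ((complex_of_real \<rho>)\<^sup>2) - cmod ((z - ?E)\<^sup>2)"
    using z \<rho> by (auto simp: norm_power intro!: diff_mono power_mono)
  also have "\<dots> \<le> cmod ((z - ?E)\<^sup>2 - (complex_of_real \<rho>)\<^sup>2)"
    by (metis norm_minus_commute norm_triangle_ineq2)
  finally have "\<rho>\<^sup>2 - (\<rho> / 2)\<^sup>2 \<le> cmod ((z - ?E)\<^sup>2 - (complex_of_real \<rho>)\<^sup>2)" .
  moreover have "(\<rho> / 2)\<^sup>2 = \<rho>\<^sup>2 / 4" by (simp add: power_divide)
  ultimately have low: "\<rho>\<^sup>2 / 2 \<le> cmod ((z - ?E)\<^sup>2 - (complex_of_real \<rho>)\<^sup>2)"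
    using zero_le_power2[of \<rho>] by linarith
  have "cmod (G z) * (\<rho>\<^sup>2 / 2) \<le> cmod (h z)"
    unfolding h_def norm_mult by (intro mult_left_mono low) simp
  moreover have "\<rho> * (cmod (G z) * \<rho>) = 2 * (cmod (G z) * (\<rho>\<^sup>2 / 2))" by (simp add: power2_eq_square)
  moreover have "\<rho> * (4 * B) = 2 * (2 * \<rho> * B)" by simp
  ultimately have "\<rho> * (cmod (G z) * \<rho>) \<le> \<rho> * (4 * B)" using h_z by linarith
  then have "cmod (G z) * \<rho> \<le> 4 * B" using \<rho> by (simp add: mult_le_cancel_left)
  then show ?thesis using \<rho> by (simp add: pos_le_divide_eq)
qed

text \<open>In the cone where |Im z| is comparable to the distance from E the hypothesis suffices.
  Near the real axis \<open>strip_bound\<close> is used in a disc around Re z that avoids E. The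
  cases give 5 and (5/4) 8 = 10.\<close>

lemma simple_pole_bound:
  fixes F :: "complex \<Rightarrow> complex" and E r :: real
  assumes hol: "F holomorphic_on ball (complex_of_real E) r - {complex_of_real E}"
    and F: "\<And>z. z \<in> ball (complex_of_real E) r \<Longrightarrow> Im z \<noteq> 0 \<Longrightarrow> cmod (F z) \<le> 1 / \<bar>Im z\<bar>"
    and z: "cmod (z - complex_of_real E) < r / 2" "z \<noteq> complex_of_real E"
  shows "cmod ((z - complex_of_real E) * F z) \<le> 10"
proof -
  define d where "d = \<bar>Re z - E\<bar>"
  have zE: "cmod (z - complex_of_real E) \<le> d + \<bar>Im z\<bar>"
    using cmod_le[of "z - complex_of_real E"] by (simp add: d_def)
  have d_le: "d < r / 2" using abs_Re_le_cmod[of "z - complex_of_real E"] z(1) by (simp add: d_def)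
  show ?thesis
  proof (cases "d / 4 \<le> \<bar>Im z\<bar>")
    case True
    have nz: "Im z \<noteq> 0"
    proof
      assume "Im z = 0"
      then have "z = complex_of_real E" using True by (simp add: d_def complex_eq_iff)
      then show False using z(2) by simp
    qed
    have "cmod (z - complex_of_real E) < r" using z(1) norm_ge_zero[of "z - complex_of_real E"] by linarith
    then have "z \<in> ball (complex_of_real E) r" by (simp add: dist_norm norm_minus_commute)
    then have "cmod (F z) \<le> 1 / \<bar>Im z\<bar>" using F nz by blast
    moreover have "cmod (z - complex_of_real E) \<le> 5 * \<bar>Im z\<bar>" using zE True by linarith
    ultimately have "cmod (z - complex_of_real E) * cmod (F z) \<le> (5 * \<bar>Im z\<bar>) * (1 / \<bar>Im z\<bar>)"
      by (intro mult_mono) auto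
    then show ?thesis using nz by (simp add: norm_mult)
  next
    case False
    then have d: "0 < d" by linarith
    have sub: "ball (complex_of_real (Re z)) d \<subseteq> ball (complex_of_real E) r - {complex_of_real E}"
    proof
      fix w assume w: "w \<in> ball (complex_of_real (Re z)) d"
      have "dist (complex_of_real E) (complex_of_real (Re z)) = d" by (simp add: dist_of_real dist_real_def d_def abs_minus_commute)
      then show "w \<in> ball (complex_of_real E) r - {complex_of_real E}"
        using w d_le dist_triangle[of "complex_of_real E" w "complex_of_real (Re z)"]
        by (auto simp: dist_commute)
    qed
    have "cmod (F z) \<le> 4 * 1 / (d / 2)"
    proof (rule strip_bound[where G = F and r = d and E = "Re z" and \<rho> = "d / 2" and B = 1 and z = z])
      show "F holomorphic_on ball (complex_of_real (Re z)) d" by (rule holomorphic_on_subset[OF hol sub])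
      have "z - complex_of_real (Re z) = \<i> * complex_of_real (Im z)" by (simp add: complex_eq_iff)
      then show "cmod (z - complex_of_real (Re z)) \<le> d / 2 / 2" using False by (simp add: norm_mult)
      show "cmod (F w) \<le> 1 / \<bar>Im w\<bar>" if "w \<in> ball (complex_of_real (Re z)) d" "Im w \<noteq> 0" for w
        using F sub that by blast
    qed (use d in auto)
    moreover have "cmod (z - complex_of_real E) \<le> d + d / 4" using zE False by linarith
    ultimately have "cmod (z - complex_of_real E) * cmod (F z) \<le> (d + d / 4) * (4 * 1 / (d / 2))"
      using d by (intro mult_mono) auto
    moreover have "(d + d / 4) * (4 * 1 / (d / 2)) = 10" using d by (simp add: field_simps)
    ultimately show ?thesis by (simp only: norm_mult)
  qed
qed

context finite_row_operator
begin

lemma cmod_resolvent_entry_le: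
  assumes "Im z \<noteq> 0" shows "cmod (ell2_apply (resolvent T z (ell2_delta y)) x) \<le> 1 / \<bar>Im z\<bar>"
  using cmod_ell2_apply_le norm_resolvent_le[OF assms, of "ell2_delta y"] order_trans
  by (fastforce simp: norm_ell2_delta)

lemma shift_diff_points: "op_shift T z f = op_shift T w f - (z - w) *\<^sub>C f"
  by (simp add: op_shift_def scaleC_distribs)

lemma norm_shift_le: "norm (op_shift T w f) \<le> norm (op_shift T z f) + cmod (z - w) * norm f"
proof -
  have "op_shift T w f = op_shift T z f + (z - w) *\<^sub>C f" using shift_diff_points[of z f w] by simp
  then show ?thesis by (metis norm_scaleC norm_triangle_ineq)
qed

text \<open>A real point is regular once T - E is bounded below: the resolvent at E + i \<eta> gives
  approximate solutions, with error \<eta> times a norm that the lower bound controls.\<close>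

lemma bounded_below_not_spectrum:
  assumes \<kappa>: "0 < \<kappa>" and below: "\<And>f. \<kappa> * norm f \<le> norm (op_shift T (complex_of_real E) f)"
  shows "complex_of_real E \<notin> spectrum T"
proof -
  let ?E = "complex_of_real E"
  have surj: "\<exists>f. op_shift T ?E f = g" for g
  proof (rule shift_surj_closed[OF below \<kappa>])
    fix e :: real assume e: "0 < e"
    \<comment> \<open>The first bound keeps half of the lower bound at E + i \<eta>; the second
      makes the error at most e, with norm g + 1 to avoid dividing by 0.\<close>
    define \<eta> where "\<eta> = min (\<kappa> / 2) (e * \<kappa> / (2 * (norm g + 1)))"
    have g1: "0 < norm g + 1" using norm_ge_zero[of g] by linarith
    have \<eta>: "0 < \<eta>" "\<eta> \<le> \<kappa> / 2" "\<eta> \<le> e * \<kappa> / (2 * (norm g + 1))"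
    proof -
      show "0 < \<eta>" unfolding \<eta>_def using \<kappa> e g1 by auto
    qed (unfold \<eta>_def, (rule min.cobounded1 min.cobounded2)+)
    define z where "z = Complex E \<eta>"
    have z: "Im z \<noteq> 0" "cmod (z - ?E) = \<eta>" using \<eta> by (auto simp: z_def cmod_def)
    define f where "f = resolvent T z g"
    have f: "op_shift T z f = g" unfolding f_def by (rule shift_resolvent[OF z(1)])
    have "\<kappa> * norm f \<le> norm g + \<eta> * norm f"
      using below[of f] norm_shift_le[of ?E f z] f z(2) by (simp add: norm_minus_commute)
    moreover have "\<eta> * norm f \<le> \<kappa> / 2 * norm f" using \<eta>(2) by (intro mult_right_mono) auto
    ultimately have nf: "\<kappa> / 2 * norm f \<le> norm g" by (simp add: algebra_simps)
    have "op_shift T ?E f - g = (z - ?E) *\<^sub>C f" using shift_diff_points[of z f ?E] f by simp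
    then have "norm (op_shift T ?E f - g) = \<eta> * norm f" by (simp add: norm_scaleC z(2))
    also have "\<dots> \<le> e * \<kappa> / (2 * (norm g + 1)) * norm f" using \<eta>(3) by (intro mult_right_mono) auto
    also have "\<dots> = e * (\<kappa> / 2 * norm f) / (norm g + 1)" by simp
    also have "\<dots> \<le> e * norm g / (norm g + 1)" using nf e g1 by (intro divide_right_mono mult_left_mono) auto
    also have "\<dots> \<le> e" using e g1 by (simp add: pos_divide_le_eq)
    finally show "\<exists>f. norm (op_shift T ?E f - g) \<le> e" by blast
  qed
  show ?thesis
    unfolding spectrum_def using regular_point(1,2)[OF below \<kappa> surj] by simp
qed

lemma not_spectrum_bounded_below:
  assumes "w \<notin> spectrum T"
  shows "\<exists>\<kappa>>0. \<forall>f. \<kappa> * norm f \<le> norm (op_shift T w f)"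
proof -
  have bij: "bij (op_shift T w)" and bl: "bounded_linear (resolvent T w)"
    using assms by (auto simp: spectrum_def)
  obtain M where M: "0 < M" "\<And>g. norm (resolvent T w g) \<le> norm g * M"
    using bounded_linear.pos_bounded[OF bl] by blast
  have "1 / M * norm f \<le> norm (op_shift T w f)" for f
  proof -
    have "resolvent T w (op_shift T w f) = f"
      unfolding resolvent_def using bij by (simp add: bij_is_inj inv_f_f)
    then show ?thesis using M(2)[of "op_shift T w f"] M(1) by (simp add: pos_divide_le_eq)
  qed
  then show ?thesis using M(1) by (intro exI[of _ "1 / M"]) simp
qed

lemma not_spectrum_neighbourhood:
  assumes "complex_of_real E \<notin> spectrum T"
  shows "\<exists>r>0. \<forall>E'. \<bar>E' - E\<bar> < r \<longrightarrow> complex_of_real E' \<notin> spectrum T"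
proof -
  obtain \<kappa> where \<kappa>: "0 < \<kappa>" "\<And>f. \<kappa> * norm f \<le> norm (op_shift T (complex_of_real E) f)"
    using not_spectrum_bounded_below[OF assms] by blast
  have "complex_of_real E' \<notin> spectrum T" if "\<bar>E' - E\<bar> < \<kappa> / 2" for E'
  proof (rule bounded_below_not_spectrum)
    show "0 < \<kappa> / 2" using \<kappa> by simp
    fix f :: "'x ell2"
    have "cmod (complex_of_real E' - complex_of_real E) \<le> \<kappa> / 2"
      using that by (simp only: of_real_diff[symmetric] norm_of_real)
    then have "cmod (complex_of_real E' - complex_of_real E) * norm f \<le> \<kappa> / 2 * norm f" by (intro mult_right_mono) auto
    then show "\<kappa> / 2 * norm f \<le> norm (op_shift T (complex_of_real E') f)"
      using \<kappa>(2)[of f] norm_shift_le[of "complex_of_real E" f "complex_of_real E'"] by (simp add: algebra_simps)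
  qed
  then show ?thesis using \<kappa>(1) by (intro exI[of _ "\<kappa> / 2"]) simp
qed

lemma spectrum_norm_bound:
  assumes "complex_of_real E \<in> spectrum T" shows "\<bar>E\<bar> \<le> K"
proof (rule ccontr)
  assume "\<not> \<bar>E\<bar> \<le> K"
  then have "0 < \<bar>E\<bar> - K" by simp
  moreover have "(\<bar>E\<bar> - K) * norm f \<le> norm (op_shift T (complex_of_real E) f)" for f
    using norm_triangle_ineq2[of "complex_of_real E *\<^sub>C f" "T f"] bdd[of f]
    by (simp add: op_shift_def norm_scaleC norm_minus_commute algebra_simps)
  ultimately show False using bounded_below_not_spectrum assms by blast
qed

text \<open>At a regular point the resolvent norms stay bounded, so the imaginary part of a diagonal
  entry, \<eta> times a squared norm, tends to 0.\<close>

lemma spectrum_if_Im_entry_bounded_below: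
  assumes c: "0 < c" and \<eta>0: "0 < \<eta>0"
    and low: "\<And>\<eta>. 0 < \<eta> \<Longrightarrow> \<eta> < \<eta>0 \<Longrightarrow> c \<le> Im (ell2_apply (resolvent T (Complex E \<eta>) (ell2_delta x)) x)"
  shows "complex_of_real E \<in> spectrum T"
proof (rule ccontr)
  assume "complex_of_real E \<notin> spectrum T"
  then obtain \<kappa> where \<kappa>: "0 < \<kappa>" "\<And>f. \<kappa> * norm f \<le> norm (op_shift T (complex_of_real E) f)"
    using not_spectrum_bounded_below by blast
  \<comment> \<open>With this \<eta> the resolvent column has norm at most 2/\<kappa>, so the
    imaginary part is at most c/2.\<close>
  define \<eta> where "\<eta> = min (\<eta>0 / 2) (min (\<kappa> / 2) (c * \<kappa>\<^sup>2 / 8))"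
  have \<eta>: "0 < \<eta>" "\<eta> < \<eta>0" "\<eta> \<le> \<kappa> / 2" "\<eta> \<le> c * \<kappa>\<^sup>2 / 8" unfolding \<eta>_def using \<kappa>(1) c \<eta>0 by auto
  define z where "z = Complex E \<eta>"
  have z: "Im z \<noteq> 0" "Im z = \<eta>" "cmod (z - complex_of_real E) = \<eta>" using \<eta> by (auto simp: z_def cmod_def)
  define f where "f = resolvent T z (ell2_delta x)"
  have "op_shift T z f = ell2_delta x" unfolding f_def by (rule shift_resolvent[OF z(1)])
  then have "\<kappa> * norm f \<le> 1 + \<eta> * norm f"
    using \<kappa>(2)[of f] norm_shift_le[of "complex_of_real E" f z] z(3) by (simp add: norm_ell2_delta)
  moreover have "\<eta> * norm f \<le> \<kappa> / 2 * norm f" using \<eta>(3) by (intro mult_right_mono) auto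
  ultimately have "\<kappa> * norm f \<le> 2" by (simp add: algebra_simps)
  then have "(\<kappa> * norm f)\<^sup>2 \<le> 2\<^sup>2" using \<kappa>(1) by (intro power_mono) auto
  then have sq: "\<kappa>\<^sup>2 * (norm f)\<^sup>2 \<le> 4" by (simp add: power_mult_distrib)
  have "Im (ell2_apply f x) = \<eta> * (norm f)\<^sup>2"
    using Im_cinner_resolvent[OF z(1), of "ell2_delta x"] unfolding f_def cinner_delta_left z(2) .
  then have "c \<le> \<eta> * (norm f)\<^sup>2" using low[OF \<eta>(1,2)] by (simp add: f_def z_def)
  also have "\<dots> \<le> c * \<kappa>\<^sup>2 / 8 * (norm f)\<^sup>2" using \<eta>(4) by (intro mult_right_mono) auto
  also have "\<dots> = c / 8 * (\<kappa>\<^sup>2 * (norm f)\<^sup>2)" by simp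
  also have "\<dots> \<le> c / 8 * 4" using sq c by (intro mult_left_mono) auto
  finally show False using c by simp
qed

text \<open>For finitely supported f the quadratic form G of the resolvent is holomorphic at E and,
  by \<open>strip_bound\<close>, bounded by a multiple of the squared norm of f alone. Being
  conjugation symmetric it has imaginary part O(\<eta>); this is \<eta> times a squared resolvent
  norm, so resolvents are bounded uniformly.\<close>

lemma holomorphic_entries_not_spectrum:
  fixes F :: "'x \<Rightarrow> 'x \<Rightarrow> complex \<Rightarrow> complex"
  assumes r: "0 < r" and hol: "\<And>x y. F x y holomorphic_on ball (complex_of_real E) r"
    and F: "\<And>x y z. z \<in> ball (complex_of_real E) r \<Longrightarrow> Im z \<noteq> 0 \<Longrightarrow>
      F x y z = ell2_apply (resolvent T z (ell2_delta y)) x"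
  shows "complex_of_real E \<notin> spectrum T"
proof -
  let ?E = "complex_of_real E"
  define \<rho> where "\<rho> = r / 2"
  have \<rho>: "0 < \<rho>" "\<rho> < r" using r by (auto simp: \<rho>_def)
  have fin: "norm (resolvent T (Complex E \<eta>) f) \<le> 4 / \<rho> * norm f"
    if \<eta>: "0 < \<eta>" "\<eta> < \<rho> / 4" and f: "f = truncate A g" and A: "finite A" for \<eta> f A g
  proof -
    define G where "G z = (\<Sum>x\<in>A. \<Sum>y\<in>A. cnj (ell2_apply g x) * ell2_apply g y * F x y z)" for z
    have holG: "G holomorphic_on ball ?E r" unfolding G_def by (intro holomorphic_intros hol)
    have G: "G z = cinner f (resolvent T z f)" if z: "z \<in> ball ?E r" "Im z \<noteq> 0" for z
    proof -
      define R where "R = resolvent T z f"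
      have "R = (\<Sum>y\<in>A. ell2_apply g y *\<^sub>C resolvent T z (ell2_delta y))"
        unfolding R_def f truncate_def by (rule resolvent_sum_scaleC[OF z(2)])
      then have R: "ell2_apply R x = (\<Sum>y\<in>A. ell2_apply g y * F x y z)" for x
        by (simp add: ell2_apply_sum F[OF z])
      have "cinner f R = (\<Sum>x\<in>A. cnj (ell2_apply g x) * ell2_apply R x)"
        unfolding f truncate_def by (simp add: cinner_sum_left cinner_scaleC_left cinner_delta_left)
      then have "cinner f R = (\<Sum>x\<in>A. \<Sum>y\<in>A. cnj (ell2_apply g x) * (ell2_apply g y * F x y z))"
        unfolding R sum_distrib_left .
      then show ?thesis unfolding G_def R_def by (simp add: mult.assoc)
    qed
    have G_bd: "cmod (G z) \<le> (norm f)\<^sup>2 / \<bar>Im z\<bar>" if z: "z \<in> ball ?E r" "Im z \<noteq> 0" for z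
    proof -
      have "cmod (G z) \<le> norm f * norm (resolvent T z f)" unfolding G[OF z] by (rule cinner_Cauchy_Schwarz)
      also have "\<dots> \<le> norm f * (norm f / \<bar>Im z\<bar>)" by (intro mult_left_mono norm_resolvent_le z) simp
      finally show ?thesis by (simp add: power2_eq_square)
    qed
    have near: "cmod (G z) \<le> 4 * (norm f)\<^sup>2 / \<rho>" if "cmod (z - ?E) \<le> \<rho> / 2" for z
      by (rule strip_bound[OF holG \<rho> G_bd _ that]) simp_all
    \<comment> \<open>Cauchy's estimate on discs of radius \<rho>/4, which stay in the disc of
      radius \<rho>/2 where G is bounded.\<close>
    have lip: "cmod (G z - G w) \<le> 4 * (4 * (norm f)\<^sup>2 / \<rho>) / \<rho> * cmod (z - w)"
      if "z \<in> ball ?E (\<rho> / 4)" "w \<in> ball ?E (\<rho> / 4)" for z w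
    proof (rule field_differentiable_bound[OF convex_ball _ _ that])
      fix z assume z: "z \<in> ball ?E (\<rho> / 4)"
      then have zr: "z \<in> ball ?E r" using \<rho> by auto
      show "(G has_field_derivative deriv G z) (at z within ball ?E (\<rho> / 4))"
        by (rule has_field_derivative_at_within[OF holomorphic_derivI[OF holG open_ball zr]])
      have sub: "cball z (\<rho> / 4) \<subseteq> cball ?E (\<rho> / 2)"
      proof
        fix w assume "w \<in> cball z (\<rho> / 4)"
        then show "w \<in> cball ?E (\<rho> / 2)" using z dist_triangle[of ?E w z] by simp
      qed
      have sub': "cball ?E (\<rho> / 2) \<subseteq> ball ?E r" using \<rho> by auto
      have hc: "G holomorphic_on cball z (\<rho> / 4)" by (rule holomorphic_on_subset[OF holG order_trans[OF sub sub']])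
      have "cmod ((deriv ^^ 1) G z) \<le> fact 1 * (4 * (norm f)\<^sup>2 / \<rho>) / (\<rho> / 4) ^ 1"
      proof (rule Cauchy_inequality)
        show "G holomorphic_on ball z (\<rho> / 4)" using hc ball_subset_cball by (rule holomorphic_on_subset)
        show "continuous_on (cball z (\<rho> / 4)) G" using hc by (rule holomorphic_on_imp_continuous_on)
        fix w assume "cmod (z - w) = \<rho> / 4"
        then have "w \<in> cball z (\<rho> / 4)" by (simp add: dist_norm)
        then have "w \<in> cball ?E (\<rho> / 2)" using sub by blast
        then show "cmod (G w) \<le> 4 * (norm f)\<^sup>2 / \<rho>" by (intro near) (simp add: dist_norm norm_minus_commute)
      qed (use \<rho> in simp)
      then show "cmod (deriv G z) \<le> 4 * (4 * (norm f)\<^sup>2 / \<rho>) / \<rho>" by simp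
    qed
    define z where "z = Complex E \<eta>"
    have zE: "cmod (z - ?E) = \<eta>" "cmod (cnj z - ?E) = \<eta>" "cmod (z - cnj z) = 2 * \<eta>"
      using \<eta> by (simp_all add: z_def cmod_def real_sqrt_mult)
    have zb: "z \<in> ball ?E (\<rho> / 4)" "cnj z \<in> ball ?E (\<rho> / 4)"
      using \<eta> zE by (simp_all add: dist_norm norm_minus_commute)
    then have zr: "z \<in> ball ?E r" "cnj z \<in> ball ?E r" using \<rho> by auto
    have Imz: "Im z = \<eta>" "Im z \<noteq> 0" "Im (cnj z) \<noteq> 0" using \<eta> by (simp_all add: z_def)
    \<comment> \<open>Hence 2 |Im G(z)| is a difference of values at points 2 \<eta> apart.\<close>
    have "G (cnj z) = cnj (G z)"
      unfolding G[OF zr(1) Imz(2)] G[OF zr(2) Imz(3)]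
      using resolvent_adjoint[OF Imz(2), of f f] cinner_cnj by metis
    then have "2 * \<bar>Im (G z)\<bar> = cmod (G z - G (cnj z))" by (simp add: complex_diff_cnj norm_mult)
    also have "\<dots> \<le> 4 * (4 * (norm f)\<^sup>2 / \<rho>) / \<rho> * (2 * \<eta>)" using lip[OF zb] unfolding zE(3) .
    finally have "\<bar>Im (G z)\<bar> \<le> 4 * (4 * (norm f)\<^sup>2 / \<rho>) / \<rho> * \<eta>" by simp
    moreover have "Im (G z) = \<eta> * (norm (resolvent T z f))\<^sup>2"
      unfolding G[OF zr(1) Imz(2)] using Im_cinner_resolvent[OF Imz(2)] Imz(1) by simp
    ultimately have "\<eta> * (norm (resolvent T z f))\<^sup>2 \<le> \<eta> * (4 / \<rho> * norm f)\<^sup>2"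
      by (simp add: power2_eq_square mult_ac)
    then have "(norm (resolvent T z f))\<^sup>2 \<le> (4 / \<rho> * norm f)\<^sup>2" using \<eta>(1) by (simp only: mult_le_cancel_left_pos)
    then show ?thesis unfolding z_def by (rule power2_le_imp_le) (use \<rho> in simp)
  qed
  \<comment> \<open>The bound is extended from finite supports by density; the crude norm 1/\<eta>
    is harmless since the truncation error is chosen after \<eta>.\<close>
  have all: "norm (resolvent T (Complex E \<eta>) f) \<le> 4 / \<rho> * norm f" if \<eta>: "0 < \<eta>" "\<eta> < \<rho> / 4" for \<eta> f
  proof (rule field_le_epsilon)
    fix e :: real assume e: "0 < e"
    define c where "c = 1 / \<eta> + 4 / \<rho>"
    have c: "0 < c" using \<eta> \<rho> by (simp add: c_def add_pos_pos)
    have "0 < e / c" using e c by simp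
    then obtain A where A: "finite A" "norm (f - truncate A f) \<le> e / c" using truncate_approx by blast
    define t where "t = truncate A f"
    have nz: "Im (Complex E \<eta>) \<noteq> 0" using \<eta> by simp
    have "resolvent T (Complex E \<eta>) f = resolvent T (Complex E \<eta>) (f - t) + resolvent T (Complex E \<eta>) t"
      by (rule resolvent_eqI[OF nz]) (simp add: shift_add shift_resolvent[OF nz])
    then have "norm (resolvent T (Complex E \<eta>) f) \<le> norm (resolvent T (Complex E \<eta>) (f - t)) + norm (resolvent T (Complex E \<eta>) t)"
      by (metis norm_triangle_ineq)
    also have "\<dots> \<le> norm (f - t) / \<eta> + 4 / \<rho> * norm t"
      using norm_resolvent_le[OF nz, of "f - t"] fin[OF \<eta> t_def A(1)] \<eta>(1) by simp
    also have "\<dots> \<le> norm (f - t) / \<eta> + 4 / \<rho> * (norm f + norm (f - t))"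
      using norm_triangle_ineq4[of f "f - t"] \<rho> by (intro add_left_mono mult_left_mono) auto
    also have "\<dots> = 4 / \<rho> * norm f + c * norm (f - t)"
      by (simp add: c_def algebra_simps)
    also have "\<dots> \<le> 4 / \<rho> * norm f + c * (e / c)"
      using A(2) c unfolding t_def by (intro add_left_mono mult_left_mono) auto
    finally show "norm (resolvent T (Complex E \<eta>) f) \<le> 4 / \<rho> * norm f + e" using c \<rho> by simp
  qed
  show ?thesis
  proof (rule bounded_below_not_spectrum)
    show "0 < \<rho> / 8" using \<rho> by simp
    fix f :: "'x ell2"
    \<comment> \<open>With this \<eta> the shift from E + i \<eta> back to E costs only half of the
      norm of f.\<close>
    define \<eta> where "\<eta> = \<rho> / 8"
    have \<eta>: "0 < \<eta>" "\<eta> < \<rho> / 4" using \<rho> by (auto simp: \<eta>_def)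
    have nz: "Im (Complex E \<eta>) \<noteq> 0" using \<eta> by simp
    have "norm f \<le> 4 / \<rho> * norm (op_shift T (Complex E \<eta>) f)"
      using all[OF \<eta>, of "op_shift T (Complex E \<eta>) f"] unfolding resolvent_shift[OF nz] .
    also have "\<dots> \<le> 4 / \<rho> * (norm (op_shift T ?E f) + \<eta> * norm f)"
    proof (rule mult_left_mono)
      have "cmod (?E - Complex E \<eta>) = \<eta>" using \<eta> by (simp add: cmod_def)
      then show "norm (op_shift T (Complex E \<eta>) f) \<le> norm (op_shift T ?E f) + \<eta> * norm f"
        using norm_shift_le[of "Complex E \<eta>" f ?E] by simp
    qed (use \<rho> in simp)
    also have "\<dots> = 4 / \<rho> * norm (op_shift T ?E f) + norm f / 2"
      using \<rho> by (simp add: \<eta>_def distrib_left)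
    finally have "norm f / 2 \<le> 4 / \<rho> * norm (op_shift T ?E f)" by simp
    then have "\<rho> / 4 * (norm f / 2) \<le> \<rho> / 4 * (4 / \<rho> * norm (op_shift T ?E f))" using \<rho> by (intro mult_left_mono) auto
    then show "\<rho> / 8 * norm f \<le> norm (op_shift T ?E f)" using \<rho> by simp
  qed
qed

text \<open>The entries have at most simple poles at E. Not all residues vanish, since otherwise E
  would be regular, and a nonzero column of residues is an eigenvector.\<close>

lemma isolated_singularity_eigenvalue:
  fixes F :: "'x \<Rightarrow> 'x \<Rightarrow> complex \<Rightarrow> complex"
  assumes r: "0 < r" and hol: "\<And>x y. F x y holomorphic_on ball (complex_of_real E) r - {complex_of_real E}"
    and F: "\<And>x y z. z \<in> ball (complex_of_real E) r \<Longrightarrow> Im z \<noteq> 0 \<Longrightarrow>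
      F x y z = ell2_apply (resolvent T z (ell2_delta y)) x"
    and in_spectrum: "complex_of_real E \<in> spectrum T"
  shows "eigenvalue T (complex_of_real E)"
proof -
  let ?E = "complex_of_real E"
  have Fb: "cmod (F x y z) \<le> 1 / \<bar>Im z\<bar>" if "z \<in> ball ?E r" "Im z \<noteq> 0" for x y z
    unfolding F[OF that] by (rule cmod_resolvent_entry_le[OF that(2)])
  have Eint: "?E \<in> interior (ball ?E r)" using r by simp
  have "\<exists>g. g holomorphic_on ball ?E r \<and> (\<forall>z\<in>ball ?E r - {?E}. g z = (z - ?E) * F x y z)" for x y
  proof (rule holomorphic_on_extend_bounded[OF _ Eint, THEN iffD2])
    show "(\<lambda>z. (z - ?E) * F x y z) holomorphic_on ball ?E r - {?E}" by (intro holomorphic_intros hol)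
    have "\<forall>\<^sub>F z in at ?E. z \<in> ball ?E (r / 2) - {?E}" using r by (intro eventually_at_in_open) auto
    then have "\<forall>\<^sub>F z in at ?E. norm ((z - ?E) * F x y z) \<le> 10"
      by eventually_elim (use simple_pole_bound[OF hol Fb] in \<open>simp add: dist_norm norm_minus_commute\<close>)
    then show "\<exists>B. \<forall>\<^sub>F z in at ?E. norm ((z - ?E) * F x y z) \<le> B" by blast
  qed
  then have "\<forall>p. \<exists>g. g holomorphic_on ball ?E r \<and> (\<forall>z\<in>ball ?E r - {?E}. g z = (z - ?E) * F (fst p) (snd p) z)" by blast
  from choice[OF this] obtain g where
    "\<forall>p. g p holomorphic_on ball ?E r \<and> (\<forall>z\<in>ball ?E r - {?E}. g p z = (z - ?E) * F (fst p) (snd p) z)" by (rule exE)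
  then have g: "g (x, y) holomorphic_on ball ?E r" "z \<in> ball ?E r - {?E} \<Longrightarrow> g (x, y) z = (z - ?E) * F x y z" for x y z
    by auto
  have lim: "((\<lambda>z. (z - ?E) * F x y z) \<longlongrightarrow> g (x, y) ?E) (at ?E)" for x y
  proof -
    have "isCont (g (x, y)) ?E"
      using holomorphic_on_imp_continuous_on[OF g(1)] r by (simp add: continuous_on_eq_continuous_at)
    then have "(g (x, y) \<longlongrightarrow> g (x, y) ?E) (at ?E)" by (simp add: isCont_def)
    moreover have "\<forall>\<^sub>F z in at ?E. z \<in> ball ?E r - {?E}" using r by (intro eventually_at_in_open) auto
    then have "\<forall>\<^sub>F z in at ?E. g (x, y) z = (z - ?E) * F x y z" by eventually_elim (rule g(2))
    ultimately show ?thesis by (rule Lim_transform_eventually)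
  qed
  \<comment> \<open>If all residues vanished, the singularities would be removable and the entries
    holomorphic at E.\<close>
  have "\<exists>x y. g (x, y) ?E \<noteq> 0"
  proof (rule ccontr)
    assume no: "\<not> (\<exists>x y. g (x, y) ?E \<noteq> 0)"
    have "\<exists>h. h holomorphic_on ball ?E r \<and> (\<forall>z\<in>ball ?E r - {?E}. h z = F x y z)" for x y
      by (rule holomorphic_on_extend_lim[OF hol Eint, THEN iffD2]) (use lim[of x y] no in simp)
    then have "\<forall>p. \<exists>h. h holomorphic_on ball ?E r \<and> (\<forall>z\<in>ball ?E r - {?E}. h z = F (fst p) (snd p) z)" by blast
    from choice[OF this] obtain h where
      h: "\<forall>p. h p holomorphic_on ball ?E r \<and> (\<forall>z\<in>ball ?E r - {?E}. h p z = F (fst p) (snd p) z)" by (rule exE)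
    have "?E \<notin> spectrum T"
    proof (rule holomorphic_entries_not_spectrum[OF r, of "\<lambda>x y. h (x, y)"])
      show "h (x, y) holomorphic_on ball ?E r" for x y using h by blast
      show "h (x, y) z = ell2_apply (resolvent T z (ell2_delta y)) x" if z: "z \<in> ball ?E r" "Im z \<noteq> 0" for x y z
      proof -
        have "z \<noteq> ?E" using z(2) by auto
        then have "h (x, y) z = F x y z" using h[THEN spec, of "(x, y)"] z(1) by simp
        then show ?thesis using F[OF z] by simp
      qed
    qed
    then show False using in_spectrum by simp
  qed
  then obtain x0 y0 where nz: "g (x0, y0) ?E \<noteq> 0" by blast
  define zn where "zn n = Complex E (r / 2 / real (Suc n))" for n
  have Im_zn: "0 < Im (zn n)" for n using r by (simp add: zn_def)
  have zn_E: "zn n - ?E = \<i> * complex_of_real (Im (zn n))" for n by (simp add: zn_def complex_eq_iff)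
  have zn_ball: "zn n \<in> ball ?E r" for n
  proof -
    have "cmod (zn n - ?E) = Im (zn n)" unfolding zn_E norm_mult using Im_zn[of n] by simp
    also have "\<dots> = r / 2 / real (Suc n)" by (simp add: zn_def)
    also have "\<dots> \<le> r / 2 / 1" using r by (intro divide_left_mono) auto
    finally show ?thesis using r by (simp add: dist_norm norm_minus_commute)
  qed
  have zn_lim: "zn \<longlonglongrightarrow> ?E"
  proof -
    have "(\<lambda>n. Im (zn n)) \<longlonglongrightarrow> 0"
      unfolding zn_def complex.sel by (rule LIMSEQ_Suc[OF lim_const_over_n])
    then have "(\<lambda>n. ?E + \<i> * complex_of_real (Im (zn n))) \<longlonglongrightarrow> ?E + \<i> * complex_of_real 0" by (intro tendsto_intros)
    moreover have "?E + \<i> * complex_of_real (Im (zn n)) = zn n" for n unfolding zn_E[of n, symmetric] by simp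
    ultimately show ?thesis by simp
  qed
  have zn_at: "filterlim zn (at ?E) sequentially"
  proof -
    have "zn n \<noteq> ?E" for n using Im_zn[of n] by auto
    then show ?thesis using zn_lim by (simp add: filterlim_at)
  qed
  \<comment> \<open>The approximants of the residue column: norm at most 1 because zn approaches E
    vertically, hence a square-summable pointwise limit.\<close>
  define u where "u n = (zn n - ?E) *\<^sub>C resolvent T (zn n) (ell2_delta y0)" for n
  have u_pt: "(\<lambda>n. ell2_apply (u n) x) \<longlonglongrightarrow> g (x, y0) ?E" for x
  proof -
    have "(\<lambda>n. (zn n - ?E) * F x y0 (zn n)) \<longlonglongrightarrow> g (x, y0) ?E" by (rule filterlim_compose[OF lim zn_at])
    moreover have "(zn n - ?E) * F x y0 (zn n) = ell2_apply (u n) x" for n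
      using F[OF zn_ball, of n x y0] Im_zn[of n] by (simp add: u_def)
    ultimately show ?thesis by simp
  qed
  have u_norm: "norm (u n) \<le> 1" for n
  proof -
    have nzi: "Im (zn n) \<noteq> 0" using Im_zn[of n] by simp
    have "norm (u n) \<le> Im (zn n) * (1 / \<bar>Im (zn n)\<bar>)"
      unfolding u_def norm_scaleC zn_E
      using norm_resolvent_le[OF nzi, of "ell2_delta y0"] Im_zn[of n]
      by (intro mult_mono) (auto simp: norm_mult norm_ell2_delta)
    then show ?thesis using Im_zn[of n] by simp
  qed
  obtain e where e: "ell2_apply e = (\<lambda>x. g (x, y0) ?E)"
    using pointwise_limit_in_ell2[OF u_pt always_eventually, of 1] u_norm by blast
  have "T e = ?E *\<^sub>C e"
  proof (rule ell2_eqI)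
    fix x
    have "(\<lambda>n. ell2_apply (op_shift T ?E (u n)) x) \<longlonglongrightarrow> ell2_apply (op_shift T ?E e) x"
      by (rule shift_pointwise_limit) (simp add: e u_pt)
    \<comment> \<open>The resolvent equation multiplied by z - E; both terms on the right carry the
      factor z - E and vanish in the limit.\<close>
    moreover have "ell2_apply (op_shift T ?E (u n)) x = (zn n - ?E) * (ell2_apply (ell2_delta y0) x + ell2_apply (u n) x)" for n
    proof -
      have nzi: "Im (zn n) \<noteq> 0" using Im_zn[of n] by simp
      have "op_shift T (zn n) (u n) = (zn n - ?E) *\<^sub>C ell2_delta y0"
        unfolding u_def shift_scaleC by (simp add: shift_resolvent[OF nzi])
      then have "op_shift T ?E (u n) = (zn n - ?E) *\<^sub>C ell2_delta y0 + (zn n - ?E) *\<^sub>C u n"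
        using shift_diff_points[of "zn n" "u n" ?E] by (simp add: algebra_simps)
      then show ?thesis by (simp only: ell2_apply_simps(2,5) distrib_left)
    qed
    moreover have "(\<lambda>n. (zn n - ?E) * (ell2_apply (ell2_delta y0) x + ell2_apply (u n) x)) \<longlonglongrightarrow>
        (?E - ?E) * (ell2_apply (ell2_delta y0) x + g (x, y0) ?E)"
      by (intro tendsto_intros zn_lim u_pt)
    ultimately have "ell2_apply (op_shift T ?E e) x = 0" using LIMSEQ_unique by fastforce
    then show "ell2_apply (T e) x = ell2_apply (?E *\<^sub>C e) x" by (simp add: op_shift_def)
  qed
  moreover have "e \<noteq> 0"
  proof
    assume "e = 0"
    then have "ell2_apply e x0 = 0" by simp
    then show False using nz by (simp add: e)
  qed
  ultimately show ?thesis unfolding eigenvalue_def by blast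
qed

end

section \<open>Band structure\<close>

text \<open>Components of the bounded open set S - D have their endpoints in S, as S is closed, and
  outside S - D, hence in the finite set D. A point of S missed by the closed components is
  isolated.\<close>

lemma finite_band_structure:
  fixes S D :: "real set"
  assumes D: "finite D" and bd: "\<And>t. t \<in> S \<Longrightarrow> \<bar>t\<bar> \<le> B" and cl: "closed S" and op: "open (S - D)"
  shows "\<exists>J. finite J \<and> (\<forall>(x, y)\<in>J. x < y) \<and> S = (\<Union>(x, y)\<in>J. {x..y}) \<union>
    {E \<in> D \<inter> S. \<exists>r>0. \<forall>E'. E' \<noteq> E \<longrightarrow> \<bar>E' - E\<bar> < r \<longrightarrow> E' \<notin> S}"
proof -
  \<comment> \<open>All pairs from D with the gap inside S; intervals may overlap, which does not
    affect the union.\<close>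
  define J where "J = {(x, y) \<in> D \<times> D. x < y \<and> {x<..<y} \<subseteq> S}"
  define U where "U = (\<Union>(x, y)\<in>J. {x..y})"
  define I where "I = {E \<in> D \<inter> S. \<exists>r>0. \<forall>E'. E' \<noteq> E \<longrightarrow> \<bar>E' - E\<bar> < r \<longrightarrow> E' \<notin> S}"
  have finJ: "finite J" unfolding J_def by (rule finite_subset[of _ "D \<times> D"]) (use D in auto)
  have clU: "closed U" unfolding U_def by (intro closed_UN finJ ballI) (auto simp: case_prod_unfold)
  have clC: "closed (- (S - D))" using op by (simp only: closed_Compl)
  have OU: "S - D \<subseteq> U"
  proof
    fix E assume E: "E \<in> S - D"
    have bound: "t \<notin> S - D" if "B < \<bar>t\<bar>" for t using bd[of t] that by auto
    \<comment> \<open>The least point of Y is the right end of the component of E in S - D.\<close>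
    define Y where "Y = {E..} \<inter> - (S - D)"
    have Y: "closed Y" "Y \<noteq> {}" "bdd_below Y"
    proof -
      show "closed Y" unfolding Y_def by (intro closed_Int clC closed_atLeast)
      have "max E (\<bar>B\<bar> + 1) \<in> Y" unfolding Y_def using bound by auto
      then show "Y \<noteq> {}" by blast
      show "bdd_below Y" unfolding Y_def by (intro bdd_belowI[of _ E]) auto
    qed
    define y where "y = Inf Y"
    have yY: "y \<in> Y" unfolding y_def by (rule closed_contains_Inf[OF Y(2,3,1)])
    have Ey: "E < y" using yY E unfolding Y_def by (metis ComplD IntD1 IntD2 atLeast_iff order_le_less)
    have right: "t \<in> S - D" if "E \<le> t" "t < y" for t
    proof (rule ccontr)
      assume "t \<notin> S - D"
      then have "t \<in> Y" using that by (simp add: Y_def)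
      then have "y \<le> t" unfolding y_def by (rule cInf_lower[OF _ Y(3)])
      then show False using that by simp
    qed
    define X where "X = {..E} \<inter> - (S - D)"
    have X: "closed X" "X \<noteq> {}" "bdd_above X"
    proof -
      show "closed X" unfolding X_def by (intro closed_Int clC closed_atMost)
      have "min E (- \<bar>B\<bar> - 1) \<in> X" unfolding X_def using bound by auto
      then show "X \<noteq> {}" by blast
      show "bdd_above X" unfolding X_def by (intro bdd_aboveI[of _ E]) auto
    qed
    define x where "x = Sup X"
    have xX: "x \<in> X" unfolding x_def by (rule closed_contains_Sup[OF X(2,3,1)])
    have xE: "x < E" using xX E unfolding X_def by (metis ComplD IntD1 IntD2 atMost_iff order_le_less)
    have left: "t \<in> S - D" if "t \<le> E" "x < t" for t
    proof (rule ccontr)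
      assume "t \<notin> S - D"
      then have "t \<in> X" using that by (simp add: X_def)
      then have "t \<le> x" unfolding x_def by (rule cSup_upper[OF _ X(3)])
      then show False using that by simp
    qed
    have sub: "{x<..<y} \<subseteq> S - D"
    proof
      fix t assume "t \<in> {x<..<y}"
      then show "t \<in> S - D" using left[of t] right[of t] by (cases "t \<le> E") auto
    qed
    have "closure {x<..<y} \<subseteq> S" using sub cl by (intro closure_minimal) auto
    then have "{x..y} \<subseteq> S" using xE Ey by (simp add: closure_greaterThanLessThan)
    then have "x \<in> S" "y \<in> S" using xE Ey by auto
    then have "x \<in> D" "y \<in> D" using xX yY unfolding X_def Y_def by auto
    then have "(x, y) \<in> J" unfolding J_def using xE Ey sub by auto
    then show "E \<in> U" unfolding U_def using xE Ey by (intro UN_I[of "(x, y)"]) auto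
  qed
  have "S = U \<union> I"
  proof
    show "U \<union> I \<subseteq> S"
    proof -
      have "{x..y} \<subseteq> S" if "(x, y) \<in> J" for x y
      proof -
        have "closure {x<..<y} \<subseteq> S" using that cl unfolding J_def by (intro closure_minimal) auto
        then show ?thesis using that unfolding J_def by (simp add: closure_greaterThanLessThan)
      qed
      then show ?thesis unfolding U_def I_def by blast
    qed
    show "S \<subseteq> U \<union> I"
    proof
      fix E assume E: "E \<in> S"
      show "E \<in> U \<union> I"
      proof (cases "E \<in> D")
        case False
        then show ?thesis using OU E by blast
      next
        case True
        show ?thesis
        proof (cases "E \<in> I")
          case no: False
          have "E \<in> closure U"
            unfolding closure_approachable
          proof (intro allI impI)
            fix e :: real assume e: "0 < e"
            obtain d where d: "0 < d" "\<forall>x\<in>D. x \<noteq> E \<longrightarrow> d \<le> dist E x" using finite_set_avoid[OF D] by blast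
            have "0 < min e d" using e d by simp
            then obtain E' where E': "E' \<noteq> E" "\<bar>E' - E\<bar> < min e d" "E' \<in> S" using no True E unfolding I_def by blast
            \<comment> \<open>The distance d keeps other points of D away, so a nearby point of S
              lies in S - D and thus in U.\<close>
            have "E' \<notin> D" using d(2) E' by (auto simp: dist_real_def abs_minus_commute)
            then have "E' \<in> U" using OU E' by blast
            then show "\<exists>y\<in>U. dist y E < e" using E' by (intro bexI[of _ E']) (auto simp: dist_real_def)
          qed
          then show ?thesis using clU by (simp add: closure_closed)
        qed blast
      qed
    qed
  qed
  then show ?thesis unfolding U_def I_def using finJ by (intro exI[of _ J]) (auto simp: J_def)
qed

text \<open>The real power is dominated by an integer one, for which the ratio test applies.\<close>

lemma summable_powr_geometric:
  fixes \<rho> c :: real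
  assumes \<rho>: "0 < \<rho>" "\<rho> < 1"
  shows "summable (\<lambda>n. real n powr c * \<rho> ^ n)"
proof -
  obtain M :: nat where M: "c \<le> real M" using real_arch_simple by blast
  have "summable (\<lambda>n. real n ^ Suc M * \<rho> ^ n)"
  proof -
    have "(\<lambda>n. (real (Suc n) / real n) ^ Suc M * \<rho>) \<longlonglongrightarrow> 1 ^ Suc M * \<rho>"
      by (intro tendsto_mult tendsto_power tendsto_const LIMSEQ_Suc_n_over_n)
    then have "\<forall>\<^sub>F n in sequentially. (real (Suc n) / real n) ^ Suc M * \<rho> < (1 + \<rho>) / 2"
      by (rule order_tendstoD) (use \<rho> in simp)
    then obtain N where N: "\<And>n. n \<ge> N \<Longrightarrow> (real (Suc n) / real n) ^ Suc M * \<rho> < (1 + \<rho>) / 2"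
      unfolding eventually_sequentially by blast
    show ?thesis
    proof (rule summable_ratio_test)
      show "(1 + \<rho>) / 2 < 1" using \<rho> by simp
      fix n assume n: "max 1 N \<le> n"
      then have n0: "0 < real n" by simp
      have "real (Suc n) ^ Suc M * \<rho> ^ Suc n = ((real (Suc n) / real n) ^ Suc M * \<rho>) * (real n ^ Suc M * \<rho> ^ n)"
      proof -
        have "real (Suc n) = real (Suc n) / real n * real n" using n0 by simp
        then have "real (Suc n) ^ Suc M = (real (Suc n) / real n) ^ Suc M * real n ^ Suc M" by (metis power_mult_distrib)
        then show ?thesis by (simp only: power_Suc[of \<rho> n] mult_ac)
      qed
      also have "\<dots> \<le> (1 + \<rho>) / 2 * (real n ^ Suc M * \<rho> ^ n)"
        using N[of n] n \<rho> by (intro mult_right_mono) auto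
      finally show "norm (real (Suc n) ^ Suc M * \<rho> ^ Suc n) \<le> (1 + \<rho>) / 2 * norm (real n ^ Suc M * \<rho> ^ n)"
        using \<rho> by (simp only: real_norm_def abs_of_nonneg mult_nonneg_nonneg zero_le_power of_nat_0_le_iff less_imp_le)
    qed
  qed
  then show ?thesis
  proof (rule summable_comparison_test')
    show "norm (real n powr c * \<rho> ^ n) \<le> real n ^ Suc M * \<rho> ^ n" if "0 \<le> n" for n
    proof (cases "n = 0")
      case False
      then have n1: "1 \<le> real n" by simp
      have "real n powr c \<le> real n powr real (Suc M)" using M n1 by (intro powr_mono) auto
      also have "\<dots> = real n ^ Suc M" using n1 by (subst powr_realpow) auto
      finally show ?thesis using \<rho> by (simp add: abs_mult mult_right_mono)
    qed simp
  qed
qed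

section \<open>Exponential decay along non-backtracking walks\<close>

context weighted_graph
begin

lemma inverse_one: "inverse (1 :: 'd free_group) = 1"
  using free_group_left_inverse[of 1] by simp

context
  fixes \<zeta> :: "('d \<times> bool) + 'r \<Rightarrow> complex" and z :: complex and c C wmin :: real and N :: nat
  assumes dg: "dart_graph src tgt dart_rev"
    and unb: "dart_graph.unbranched src tgt dart_rev N = {}"
    and eq: "green_eq gw z \<zeta>" and z: "0 \<le> Im z" and c: "0 < c" "\<And>k. c \<le> Im (\<zeta> k)" and C: "\<And>k. cmod (\<zeta> k) \<le> C"
    and wmin: "0 < wmin" "\<And>q. wmin \<le> (cmod (wt q))\<^sup>2"
begin

interpretation dg: dart_graph src tgt dart_rev by (rule dg)

lemma zeta_Im_pos: "0 < Im (\<zeta> k)"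
  using c(1) c(2)[of k] by linarith

lemma zeta_bounds: "Im (\<zeta> k) \<le> C" "c \<le> cmod (\<zeta> k)" "0 < C"
proof -
  show "Im (\<zeta> k) \<le> C" using abs_Im_le_cmod[of "\<zeta> k"] C[of k] by linarith
  show "c \<le> cmod (\<zeta> k)" using abs_Im_le_cmod[of "\<zeta> k"] c(2)[of k] by linarith
  then show "0 < C" using c(1) C[of k] by linarith
qed

text \<open>The quotient bounds below the share of the energy that any allowed successor receives;
  the cap 1/2 keeps \<open>theta\<close> away from 0, as it is divided by later.\<close>

definition theta :: real where "theta = 1 - min (1 / 2) (wmin * c * c\<^sup>2 / C)"

lemma theta_bounds: "1 / 2 \<le> theta" "theta < 1"
proof -
  have "0 < wmin * c * c\<^sup>2 / C" using wmin(1) c(1) zeta_bounds(3) by simp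
  then show "theta < 1" by (simp add: theta_def)
  show "1 / 2 \<le> theta"
    unfolding theta_def using min.cobounded1[of "1 / 2" "wmin * c * c\<^sup>2 / C"] by linarith
qed

lemma energy_mono: "energy \<zeta> i (q # w) \<le> energy \<zeta> i w"
proof -
  have "energy \<zeta> i (q # w) \<le> (\<Sum>q\<in>UNIV. energy \<zeta> i (q # w))"
    by (rule member_le_sum) (auto intro: energy_nonneg[OF eq zeta_Im_pos])
  also have "\<dots> \<le> energy \<zeta> i w" unfolding energy_successors[OF eq zeta_Im_pos] using z by simp
  finally show ?thesis .
qed

lemma energy_append: "energy \<zeta> i (v @ w) \<le> energy \<zeta> i w"
proof (induction v)
  case (Cons q v)
  then show ?case using energy_mono[of i q "v @ w"] by simp
qed simp

text \<open>A successor receives at least |psi|^2 wmin c, while the word itself has at most |psi|^2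
  C / c^2.\<close>

lemma energy_lower:
  assumes "allowed (state i w) q" shows "(1 - theta) * energy \<zeta> i w \<le> energy \<zeta> i (q # w)"
proof -
  let ?k = "state i w"
  have "Im (\<zeta> ?k) / (cmod (\<zeta> ?k))\<^sup>2 \<le> C / c\<^sup>2"
    using zeta_bounds(1)[of ?k] zeta_bounds(2)[of ?k] zeta_bounds(3) c(1) zeta_Im_pos[of ?k] by (intro frac_le power_mono) auto
  then have "energy \<zeta> i w \<le> (cmod (psi \<zeta> i w))\<^sup>2 * (C / c\<^sup>2)" unfolding energy_def by (intro mult_left_mono) auto
  then have "wmin * c * c\<^sup>2 / C * energy \<zeta> i w \<le> wmin * c * c\<^sup>2 / C * ((cmod (psi \<zeta> i w))\<^sup>2 * (C / c\<^sup>2))"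
    using wmin(1) c(1) zeta_bounds(3) by (intro mult_left_mono) auto
  also have "\<dots> = (cmod (psi \<zeta> i w))\<^sup>2 * (wmin * c)" using c(1) zeta_bounds(3) by simp
  also have "\<dots> \<le> (cmod (psi \<zeta> i w))\<^sup>2 * ((cmod (wt q))\<^sup>2 * Im (\<zeta> (Inl q)))"
    using wmin c by (intro mult_left_mono mult_mono) (auto intro: less_imp_le)
  also have "\<dots> = energy \<zeta> i (q # w)" unfolding energy_Cons[OF eq zeta_Im_pos] using assms by simp
  finally have "wmin * c * c\<^sup>2 / C * energy \<zeta> i w \<le> energy \<zeta> i (q # w)" .
  moreover have "(1 - theta) * energy \<zeta> i w \<le> wmin * c * c\<^sup>2 / C * energy \<zeta> i w"
    unfolding theta_def using energy_nonneg[OF eq zeta_Im_pos] by (intro mult_right_mono) auto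
  ultimately show ?thesis by linarith
qed

text \<open>A competing successor takes its share, so what is left for q is at most the fraction
  \<open>theta\<close>.\<close>

lemma energy_branch:
  assumes q': "allowed (state i w) q'" "q' \<noteq> q" shows "energy \<zeta> i (q # w) \<le> theta * energy \<zeta> i w"
proof -
  have "energy \<zeta> i (q # w) + energy \<zeta> i (q' # w) = (\<Sum>p\<in>{q, q'}. energy \<zeta> i (p # w))" using q'(2) by simp
  also have "\<dots> \<le> (\<Sum>p\<in>UNIV. energy \<zeta> i (p # w))"
    by (rule sum_mono2) (auto intro: energy_nonneg[OF eq zeta_Im_pos])
  also have "\<dots> \<le> energy \<zeta> i w" unfolding energy_successors[OF eq zeta_Im_pos] using z by simp
  finally show ?thesis using energy_lower[OF q'(1)] by (simp add: algebra_simps)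
qed

lemma energy_not_allowed: "\<not> allowed (state i w) q \<Longrightarrow> energy \<zeta> i (q # w) = 0"
  unfolding energy_Cons[OF eq zeta_Im_pos] by simp

lemma allowed_iff_follows: "allowed (Inl p) q \<longleftrightarrow> dg.follows p q"
  by (simp add: dg.follows_def)

text \<open>Among the next n steps either one is not allowed, which gives energy 0, or a branching
  occurs, which costs the factor \<open>theta\<close>; energy never increases at the other
  steps.\<close>

lemma energy_block:
  assumes "p \<notin> dg.unbranched n" "state i w = Inl p" "length v = n"
  shows "energy \<zeta> i (v @ w) \<le> theta * energy \<zeta> i w"
  using assms
proof (induction n arbitrary: p w v)
  case (Suc n)
  \<comment> \<open>The last element of v is the first step after w.\<close>
  obtain v' q where v: "v = v' @ [q]" using Suc.prems(3) by (cases v rule: rev_cases) auto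
  have mono: "energy \<zeta> i (v @ w) \<le> energy \<zeta> i (q # w)" unfolding v using energy_append[of i v' "q # w"] by simp
  have nn: "0 \<le> theta * energy \<zeta> i w" using theta_bounds energy_nonneg[OF eq zeta_Im_pos, of i w] by (intro mult_nonneg_nonneg) auto
  show ?case
  proof (cases "dg.follows p q")
    case False
    then have "energy \<zeta> i (q # w) = 0" using Suc.prems(2) by (intro energy_not_allowed) (simp only: allowed_iff_follows not_False_eq_True)
    then show ?thesis using mono nn by linarith
  next
    case True
    show ?thesis
    proof (cases "\<exists>q'. dg.follows p q' \<and> q' \<noteq> q")
      case branch: True
      then obtain q' where "dg.follows p q'" "q' \<noteq> q" by blast
      then have "energy \<zeta> i (q # w) \<le> theta * energy \<zeta> i w"
        using Suc.prems(2) by (intro energy_branch[of i w q']) (simp_all only: allowed_iff_follows not_False_eq_True)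
      then show ?thesis using mono by linarith
    next
      case no: False
      then have uniq: "q' = q" if "dg.follows p q'" for q' using that by blast
      have "q \<notin> dg.unbranched n"
      proof
        assume mem: "q \<in> dg.unbranched n"
        have "p \<in> dg.unbranched (Suc n)"
          unfolding dg.unbranched_Suc_iff
        proof (intro conjI allI impI)
          show "\<exists>!q. dg.follows p q" by (rule ex1I[of _ q]) (use True uniq in blast)+
          show "q' \<in> dg.unbranched n" if "dg.follows p q'" for q' using uniq[OF that] mem by simp
        qed
        then show False using Suc.prems(1) by contradiction
      qed
      then have "energy \<zeta> i (v' @ q # w) \<le> theta * energy \<zeta> i (q # w)"
        using Suc.prems(3) v by (intro Suc.IH[of q]) simp_all
      also have "\<dots> \<le> theta * energy \<zeta> i w" using theta_bounds by (intro mult_left_mono energy_mono) auto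
      finally show ?thesis by (simp add: v)
    qed
  qed
qed simp

lemma N_pos: "0 < N"
  using unb by (cases N) auto

text \<open>A factor \<open>theta\<close> per block of N steps, spread evenly over the
  steps.\<close>

definition rho :: real where "rho = root N theta"

lemma rho_bounds: "0 < rho" "rho < 1" "rho ^ N = theta"
proof -
  show "0 < rho" unfolding rho_def using theta_bounds N_pos by (intro real_root_gt_zero) auto
  show "rho < 1" unfolding rho_def using theta_bounds N_pos by (simp add: real_root_lt_1_iff)
  show "rho ^ N = theta" unfolding rho_def using theta_bounds N_pos by (intro real_root_pow_pos2) auto
qed

lemma energy_decay: "energy \<zeta> i w \<le> C / theta\<^sup>2 * rho ^ length w"
proof (induction "length w" arbitrary: w rule: less_induct)
  case less
  show ?case
  proof (cases "length w \<le> N")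
    case True
    have "energy \<zeta> i (w @ []) \<le> energy \<zeta> i []" by (rule energy_append)
    also have "energy \<zeta> i [] = Im (\<zeta> (Inr i))"
      using zeta_nonzero[OF eq zeta_Im_pos, of "Inr i"] by (simp add: energy_def)
    also have "\<dots> \<le> C" by (rule zeta_bounds)
    \<comment> \<open>Words of length at most N have energy at most C, and \<open>theta\<close> =
      rho^N is at most rho to their length; the constant absorbs this.\<close>
    also have "C = C / theta\<^sup>2 * theta\<^sup>2" using theta_bounds by simp
    also have "\<dots> \<le> C / theta\<^sup>2 * rho ^ length w"
    proof (rule mult_left_mono)
      have "theta\<^sup>2 \<le> theta" using theta_bounds by (simp add: power2_eq_square mult_left_le_one_le)
      also have "\<dots> \<le> rho ^ length w" unfolding rho_bounds(3)[symmetric] using rho_bounds True by (intro power_decreasing) auto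
      finally show "theta\<^sup>2 \<le> rho ^ length w" .
    qed (use zeta_bounds(3) in simp)
    finally show ?thesis by simp
  next
    case False
    define v w' where "v = take N w" and "w' = drop N w"
    have w: "w = v @ w'" "length v = N" "length w' < length w" "w' \<noteq> []" "length w = length w' + N"
      unfolding v_def w'_def using False N_pos by auto
    obtain p u where p: "w' = p # u" using w(4) by (cases w') auto
    \<comment> \<open>The remaining word w' is nonempty, so its state is a dart and the branching
      result applies.\<close>
    have "energy \<zeta> i w \<le> theta * energy \<zeta> i w'"
      unfolding w(1) by (rule energy_block[of p N]) (use unb p w(2) in simp_all)
    also have "\<dots> \<le> theta * (C / theta\<^sup>2 * rho ^ length w')"
      using less[OF w(3)] theta_bounds by (intro mult_left_mono) auto
    also have "\<dots> = C / theta\<^sup>2 * rho ^ length w" unfolding w(5) power_add rho_bounds(3) by simp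
    finally show ?thesis .
  qed
qed

text \<open>As |psi|^2 is at most C^2/c times the energy, the fourth power is bounded by the product
  of the largest energy on the level, which decays, and the total energy, at most C.\<close>

lemma psi_fourth_power_sum:
  "(\<Sum>w\<in>words n. (cmod (psi \<zeta> i w)) ^ 4) \<le> (C\<^sup>2 / c)\<^sup>2 * (C / theta\<^sup>2) * C * rho ^ n"
proof -
  have psi_energy: "(cmod (psi \<zeta> i w))\<^sup>2 \<le> C\<^sup>2 / c * energy \<zeta> i w" for w
  proof -
    let ?k = "state i w"
    have "1 \<le> C\<^sup>2 / c * (Im (\<zeta> ?k) / (cmod (\<zeta> ?k))\<^sup>2)"
    proof -
      have "(cmod (\<zeta> ?k))\<^sup>2 * c \<le> C\<^sup>2 * Im (\<zeta> ?k)" using C c zeta_bounds by (intro mult_mono power_mono) auto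
      moreover have "0 < (cmod (\<zeta> ?k))\<^sup>2 * c" using zeta_nonzero[OF eq zeta_Im_pos, of ?k] c(1) by simp
      ultimately show ?thesis by (simp add: mult.commute)
    qed
    then have "(cmod (psi \<zeta> i w))\<^sup>2 * 1 \<le> (cmod (psi \<zeta> i w))\<^sup>2 * (C\<^sup>2 / c * (Im (\<zeta> ?k) / (cmod (\<zeta> ?k))\<^sup>2))"
      by (intro mult_left_mono) auto
    then show ?thesis by (simp add: energy_def mult_ac)
  qed
  have "(\<Sum>w\<in>words n. (cmod (psi \<zeta> i w)) ^ 4) \<le> (\<Sum>w\<in>words n. (C\<^sup>2 / c)\<^sup>2 * (C / theta\<^sup>2 * rho ^ n) * energy \<zeta> i w)"
  proof (rule sum_mono)
    fix w assume w: "w \<in> words n"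
    have e0: "0 \<le> energy \<zeta> i w" by (rule energy_nonneg[OF eq zeta_Im_pos])
    have "(cmod (psi \<zeta> i w)) ^ 4 = ((cmod (psi \<zeta> i w))\<^sup>2)\<^sup>2" by simp
    also have "\<dots> \<le> (C\<^sup>2 / c * energy \<zeta> i w)\<^sup>2" by (intro power_mono psi_energy) simp
    also have "\<dots> = (C\<^sup>2 / c)\<^sup>2 * (energy \<zeta> i w * energy \<zeta> i w)" by (simp only: power_mult_distrib power2_eq_square[of "energy \<zeta> i w"])
    also have "\<dots> \<le> (C\<^sup>2 / c)\<^sup>2 * (C / theta\<^sup>2 * rho ^ n * energy \<zeta> i w)"
      using energy_decay[of i w] w e0 by (intro mult_left_mono mult_right_mono) auto
    finally show "(cmod (psi \<zeta> i w)) ^ 4 \<le> (C\<^sup>2 / c)\<^sup>2 * (C / theta\<^sup>2 * rho ^ n) * energy \<zeta> i w" by (simp only: mult.assoc)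
  qed
  also have "\<dots> = (C\<^sup>2 / c)\<^sup>2 * (C / theta\<^sup>2 * rho ^ n) * (\<Sum>w\<in>words n. energy \<zeta> i w)" by (simp only: sum_distrib_left)
  also have "\<dots> \<le> (C\<^sup>2 / c)\<^sup>2 * (C / theta\<^sup>2 * rho ^ n) * C"
  proof (rule mult_left_mono)
    have "(\<Sum>w\<in>words n. energy \<zeta> i w) \<le> Im (\<zeta> (Inr i))"
      unfolding energy_level[OF eq zeta_Im_pos] using z by (simp add: sum_nonneg)
    also have "\<dots> \<le> C" by (rule zeta_bounds)
    finally show "(\<Sum>w\<in>words n. energy \<zeta> i w) \<le> C" .
  qed (use zeta_bounds(3) rho_bounds in simp)
  finally show ?thesis by (simp only: mult_ac)
qed

end

end

section \<open>The resolvent blocks\<close>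

lemma hs_norm_sq: "(hs_norm A)\<^sup>2 = (\<Sum>i\<in>UNIV. \<Sum>j\<in>UNIV. (cmod (A $ i $ j))\<^sup>2)"
proof -
  have "trace (A ** conj_transpose A) = (\<Sum>i\<in>UNIV. \<Sum>j\<in>UNIV. complex_of_real ((cmod (A $ i $ j))\<^sup>2))"
    by (simp only: trace_def matrix_matrix_mult_def conj_transpose_def vec_lambda_beta complex_norm_square)
  then have "Re (trace (A ** conj_transpose A)) = (\<Sum>i\<in>UNIV. \<Sum>j\<in>UNIV. (cmod (A $ i $ j))\<^sup>2)"
    by (simp only: Re_sum Re_complex_of_real)
  then show ?thesis unfolding hs_norm_def by (simp add: sum_nonneg)
qed

context green_graph
begin

lemma green_value_upper: "z \<in> upper \<Longrightarrow> green_value z = (\<lambda>k. \<zeta> k z)"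
  by (simp add: green_value_def fun_eq_iff)

lemma green_value_cnj: "z \<in> upper \<Longrightarrow> green_value (cnj z) = (\<lambda>k. cnj (\<zeta> k z))"
  by (simp add: green_value_def fun_eq_iff)

lemma block_Im_resolvent_entry:
  assumes z: "z \<in> upper"
  shows "block (Im_resolvent (graph_poly H a) z) 1 g $ i $ j =
    1 / (2 * \<i>) * (ell2_apply (resolvent T z (ell2_delta (j, g))) (i, 1) - ell2_apply (resolvent T (cnj z) (ell2_delta (j, g))) (i, 1))"
proof -
  have "Im z \<noteq> 0" using z by simp
  then show ?thesis by (simp add: block_def cinner_delta_left op_Im_def op_adjoint_resolvent)
qed

lemma green_column_diagonal: "green_column v i 1 (i, 1) = v (Inr i)"
  by (simp add: green_column_def inverse_one normal_form_1)

lemma trace_block_Im_resolvent: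
  assumes z: "z \<in> upper"
  shows "Re (trace (block (Im_resolvent (graph_poly H a) z) 1 1)) = (\<Sum>i\<in>UNIV. Im (\<zeta> (Inr i) z))"
proof -
  have nz: "Im z \<noteq> 0" "Im (cnj z) \<noteq> 0" using z by simp_all
  have "block (Im_resolvent (graph_poly H a) z) 1 1 $ i $ i = complex_of_real (Im (\<zeta> (Inr i) z))" for i
    unfolding block_Im_resolvent_entry[OF z] resolvent_delta[OF nz(1)] resolvent_delta[OF nz(2)]
      green_value_upper[OF z] green_value_cnj[OF z] green_column_diagonal
    by (simp add: complex_diff_cnj complex_eq_iff)
  then show ?thesis by (simp add: trace_def)
qed

text \<open>Taking adjoints moves the basis vector at the unit to the right, so every block is read
  off from the columns rooted at the unit. Both resolvents have entries of the same modulus, and the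
  factor 2 cancels the denominator 2 i.\<close>

lemma cmod_block_entry_le:
  assumes z: "z \<in> upper"
  shows "cmod (block (Im_resolvent (graph_poly H a) z) 1 g $ i $ j) \<le> cmod (green_column (\<lambda>k. \<zeta> k z) i 1 (j, g))"
proof -
  have nz: "Im z \<noteq> 0" "Im (cnj z) \<noteq> 0" using z by simp_all
  have swap: "ell2_apply (resolvent T v (ell2_delta y)) x = cnj (ell2_apply (resolvent T (cnj v) (ell2_delta x)) y)"
    if "Im v \<noteq> 0" for v x y
    using resolvent_adjoint[OF that, of "ell2_delta x" "ell2_delta y"] by (simp only: cinner_delta_left cinner_delta_right)
  have 1: "cmod (ell2_apply (resolvent T z (ell2_delta (j, g))) (i, 1)) = cmod (green_column (\<lambda>k. \<zeta> k z) i 1 (j, g))"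
    unfolding swap[OF nz(1)] resolvent_delta[OF nz(2)] green_value_cnj[OF z] by (simp add: cmod_column_cnj)
  have 2: "cmod (ell2_apply (resolvent T (cnj z) (ell2_delta (j, g))) (i, 1)) = cmod (green_column (\<lambda>k. \<zeta> k z) i 1 (j, g))"
    unfolding swap[OF nz(2)] complex_cnj_cnj resolvent_delta[OF nz(1)] green_value_upper[OF z] by simp
  have "cmod (ell2_apply (resolvent T z (ell2_delta (j, g))) (i, 1) - ell2_apply (resolvent T (cnj z) (ell2_delta (j, g))) (i, 1))
    \<le> 2 * cmod (green_column (\<lambda>k. \<zeta> k z) i 1 (j, g))"
    by (rule order_trans[OF norm_triangle_ineq4]) (simp only: 1 2)
  then show ?thesis unfolding block_Im_resolvent_entry[OF z] by (simp add: norm_mult norm_divide)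
qed

text \<open>In each column rooted at the unit only the row of the endpoint contributes, so the
  squared norm is at most a sum over starting vertices; squaring it costs the factor CARD by
  Cauchy-Schwarz.\<close>

lemma hs_norm_block_fourth:
  assumes z: "z \<in> upper"
  shows "hs_norm (block (Im_resolvent (graph_poly H a) z) 1 g) ^ 4 \<le>
    real CARD('a) * (\<Sum>i\<in>UNIV. cmod (psi (\<lambda>k. \<zeta> k z) i (normal_form g)) ^ 4)"
proof -
  let ?w = "normal_form g" and ?v = "\<lambda>k. \<zeta> k z"
  have col: "(\<Sum>j\<in>UNIV. (cmod (green_column ?v i 1 (j, g)))\<^sup>2) = (cmod (psi ?v i ?w))\<^sup>2" for i
  proof -
    have "(\<Sum>j\<in>UNIV. (cmod (green_column ?v i 1 (j, g)))\<^sup>2) = (\<Sum>j\<in>UNIV. if j = endpoint i ?w then (cmod (psi ?v i ?w))\<^sup>2 else 0)"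
      by (intro sum.cong) (auto simp: green_column_def inverse_one)
    then show ?thesis by simp
  qed
  have "(hs_norm (block (Im_resolvent (graph_poly H a) z) 1 g))\<^sup>2 \<le> (\<Sum>i\<in>UNIV. \<Sum>j\<in>UNIV. (cmod (green_column ?v i 1 (j, g)))\<^sup>2)"
    unfolding hs_norm_sq by (intro sum_mono power_mono cmod_block_entry_le z) simp
  then have le: "(hs_norm (block (Im_resolvent (graph_poly H a) z) 1 g))\<^sup>2 \<le> (\<Sum>i\<in>UNIV. (cmod (psi ?v i ?w))\<^sup>2)"
    unfolding col .
  have "hs_norm (block (Im_resolvent (graph_poly H a) z) 1 g) ^ 4 = ((hs_norm (block (Im_resolvent (graph_poly H a) z) 1 g))\<^sup>2)\<^sup>2" by simp
  also have "\<dots> \<le> (\<Sum>i\<in>UNIV. (cmod (psi ?v i ?w))\<^sup>2)\<^sup>2" by (rule power_mono[OF le]) simp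
  also have "\<dots> \<le> (\<Sum>i\<in>UNIV. ((cmod (psi ?v i ?w))\<^sup>2)\<^sup>2) * real CARD('a)" by (rule sum_squared_le_sum_of_squares)
  finally show ?thesis by (simp add: mult.commute)
qed

end

section \<open>Bands of positive boundary values\<close>

text \<open>Closedness under successors gives all darts because H is not a cycle. The converse
  direction of the equivalence then brings in the vertex states, all of whose successors are
  darts.\<close>

lemma (in weighted_graph) gw_irreducible:
  assumes dg: "dart_graph src tgt dart_rev" and nc: "\<not> is_orbit_cycle src tgt dart_rev"
    and a: "\<And>i. a i \<noteq> 0" and X: "X \<noteq> {}" and iff: "\<And>k. k \<in> X \<longleftrightarrow> (\<forall>l. 0 < gw k l \<longrightarrow> l \<in> X)"
  shows "X = UNIV"
proof -
  interpret dg: dart_graph src tgt dart_rev by (rule dg)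
  have gw_pos: "0 < gw k (Inl q) \<longleftrightarrow> allowed k q" "\<not> 0 < gw k (Inr i)" for k q i
    using a[of "fst q"] by (auto simp: gw_def dart_weight_def)
  have step: "Inl q \<in> X" if "k \<in> X" "allowed k q" for k q
    using that iff[of k] gw_pos(1) by blast
  define Y where "Y = {p. Inl p \<in> X}"
  have "Y = UNIV"
  proof (rule dg.closed_set_UNIV[OF nc])
    show "q \<in> Y" if "p \<in> Y" "dg.follows p q" for p q
      using step[of "Inl p" q] that by (simp add: Y_def dg.follows_def)
    obtain k where k: "k \<in> X" using X by blast
    show "Y \<noteq> {}"
    proof (cases k)
      case (Inl p)
      then have "p \<in> Y" using k by (simp add: Y_def)
      then show ?thesis by blast
    next
      case (Inr i)
      have "{p. src p = i} \<noteq> {}" using dg.deg[of i] by (metis card.empty not_numeral_le_zero)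
      then obtain q where "src q = i" by blast
      then have "Inl q \<in> X" using step[OF k, of q] Inr by simp
      then have "q \<in> Y" by (simp add: Y_def)
      then show ?thesis by blast
    qed
  qed
  then have Inl: "Inl p \<in> X" for p by (auto simp: Y_def)
  have "k \<in> X" for k
  proof -
    have "l \<in> X" if "0 < gw k l" for l using that gw_pos(2) Inl by (cases l) auto
    then show ?thesis using iff by blast
  qed
  then show ?thesis by blast
qed

locale boundary_graph = green_graph +
  fixes D :: "real set" and Z :: "('b \<times> bool) + 'a \<Rightarrow> complex \<Rightarrow> complex"
  assumes finD: "finite D" and Z_upper: "z \<in> upper \<Longrightarrow> Z k z = \<zeta> k z"
    and Z_cont: "continuous_on (closed_upper_minus D) (Z k)"
    and Z_eq: "z \<in> closed_upper_minus D \<Longrightarrow> green_eq gw z (\<lambda>k. Z k z)"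
    and Z_dich: "E \<notin> D \<Longrightarrow> (\<forall>k. 0 < Im (Z k (complex_of_real E))) \<or>
      (\<exists>r>0. \<forall>E'. \<bar>E' - E\<bar> < r \<longrightarrow> E' \<notin> D \<and> (\<forall>k. Im (Z k (complex_of_real E')) = 0))"
begin

text \<open>Along a fixed word an entry is a product of finitely many \<zeta> and constants, so it
  extends wherever the \<zeta> reflect across the axis. S is any symmetric open set, so that discs
  and punctured discs are both covered.\<close>

lemma entries_extend:
  assumes S: "open S" "cnj ` S \<subseteq> S"
    and real: "\<And>x. complex_of_real x \<in> S \<Longrightarrow> x \<notin> D \<and> (\<forall>k. Im (Z k (complex_of_real x)) = 0)"
  shows "\<exists>F. (\<forall>x y. F x y holomorphic_on S) \<and>
    (\<forall>x y z. z \<in> S \<longrightarrow> Im z \<noteq> 0 \<longrightarrow> F x y z = ell2_apply (resolvent T z (ell2_delta y)) x)"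
proof -
  define Zr where "Zr k z = (if 0 \<le> Im z then Z k z else cnj (Z k (cnj z)))" for k z
  have hol: "Zr k holomorphic_on S" for k
    unfolding Zr_def
  proof (rule Schwarz_reflection[OF S])
    have "\<zeta> k holomorphic_on S \<inter> upper"
      using sol unfolding green_solution_def by (blast intro: holomorphic_on_subset)
    then show "Z k holomorphic_on S \<inter> {z. 0 < Im z}"
      by (rule holomorphic_transform) (simp add: Z_upper)
    have "S \<inter> {z. 0 \<le> Im z} \<subseteq> closed_upper_minus D" using real by (auto simp: closed_upper_minus_def)
    then show "continuous_on (S \<inter> {z. 0 \<le> Im z}) (Z k)" by (rule continuous_on_subset[OF Z_cont])
    fix z assume z: "z \<in> S" "z \<in> \<real>"
    then obtain x where x: "z = complex_of_real x" by (auto simp: Reals_def)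
    have "Im (Z k z) = 0" using real[of x] z(1) unfolding x by blast
    then show "Z k z \<in> \<real>" by (simp add: complex_is_Real_iff)
  qed
  have hol_psi: "(\<lambda>z. psi (\<lambda>k. Zr k z) i w) holomorphic_on S" for i w
  proof (induction w)
    case Nil
    show ?case using hol[of "Inr i"] by simp
  next
    case (Cons q w)
    show ?case
    proof (cases "allowed (state i w) q")
      case True
      have "(\<lambda>z. - Zr (Inl q) z * wt q * psi (\<lambda>k. Zr k z) i w) holomorphic_on S"
        by (intro holomorphic_intros hol Cons)
      then show ?thesis using True by simp
    qed simp
  qed
  have hol_col: "(\<lambda>z. green_column (\<lambda>k. Zr k z) i h x) holomorphic_on S" for i h x
    unfolding green_column_def Let_def
    by (cases "fst x = endpoint i (normal_form (snd x * inverse h))") (simp_all add: hol_psi)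
  have gv: "green_value z = (\<lambda>k. Zr k z)" if "Im z \<noteq> 0" for z
  proof
    fix k
    show "green_value z k = Zr k z"
      using that Z_upper[of z k] Z_upper[of "cnj z" k] by (auto simp: green_value_def Zr_def)
  qed
  show ?thesis
  proof (intro exI conjI allI impI)
    show "(\<lambda>x y z. green_column (\<lambda>k. Zr k z) (fst y) (snd y) x) x y holomorphic_on S" for x y
      by (rule hol_col)
    show "(\<lambda>x y z. green_column (\<lambda>k. Zr k z) (fst y) (snd y) x) x y z = ell2_apply (resolvent T z (ell2_delta y)) x"
      if "z \<in> S" "Im z \<noteq> 0" for x y z
      using resolvent_delta[OF that(2), of "fst y" "snd y"] gv[OF that(2)] by simp
  qed
qed

definition spec :: "real set" where
  "spec = {t. complex_of_real t \<in> spectrum T}"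

definition positive_at :: "real \<Rightarrow> bool" where
  "positive_at E \<longleftrightarrow> (\<forall>k. 0 < Im (Z k (complex_of_real E)))"

text \<open>The diagonal entry at the unit is \<zeta> of a vertex state, whose imaginary part near E
  stays above half its boundary value.\<close>

lemma positive_in_spec:
  assumes E: "E \<notin> D" "positive_at E" shows "E \<in> spec"
proof -
  fix i0 :: 'a
  let ?E = "complex_of_real E"
  define c where "c = Im (Z (Inr i0) ?E) / 2"
  have c: "0 < c" using E(2) by (simp add: c_def positive_at_def)
  have mem: "?E \<in> closed_upper_minus D" using E(1) by (simp add: of_real_in_closed_upper_minus)
  obtain \<eta>0 where \<eta>0: "0 < \<eta>0" "\<And>z. z \<in> closed_upper_minus D \<Longrightarrow> dist z ?E < \<eta>0 \<Longrightarrow> dist (Z (Inr i0) z) (Z (Inr i0) ?E) < c"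
    using Z_cont[of "Inr i0"] mem c unfolding continuous_on_iff by metis
  have "?E \<in> spectrum T"
  proof (rule spectrum_if_Im_entry_bounded_below[OF c \<eta>0(1), of E "(i0, 1)"])
    fix \<eta> assume \<eta>: "0 < \<eta>" "\<eta> < \<eta>0"
    define z where "z = Complex E \<eta>"
    have zu: "z \<in> upper" "Im z \<noteq> 0" "dist z ?E < \<eta>0" using \<eta> by (auto simp: z_def dist_norm cmod_def)
    have "z \<in> closed_upper_minus D" using zu(1) upper_subset_closed_upper_minus by blast
    then have "dist (Z (Inr i0) z) (Z (Inr i0) ?E) < c" using \<eta>0(2) zu(3) by blast
    then have "\<bar>Im (Z (Inr i0) z - Z (Inr i0) ?E)\<bar> < c"
      using abs_Im_le_cmod[of "Z (Inr i0) z - Z (Inr i0) ?E"] by (simp add: dist_norm)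
    then have "c \<le> Im (Z (Inr i0) z)" unfolding minus_complex.sel c_def by linarith
    moreover have "ell2_apply (resolvent T z (ell2_delta (i0, 1))) (i0, 1) = Z (Inr i0) z"
      unfolding resolvent_delta[OF zu(2)] green_column_diagonal green_value_upper[OF zu(1)] Z_upper[OF zu(1)] ..
    ultimately show "c \<le> Im (ell2_apply (resolvent T (Complex E \<eta>) (ell2_delta (i0, 1))) (i0, 1))"
      by (simp add: z_def)
  qed
  then show ?thesis by (simp add: spec_def)
qed

lemma real_mem_ball: "complex_of_real x \<in> ball (complex_of_real E) r \<longleftrightarrow> \<bar>x - E\<bar> < r"
  by (simp add: dist_of_real dist_real_def abs_minus_commute)

lemma cnj_ball: "cnj ` ball (complex_of_real E) r \<subseteq> ball (complex_of_real E) r"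
proof
  fix z assume "z \<in> cnj ` ball (complex_of_real E) r"
  then obtain y where y: "z = cnj y" "cmod (complex_of_real E - y) < r" by (auto simp: dist_norm)
  have "complex_of_real E - cnj y = cnj (complex_of_real E - y)" by simp
  then have "cmod (complex_of_real E - cnj y) < r" using y(2) by (metis complex_mod_cnj)
  then show "z \<in> ball (complex_of_real E) r" by (simp add: y(1) dist_norm)
qed

lemma not_positive_not_in_spec:
  assumes E: "E \<notin> D" "\<not> positive_at E" shows "E \<notin> spec"
proof -
  obtain r where r: "0 < r" "\<And>E'. \<bar>E' - E\<bar> < r \<Longrightarrow> E' \<notin> D \<and> (\<forall>k. Im (Z k (complex_of_real E')) = 0)"
    using Z_dich[OF E(1)] E(2) unfolding positive_at_def by blast
  have "\<exists>F. (\<forall>x y. F x y holomorphic_on ball (complex_of_real E) r) \<and>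
    (\<forall>x y z. z \<in> ball (complex_of_real E) r \<longrightarrow> Im z \<noteq> 0 \<longrightarrow> F x y z = ell2_apply (resolvent T z (ell2_delta y)) x)"
  proof (rule entries_extend[OF open_ball cnj_ball])
    show "x \<notin> D \<and> (\<forall>k. Im (Z k (complex_of_real x)) = 0)" if "complex_of_real x \<in> ball (complex_of_real E) r" for x
      using that r(2) unfolding real_mem_ball by blast
  qed
  then obtain F where F: "\<forall>x y. F x y holomorphic_on ball (complex_of_real E) r"
    "\<forall>x y z. z \<in> ball (complex_of_real E) r \<longrightarrow> Im z \<noteq> 0 \<longrightarrow> F x y z = ell2_apply (resolvent T z (ell2_delta y)) x"
    by (elim exE conjE)
  have "complex_of_real E \<notin> spectrum T"
  proof (rule holomorphic_entries_not_spectrum[OF r(1)])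
    show "F x y holomorphic_on ball (complex_of_real E) r" for x y using F(1) by blast
    show "F x y z = ell2_apply (resolvent T z (ell2_delta y)) x"
      if "z \<in> ball (complex_of_real E) r" "Im z \<noteq> 0" for x y z using F(2) that by blast
  qed
  then show ?thesis by (simp add: spec_def)
qed

lemma in_spec_iff: "E \<notin> D \<Longrightarrow> E \<in> spec \<longleftrightarrow> positive_at E"
  using positive_in_spec not_positive_not_in_spec by blast

lemma closed_spec: "closed spec"
proof -
  have "open (- spec)"
    unfolding open_dist
  proof
    fix E assume "E \<in> - spec"
    then have "complex_of_real E \<notin> spectrum T" by (simp add: spec_def)
    then show "\<exists>e>0. \<forall>y. dist y E < e \<longrightarrow> y \<in> - spec"
      using not_spectrum_neighbourhood[of E] by (simp add: spec_def dist_real_def)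
  qed
  then show ?thesis by (simp add: closed_def)
qed

text \<open>One positive component at E stays positive nearby, and by the dichotomy it excludes the
  real alternative there.\<close>

lemma open_spec_minus: "open (spec - D)"
  unfolding open_dist
proof
  fix E assume "E \<in> spec - D"
  then have E: "E \<notin> D" "positive_at E" using in_spec_iff by auto
  fix i0 :: 'a
  let ?E = "complex_of_real E" and ?k = "Inr i0"
  have c: "0 < Im (Z ?k ?E)" using E(2) by (simp add: positive_at_def)
  have mem: "?E \<in> closed_upper_minus D" using E(1) by (simp add: of_real_in_closed_upper_minus)
  obtain e1 where e1: "0 < e1" "\<And>z. z \<in> closed_upper_minus D \<Longrightarrow> dist z ?E < e1 \<Longrightarrow> dist (Z ?k z) (Z ?k ?E) < Im (Z ?k ?E)"
    using Z_cont[of ?k] mem c unfolding continuous_on_iff by metis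
  have "open (- D)" using finD by (simp add: finite_imp_closed open_Compl)
  then obtain e2 where e2: "0 < e2" "\<And>y. dist y E < e2 \<Longrightarrow> y \<notin> D" using E(1) unfolding open_dist by auto
  have "y \<in> spec - D" if y: "dist y E < min e1 e2" for y
  proof -
    have yD: "y \<notin> D" using e2(2) y by simp
    then have my: "complex_of_real y \<in> closed_upper_minus D" by (simp add: of_real_in_closed_upper_minus)
    have "dist (Z ?k (complex_of_real y)) (Z ?k ?E) < Im (Z ?k ?E)"
      using y by (intro e1(2)[OF my]) (simp add: dist_of_real)
    then have "\<bar>Im (Z ?k (complex_of_real y) - Z ?k ?E)\<bar> < Im (Z ?k ?E)"
      using abs_Im_le_cmod[of "Z ?k (complex_of_real y) - Z ?k ?E"] unfolding dist_norm by linarith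
    then have "Im (Z ?k (complex_of_real y)) \<noteq> 0" unfolding minus_complex.sel by linarith
    moreover have "\<bar>y - y\<bar> < r" if "0 < r" for r :: real using that by simp
    ultimately have "positive_at y" using Z_dich[OF yD] unfolding positive_at_def by blast
    then show ?thesis using yD in_spec_iff by blast
  qed
  then show "\<exists>e>0. \<forall>y. dist y E < e \<longrightarrow> y \<in> spec - D" using e1(1) e2(1) by (intro exI[of _ "min e1 e2"]) simp
qed

lemma spectrum_eq: "spectrum T = complex_of_real ` spec"
proof
  show "complex_of_real ` spec \<subseteq> spectrum T" by (auto simp: spec_def)
  show "spectrum T \<subseteq> complex_of_real ` spec"
  proof
    fix z assume z: "z \<in> spectrum T"
    then have "Im z = 0" using nonreal_not_spectrum by blast
    then have "z = complex_of_real (Re z)" by (simp add: complex_eq_iff)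
    then show "z \<in> complex_of_real ` spec" using z unfolding spec_def by (metis (mono_tags, lifting) imageI mem_Collect_eq)
  qed
qed

lemma isolated_eigenvalue:
  assumes E: "E \<in> spec" and r: "0 < r" "\<And>E'. E' \<noteq> E \<Longrightarrow> \<bar>E' - E\<bar> < r \<Longrightarrow> E' \<notin> spec"
  shows "eigenvalue T (complex_of_real E)"
proof -
  let ?E = "complex_of_real E"
  obtain d where d: "0 < d" "\<And>x. x \<in> D \<Longrightarrow> x \<noteq> E \<Longrightarrow> d \<le> dist E x" using finite_set_avoid[OF finD] by blast
  \<comment> \<open>The punctured interval avoids the spectrum and all other points of D, so the
    boundary values on it are real and reflection applies.\<close>
  define s where "s = min r d"
  have s: "0 < s" using r d by (simp add: s_def)
  let ?S = "ball ?E s - {?E}"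
  have "\<exists>F. (\<forall>x y. F x y holomorphic_on ?S) \<and>
    (\<forall>x y z. z \<in> ?S \<longrightarrow> Im z \<noteq> 0 \<longrightarrow> F x y z = ell2_apply (resolvent T z (ell2_delta y)) x)"
  proof (rule entries_extend)
    show "open ?S" by (intro open_Diff open_ball closed_singleton)
    show "cnj ` ?S \<subseteq> ?S"
    proof
      fix z assume "z \<in> cnj ` ?S"
      then obtain y where y: "z = cnj y" "y \<in> ball ?E s" "y \<noteq> ?E" by blast
      have "z \<in> ball ?E s" using cnj_ball y by blast
      moreover have "z \<noteq> ?E" using y(1,3) by (metis complex_cnj_cnj complex_cnj_complex_of_real)
      ultimately show "z \<in> ?S" by blast
    qed
    fix x assume x: "complex_of_real x \<in> ?S"
    then have xE: "x \<noteq> E" "\<bar>x - E\<bar> < s" using real_mem_ball by auto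
    have xD: "x \<notin> D" using d(2)[of x] xE by (auto simp: s_def dist_real_def)
    have "\<not> positive_at x" using r(2)[OF xE(1)] xE(2) in_spec_iff[OF xD] by (simp add: s_def)
    then obtain e where "0 < e" "\<forall>E'. \<bar>E' - x\<bar> < e \<longrightarrow> E' \<notin> D \<and> (\<forall>k. Im (Z k (complex_of_real E')) = 0)"
      using Z_dich[OF xD] unfolding positive_at_def by blast
    then show "x \<notin> D \<and> (\<forall>k. Im (Z k (complex_of_real x)) = 0)" by simp
  qed
  then obtain F where F: "\<forall>x y. F x y holomorphic_on ?S"
    "\<forall>x y z. z \<in> ?S \<longrightarrow> Im z \<noteq> 0 \<longrightarrow> F x y z = ell2_apply (resolvent T z (ell2_delta y)) x"
    by (elim exE conjE)
  show ?thesis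
  proof (rule isolated_singularity_eigenvalue[OF s])
    show "F x y holomorphic_on ?S" for x y using F(1) by blast
    show "F x y z = ell2_apply (resolvent T z (ell2_delta y)) x" if "z \<in> ball ?E s" "Im z \<noteq> 0" for x y z
    proof -
      have "z \<noteq> ?E" using that(2) by auto
      then show ?thesis using F(2) that by blast
    qed
    show "?E \<in> spectrum T" using E by (simp add: spec_def)
  qed
qed

lemma spectrum_bands:
  "\<exists>J D0. finite J \<and> (\<forall>(x, y)\<in>J. x < y) \<and> finite D0 \<and> D0 \<subseteq> D \<and>
    (\<forall>x\<in>D0. eigenvalue T (complex_of_real x)) \<and>
    spectrum T = complex_of_real ` ((\<Union>(x, y)\<in>J. {x..y}) \<union> D0)"
proof -
  define D0 where "D0 = {E \<in> D \<inter> spec. \<exists>r>0. \<forall>E'. E' \<noteq> E \<longrightarrow> \<bar>E' - E\<bar> < r \<longrightarrow> E' \<notin> spec}"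
  obtain J where J: "finite J" "\<forall>(x, y)\<in>J. x < y" "spec = (\<Union>(x, y)\<in>J. {x..y}) \<union> D0"
  proof -
    obtain B where B: "\<forall>t\<in>spec. \<bar>t\<bar> \<le> B" using spectrum_norm_bound unfolding spec_def by blast
    have "\<exists>J. finite J \<and> (\<forall>(x, y)\<in>J. x < y) \<and> spec = (\<Union>(x, y)\<in>J. {x..y}) \<union> D0"
      unfolding D0_def
    proof (rule finite_band_structure[OF finD _ closed_spec open_spec_minus])
      show "\<bar>t\<bar> \<le> B" if "t \<in> spec" for t using B that by blast
    qed
    then show ?thesis using that by blast
  qed
  have "finite D0" "D0 \<subseteq> D" unfolding D0_def using finD by auto
  moreover have "\<forall>x\<in>D0. eigenvalue T (complex_of_real x)"
  proof
    fix x assume "x \<in> D0"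
    then obtain r where "x \<in> spec" "0 < r" "\<forall>E'. E' \<noteq> x \<longrightarrow> \<bar>E' - x\<bar> < r \<longrightarrow> E' \<notin> spec" unfolding D0_def by blast
    then show "eigenvalue T (complex_of_real x)" by (intro isolated_eigenvalue[of x r]) simp_all
  qed
  ultimately show ?thesis using J spectrum_eq by (intro exI[of _ J] exI[of _ D0]) simp
qed

section \<open>Uniform estimates on a closed interval inside a band\<close>

context
  fixes x y :: real
  assumes xy: "x \<le> y" and sub: "{x..y} \<subseteq> interior (spec - D)"
begin

text \<open>Compactness of the rectangle of heights 0 to 1 over the interval: its bottom edge avoids
  D and consists of positive points, so continuity up to the boundary gives both bounds.\<close>

lemma band_bounds:
  "\<exists>c C. 0 < c \<and> (\<forall>z k. Re z \<in> {x..y} \<longrightarrow> 0 \<le> Im z \<longrightarrow> Im z \<le> 1 \<longrightarrow>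
    c \<le> Im (Z k z) \<and> cmod (Z k z) \<le> C)"
proof -
  define Q where "Q = cbox (Complex x 0) (Complex y 1)"
  have Q: "z \<in> Q \<longleftrightarrow> Re z \<in> {x..y} \<and> 0 \<le> Im z \<and> Im z \<le> 1" for z
    by (auto simp: Q_def in_cbox_complex_iff)
  have pos: "E \<notin> D \<and> positive_at E" if "E \<in> {x..y}" for E
    using that sub interior_subset in_spec_iff by blast
  have QS: "Q \<subseteq> closed_upper_minus D"
  proof
    fix z assume z: "z \<in> Q"
    then have "Re z \<notin> D" using pos Q by blast
    then show "z \<in> closed_upper_minus D" using z Q by (auto simp: closed_upper_minus_def)
  qed
  have Im_pos: "0 < Im (Z k z)" if z: "z \<in> Q" for k z
  proof (cases "Im z = 0")
    case True
    then have "z = complex_of_real (Re z)" by (simp add: complex_eq_iff)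
    then show ?thesis using pos[of "Re z"] z Q unfolding positive_at_def by metis
  next
    case False
    then have "z \<in> upper" using z Q by simp
    then show ?thesis using Z_upper sol unfolding green_solution_def by simp
  qed
  have cQ: "compact Q" unfolding Q_def by (rule compact_cbox)
  have neQ: "Q \<noteq> {}" using Q[of "Complex x 0"] xy by auto
  have cont: "continuous_on Q (Z k)" for k by (rule continuous_on_subset[OF Z_cont QS])
  have "\<exists>c. 0 < c \<and> (\<forall>z\<in>Q. c \<le> Im (Z k z))" for k
  proof -
    obtain z0 where "z0 \<in> Q" "\<forall>z\<in>Q. Im (Z k z0) \<le> Im (Z k z)"
      using continuous_attains_inf[OF cQ neQ continuous_on_Im[OF cont[of k]]] by blast
    then show ?thesis using Im_pos by blast
  qed
  then have "\<forall>k. \<exists>c. 0 < c \<and> (\<forall>z\<in>Q. c \<le> Im (Z k z))" by blast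
  from choice[OF this] obtain ck where ck: "\<forall>k. 0 < ck k \<and> (\<forall>z\<in>Q. ck k \<le> Im (Z k z))" by (rule exE)
  have "\<exists>C. \<forall>z\<in>Q. cmod (Z k z) \<le> C" for k
    using continuous_attains_sup[OF cQ neQ continuous_on_norm[OF cont[of k]]] by blast
  then have "\<forall>k. \<exists>C. \<forall>z\<in>Q. cmod (Z k z) \<le> C" by blast
  from choice[OF this] obtain Ck where Ck: "\<forall>k. \<forall>z\<in>Q. cmod (Z k z) \<le> Ck k" by (rule exE)
  define c C where "c = Min (range ck)" and "C = Max (range Ck)"
  have c: "0 < c" "c \<le> ck k" for k unfolding c_def using ck by auto
  have C: "Ck k \<le> C" for k unfolding C_def by simp
  have "c \<le> Im (Z k z) \<and> cmod (Z k z) \<le> C" if "z \<in> Q" for k z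
  proof -
    have "ck k \<le> Im (Z k z)" "cmod (Z k z) \<le> Ck k" using ck Ck that by blast+
    then show ?thesis using c(2)[of k] C[of k] by linarith
  qed
  then show ?thesis using c(1) Q by (intro exI[of _ c] exI[of _ C]) simp
qed

lemma band_ACmat: "ACmat (graph_poly H a) {x..y}"
proof -
  obtain c C where c: "0 < c" and b: "\<And>z k. Re z \<in> {x..y} \<Longrightarrow> 0 \<le> Im z \<Longrightarrow> Im z \<le> 1 \<Longrightarrow>
    c \<le> Im (Z k z) \<and> cmod (Z k z) \<le> C"
    using band_bounds by blast
  define n where "n = real CARD('a)"
  have n: "1 \<le> n" unfolding n_def by (simp add: Suc_le_eq)
  define C0 where "C0 = max 1 (max (inverse c) (n * C))"
  show ?thesis
    unfolding ACmat_def
  proof (intro exI conjI ballI allI impI)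
    show "1 \<le> C0" by (simp add: C0_def)
    fix E \<eta> :: real assume E: "E \<in> {x..y}" and \<eta>: "0 < \<eta> \<and> \<eta> \<le> 1"
    define z where "z = Complex E \<eta>"
    have z: "z \<in> upper" "Re z \<in> {x..y}" "0 \<le> Im z" "Im z \<le> 1" using E \<eta> by (auto simp: z_def)
    have tr: "Re (trace (block (Im_resolvent (graph_poly H a) (Complex E \<eta>)) 1 1)) = (\<Sum>i\<in>UNIV. Im (Z (Inr i) z))"
      using trace_block_Im_resolvent[OF z(1)] Z_upper[OF z(1)] by (simp add: z_def)
    have low: "c \<le> Im (Z (Inr i) z)" and up: "Im (Z (Inr i) z) \<le> C" for i
      using b[OF z(2-4), of "Inr i"] abs_Im_le_cmod[of "Z (Inr i) z"] by linarith+
    have "inverse C0 \<le> c"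
    proof -
      have "inverse c \<le> C0" unfolding C0_def by simp
      then have "inverse C0 \<le> inverse (inverse c)" using c by (intro le_imp_inverse_le) auto
      then show ?thesis by simp
    qed
    also have "c \<le> n * c" using n c by simp
    also have "n * c = (\<Sum>i\<in>(UNIV :: 'a set). c)" by (simp add: n_def)
    also have "\<dots> \<le> (\<Sum>i\<in>UNIV. Im (Z (Inr i) z))" by (intro sum_mono low)
    finally show "inverse C0 \<le> Re (trace (block (Im_resolvent (graph_poly H a) (Complex E \<eta>)) 1 1))" unfolding tr .
    have "(\<Sum>i\<in>UNIV. Im (Z (Inr i) z)) \<le> (\<Sum>i\<in>(UNIV :: 'a set). C)" by (intro sum_mono up)
    also have "\<dots> = n * C" by (simp add: n_def)
    also have "\<dots> \<le> C0" unfolding C0_def by simp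
    finally show "Re (trace (block (Im_resolvent (graph_poly H a) (Complex E \<eta>)) 1 1)) \<le> C0" unfolding tr .
  qed
qed

text \<open>The sum without the factor \<eta>^2 is bounded by a constant B uniformly in E and
  \<eta>, since exponential decay in the reduced length beats any power of the word length; then
  \<eta>^2 B tends to 0.\<close>

lemma band_R4mat:
  assumes dg: "dart_graph src tgt dart_rev" and nc: "\<not> is_orbit_cycle src tgt dart_rev"
    and a: "\<And>i. a i \<noteq> 0" and gen: "generates G"
  shows "R4mat (graph_poly H a) G C1 {x..y}"
proof -
  obtain c C where c: "0 < c" and b: "\<And>z k. Re z \<in> {x..y} \<Longrightarrow> 0 \<le> Im z \<Longrightarrow> Im z \<le> 1 \<Longrightarrow>
    c \<le> Im (Z k z) \<and> cmod (Z k z) \<le> C"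
    using band_bounds by blast
  obtain N where N: "dart_graph.unbranched src tgt dart_rev N = {}"
    using dart_graph.unbranched_empty[OF dg nc] by blast
  obtain K where K: "\<And>g. word_length G g \<le> K * length (normal_form g)"
    using word_length_linear_bound[OF gen] by blast
  define wmin where "wmin = Min (range (\<lambda>q. (cmod (wt q))\<^sup>2))"
  have wmin: "0 < wmin" "wmin \<le> (cmod (wt q))\<^sup>2" for q
    unfolding wmin_def using a by (auto simp: dart_weight_def)
  \<comment> \<open>Above the required threshold, and nonnegative so that \<open>powr\<close> is
    monotone in its base.\<close>
  define p where "p = max (2 * C1 + 2) 0"
  \<comment> \<open>The decay rate depends on c, C, wmin and N only, although the estimates are made
    at a given z; this is the source of uniformity.\<close>
  define \<rho> where "\<rho> = rho c C wmin N"
  define M where "M = (C\<^sup>2 / c)\<^sup>2 * (C / (theta c C wmin)\<^sup>2) * C"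
  have ctx: "green_eq gw z (\<lambda>k. \<zeta> k z)" "\<And>k. c \<le> Im (\<zeta> k z)" "\<And>k. cmod (\<zeta> k z) \<le> C"
    if "z \<in> upper" "Re z \<in> {x..y}" "Im z \<le> 1" for z
  proof -
    show "green_eq gw z (\<lambda>k. \<zeta> k z)" using sol that(1) unfolding green_solution_def by blast
    have "0 \<le> Im z" using that(1) by simp
    then show "c \<le> Im (\<zeta> k z)" "cmod (\<zeta> k z) \<le> C" for k
      using b[OF that(2) _ that(3), of k] Z_upper[OF that(1), of k] by simp_all
  qed
  have sums: "(\<Sum>w\<in>words n. (cmod (psi (\<lambda>k. \<zeta> k z) i w)) ^ 4) \<le> M * \<rho> ^ n" and \<rho>: "0 < \<rho>" "\<rho> < 1"
    if z: "z \<in> upper" "Re z \<in> {x..y}" "Im z \<le> 1" for z n i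
  proof -
    have z0: "0 \<le> Im z" using z(1) by simp
    show "(\<Sum>w\<in>words n. (cmod (psi (\<lambda>k. \<zeta> k z) i w)) ^ 4) \<le> M * \<rho> ^ n"
      unfolding M_def \<rho>_def by (rule psi_fourth_power_sum[OF dg N ctx(1)[OF z] z0 c ctx(2)[OF z] ctx(3)[OF z] wmin])
    show "0 < \<rho>" "\<rho> < 1"
      unfolding \<rho>_def by (rule rho_bounds[OF dg N ctx(1)[OF z] z0 c ctx(2)[OF z] ctx(3)[OF z] wmin])+
  qed
  define n where "n = real CARD('a)"
  define B where "B = suminf (\<lambda>m. n * (n * M) * (real K powr p) * (real m powr p * \<rho> ^ m))"
  have main: "(\<Sum>\<^sub>\<infinity>g. ennreal (\<eta>\<^sup>2 * hs_norm (block (Im_resolvent (graph_poly H a) (Complex E \<eta>)) 1 g) ^ 4 *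
      real (word_length G g) powr p)) \<le> ennreal (\<eta>\<^sup>2 * B)"
    if E: "E \<in> {x..y}" and \<eta>: "0 < \<eta>" "\<eta> \<le> 1" for E \<eta>
  proof (rule infsum_le_finite_sums)
    show "(\<lambda>g. ennreal (\<eta>\<^sup>2 * hs_norm (block (Im_resolvent (graph_poly H a) (Complex E \<eta>)) 1 g) ^ 4 *
      real (word_length G g) powr p)) summable_on UNIV"
      by (rule nonneg_summable_on_complete) simp
    fix F :: "'b free_group set" assume F: "finite F"
    define z where "z = Complex E \<eta>"
    have z: "z \<in> upper" "Re z \<in> {x..y}" "Im z \<le> 1" using E \<eta> by (auto simp: z_def)
    note \<rho> = \<rho>[OF z]
    \<comment> \<open>The constant bounds a sum of fourth powers at level 0, hence is
      nonnegative.\<close>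
    have M0: "0 \<le> M"
    proof -
      have "0 \<le> (\<Sum>w\<in>words 0. (cmod (psi (\<lambda>k. \<zeta> k z) undefined w)) ^ 4)" by (intro sum_nonneg) simp
      also have "\<dots> \<le> M * \<rho> ^ 0" by (rule sums[OF z])
      finally show ?thesis by simp
    qed
    let ?h = "\<lambda>g. hs_norm (block (Im_resolvent (graph_poly H a) (Complex E \<eta>)) 1 g) ^ 4"
    let ?s = "\<lambda>w. n * (\<Sum>i\<in>UNIV. cmod (psi (\<lambda>k. \<zeta> k z) i w) ^ 4) * ((real K * real (length w)) powr p)"
    have term_le: "?h g * real (word_length G g) powr p \<le> ?s (normal_form g)" for g
    proof (rule mult_mono)
      show "?h g \<le> n * (\<Sum>i\<in>UNIV. cmod (psi (\<lambda>k. \<zeta> k z) i (normal_form g)) ^ 4)"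
        using hs_norm_block_fourth[OF z(1), of g] by (simp add: z_def n_def)
      have "real (word_length G g) \<le> real K * real (length (normal_form g))"
        using K[of g] by (simp only: of_nat_mult[symmetric] of_nat_le_iff)
      then show "real (word_length G g) powr p \<le> (real K * real (length (normal_form g))) powr p"
        by (intro powr_mono2) (auto simp: p_def)
    qed (auto simp: n_def sum_nonneg)
    have inj: "inj_on normal_form F" using bij_normal_form by (auto simp: bij_betw_def intro: inj_on_subset)
    define L where "L = Suc (Max (insert 0 (length ` normal_form ` F)))"
    have nfL: "normal_form ` F \<subseteq> (\<Union>m\<in>{..<L}. words m)"
    proof
      fix w assume "w \<in> normal_form ` F"
      then have "length w \<le> Max (insert 0 (length ` normal_form ` F))" using F by (intro Max_ge) auto
      then show "w \<in> (\<Union>m\<in>{..<L}. words m)" unfolding L_def by auto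
    qed
    have s_nonneg: "0 \<le> ?s w" for w by (intro mult_nonneg_nonneg sum_nonneg) (auto simp: n_def)
    have "(\<Sum>g\<in>F. ?h g * real (word_length G g) powr p) \<le> (\<Sum>g\<in>F. ?s (normal_form g))" by (intro sum_mono term_le)
    also have "\<dots> = (\<Sum>w\<in>normal_form ` F. ?s w)" by (simp only: sum.reindex[OF inj] o_def)
    also have "\<dots> \<le> (\<Sum>w\<in>(\<Union>m\<in>{..<L}. words m). ?s w)"
      using nfL finite_words s_nonneg by (intro sum_mono2) auto
    also have "\<dots> = (\<Sum>m<L. \<Sum>w\<in>words m. ?s w)"
      using finite_words by (intro sum.UNION_disjoint) auto
    also have "\<dots> \<le> (\<Sum>m<L. n * (n * M) * (real K powr p) * (real m powr p * \<rho> ^ m))"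
    proof (rule sum_mono)
      fix m assume "m \<in> {..<L}"
      have "(\<Sum>w\<in>words m. ?s w) = (\<Sum>w\<in>words m. n * ((real K * real m) powr p) * (\<Sum>i\<in>UNIV. cmod (psi (\<lambda>k. \<zeta> k z) i w) ^ 4))"
        by (intro sum.cong) (auto simp: mult_ac)
      also have "\<dots> = n * ((real K * real m) powr p) * (\<Sum>i\<in>UNIV. \<Sum>w\<in>words m. cmod (psi (\<lambda>k. \<zeta> k z) i w) ^ 4)"
        by (simp only: sum_distrib_left[symmetric] sum.swap[of _ UNIV])
      also have "\<dots> \<le> n * ((real K * real m) powr p) * (\<Sum>i\<in>(UNIV :: 'a set). M * \<rho> ^ m)"
        by (intro mult_left_mono sum_mono sums[OF z]) (simp add: n_def)
      also have "\<dots> = n * (n * M) * (real K powr p) * (real m powr p * \<rho> ^ m)"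
        by (simp add: n_def powr_mult mult_ac)
      finally show "(\<Sum>w\<in>words m. ?s w) \<le> n * (n * M) * (real K powr p) * (real m powr p * \<rho> ^ m)" .
    qed
    also have "\<dots> \<le> B"
      unfolding B_def using M0 \<rho>
      by (intro sum_le_suminf summable_mult summable_powr_geometric) (auto simp: n_def)
    finally have fin: "(\<Sum>g\<in>F. ?h g * real (word_length G g) powr p) \<le> B" .
    have "(\<Sum>g\<in>F. ennreal (\<eta>\<^sup>2 * ?h g * real (word_length G g) powr p)) = ennreal (\<Sum>g\<in>F. \<eta>\<^sup>2 * ?h g * real (word_length G g) powr p)"
      by (intro sum_ennreal) simp
    also have "(\<Sum>g\<in>F. \<eta>\<^sup>2 * ?h g * real (word_length G g) powr p) = \<eta>\<^sup>2 * (\<Sum>g\<in>F. ?h g * real (word_length G g) powr p)"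
      by (simp only: sum_distrib_left mult.assoc)
    also have "ennreal \<dots> \<le> ennreal (\<eta>\<^sup>2 * B)" using fin by (intro ennreal_leI mult_left_mono) simp_all
    finally show "(\<Sum>g\<in>F. ennreal (\<eta>\<^sup>2 * ?h g * real (word_length G g) powr p)) \<le> ennreal (\<eta>\<^sup>2 * B)" .
  qed
  show ?thesis
    unfolding R4mat_def
  proof (intro exI conjI)
    show "p > 2 * C1 + 1" by (simp add: p_def)
    let ?S = "\<lambda>\<eta>. SUP E\<in>{x..y}. \<Sum>\<^sub>\<infinity>g. ennreal (\<eta>\<^sup>2 *
      hs_norm (block (Im_resolvent (graph_poly H a) (Complex E \<eta>)) 1 g) ^ 4 * real (word_length G g) powr p)"
    have ev: "\<forall>\<^sub>F \<eta> in at_right 0. ?S \<eta> \<le> ennreal (\<eta>\<^sup>2 * B)"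
      unfolding eventually_at_right_field using main by (intro exI[of _ 1]) (auto intro!: SUP_least)
    have "((\<lambda>\<eta> :: real. \<eta>\<^sup>2 * B) \<longlongrightarrow> 0\<^sup>2 * B) (at_right 0)" by (intro tendsto_intros)
    then have "((\<lambda>\<eta>. ennreal (\<eta>\<^sup>2 * B)) \<longlongrightarrow> ennreal (0\<^sup>2 * B)) (at_right 0)" by (rule tendsto_ennrealI)
    then have lim: "((\<lambda>\<eta>. ennreal (\<eta>\<^sup>2 * B)) \<longlongrightarrow> 0) (at_right 0)" by simp
    show "(?S \<longlongrightarrow> 0) (at_right 0)"
      by (rule tendsto_sandwich[OF _ ev tendsto_const lim]) simp
  qed
qed

end

end

theorem proposition6p19:
  fixes H :: "('r::finite, 'd::finite) pre_digraph"
    and a :: "'d \<Rightarrow> complex"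
    and S :: "'d free_group set"
    and C1 :: real
  assumes "verts H = UNIV" and "arcs H = UNIV"
    and "Digraph_Component.connected H"
    and "\<not> is_cycle H"
    and "\<And>x. 2 \<le> vertex_degree H x"
    and "\<And>i. a i \<noteq> 0"
    and "finite S" and "generates S"
    and "rapid_decay_exponent TYPE('d) C1"
  defines "p \<equiv> graph_poly H a"
  shows "\<exists>D :: real set. finite D \<and>
    (\<exists>J D0. finite J \<and> (\<forall>(x, y)\<in>J. x < y) \<and>
       finite D0 \<and> D0 \<subseteq> D \<and> (\<forall>x\<in>D0. eigenvalue (lambda_matrix p) (complex_of_real x)) \<and>
       spectrum (lambda_matrix p) = complex_of_real ` ((\<Union>(x, y)\<in>J. {x..y}) \<union> D0)) \<and>
    (\<forall>x y. x \<le> y \<longrightarrow>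
       {x..y} \<subseteq> interior ({t. complex_of_real t \<in> spectrum (lambda_matrix p)} - D) \<longrightarrow>
       ACmat p {x..y} \<and> R4mat p S C1 {x..y})"
proof -
  interpret weighted_graph H a by unfold_locales (rule assms(2))
  have dg: "dart_graph src tgt dart_rev" by (rule dart_graph_of_digraph[OF assms(1-3,5)])
  have nc: "\<not> is_orbit_cycle src tgt dart_rev" using orbit_cycle_is_cycle[OF assms(1,2)] assms(4) by blast
  obtain \<zeta> where \<zeta>: "green_solution gw \<zeta>" using green_solution_exists[of gw, OF gw_nonneg] by blast
  have "\<exists>D Z. finite D \<and> (\<forall>k. \<forall>z\<in>upper. Z k z = \<zeta> k z) \<and>
    (\<forall>k. continuous_on (closed_upper_minus D) (Z k)) \<and>
    (\<forall>z\<in>closed_upper_minus D. green_eq gw z (\<lambda>k. Z k z)) \<and>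
    (\<forall>E. E \<notin> D \<longrightarrow> (\<forall>k. 0 < Im (Z k (complex_of_real E))) \<or>
      (\<exists>r>0. \<forall>E'. \<bar>E' - E\<bar> < r \<longrightarrow> E' \<notin> D \<and> (\<forall>k. Im (Z k (complex_of_real E')) = 0)))"
    by (rule boundary_values[OF gw_nonneg \<zeta>]) (rule gw_irreducible[OF dg nc assms(6)])
  then obtain D Z where D: "finite D" "\<forall>k. \<forall>z\<in>upper. Z k z = \<zeta> k z"
    "\<forall>k. continuous_on (closed_upper_minus D) (Z k)"
    "\<forall>z\<in>closed_upper_minus D. green_eq gw z (\<lambda>k. Z k z)"
    "\<forall>E. E \<notin> D \<longrightarrow> (\<forall>k. 0 < Im (Z k (complex_of_real E))) \<or>
      (\<exists>r>0. \<forall>E'. \<bar>E' - E\<bar> < r \<longrightarrow> E' \<notin> D \<and> (\<forall>k. Im (Z k (complex_of_real E')) = 0))"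
    by (elim exE conjE)
  interpret boundary_graph H a \<zeta> D Z
    by unfold_locales (use \<zeta> D in \<open>blast+\<close>)
  show ?thesis
    unfolding p_def
  proof (intro exI[of _ D] conjI allI impI)
    show "finite D" by (rule D(1))
    show "\<exists>J D0. finite J \<and> (\<forall>(x, y)\<in>J. x < y) \<and> finite D0 \<and> D0 \<subseteq> D \<and>
      (\<forall>x\<in>D0. eigenvalue T (complex_of_real x)) \<and>
      spectrum T = complex_of_real ` ((\<Union>(x, y)\<in>J. {x..y}) \<union> D0)"
      by (rule spectrum_bands)
    fix x y :: real
    assume xy: "x \<le> y" and sub: "{x..y} \<subseteq> interior ({t. complex_of_real t \<in> spectrum T} - D)"
    \<comment> \<open>The interior is taken of the spectrum without D, so the interval avoids D and
      consists of points where all boundary values are positive.\<close>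
    note sub' = sub[folded spec_def]
    show "ACmat (graph_poly H a) {x..y}" by (rule band_ACmat[OF xy sub'])
    show "R4mat (graph_poly H a) S C1 {x..y}" by (rule band_R4mat[OF xy sub' dg nc assms(6,8)])
  qed
qed

end
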